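(* Let $G$ be a finitely generated residually finite amenable group. Then $G$ admits a sequence of finite subsets $F_i$ with the following property: an ergodic invariant random subgroup $\mu$ of $G$ is co-sofic if and only if $\mu$-almost every subgroup $H$ is Weiss approximated by $(K_i,F_i)$ for some sequence $K_i$ of finite index subgroups of $G$.
   Context: For a countable discrete group $G$, $\mathrm{Sub}(G)\subset\{0,1\}^G$ is the compact space of all subgroups of $G$ with the topology induced from the product topology (the Chabauty topology), on which $G$ acts by conjugation. $\mathcal{P}(G)$ is the space of Borel probability measures on $\mathrm{Sub}(G)$ with the weak-$*$ topology, and $d$ is any compatible metric on $\mathcal{P}(G)$. An invariant random subgroup is a conjugation-invariant $\mu\in\mathcal{P}(G)$; $\mathrm{IRS}(G)$ is the set of these. It is ergodic if it is an extreme point of the compact convex set $\mathrm{IRS}(G)$. $\mathrm{IRS}_{\mathrm{fi}}(G)$ is the set of $\mu\in\mathrm{IRS}(G)$ giving measure one to the set of finite index subgroups; $\mu\in\mathrm{IRS}(G)$ is co-sofic if it lies in the weak-$*$ closure of $\mathrm{IRS}_{\mathrm{fi}}(G)$. A (left) transversal of a subgroup $L\le G$ is a subset of $G$ containing exactly one element of each left coset $gL$. A subgroup $H\le G$ is Weiss approximated by $(K_i,F_i)$ (i.e. $(K_i,F_i)_{i\in\mathbb{N}}$ is a Weiss approximation for $H$) if for every $i$, $K_i\le G$ is a finite index subgroup and $F_i$ is a finite union of disjoint transversals of the normalizer $\mathrm{N}_G(K_i)$ in $G$, and $$\lim_{i\to\infty}d\left(\frac1{|F_i|}\sum_{f\in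 F_i}\delta_{fK_if^{-1}},\ \frac1{|F_i|}\sum_{f\in F_i}\delta_{fHf^{-1}}\right)=0.$$ *)

theory Defs
  imports "HOL-Algebra.Generated_Groups" "HOL-Algebra.Group_Action" "HOL-Probability.Probability"
begin

section \<open>Groups\<close>

definition finite_index_subgroup :: "('a, 'b) monoid_scheme \<Rightarrow> 'a set \<Rightarrow> bool" where
  "finite_index_subgroup G K \<longleftrightarrow> subgroup K G \<and> finite (rcosets\<^bsub>G\<^esub> K)"

definition finitely_generated_group :: "('a, 'b) monoid_scheme \<Rightarrow> bool" where
  "finitely_generated_group G \<longleftrightarrow>
     group G \<and> (\<exists>S. finite S \<and> S \<subseteq> carrier G \<and> generate G S = carrier G)"

definition residually_finite_group :: "('a, 'b) monoid_scheme \<Rightarrow> bool" where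
  "residually_finite_group G \<longleftrightarrow>
     group G \<and>
     (\<forall>g\<in>carrier G. g \<noteq> \<one>\<^bsub>G\<^esub> \<longrightarrow> (\<exists>N. N \<lhd> G \<and> finite (rcosets\<^bsub>G\<^esub> N) \<and> g \<notin> N))"

text \<open>Amenability of a discrete group in von Neumann's sense: there is a left-invariant finitely
  additive probability measure defined on all subsets of the group.\<close>

definition amenable_group :: "('a, 'b) monoid_scheme \<Rightarrow> bool" where
  "amenable_group G \<longleftrightarrow>
     group G \<and>
     (\<exists>m :: 'a set \<Rightarrow> real.
        (\<forall>A. A \<subseteq> carrier G \<longrightarrow> 0 \<le> m A) \<and>
        m (carrier G) = 1 \<and>
        (\<forall>A B. A \<subseteq> carrier G \<longrightarrow> B \<subseteq> carrier G \<longrightarrow> A \<inter> B = {} \<longrightarrow> m (A \<union> B) = m A + m B) \<and>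
        (\<forall>g\<in>carrier G. \<forall>A. A \<subseteq> carrier G \<longrightarrow> m (g <#\<^bsub>G\<^esub> A) = m A))"

definition conj_subgroup :: "('a, 'b) monoid_scheme \<Rightarrow> 'a \<Rightarrow> 'a set \<Rightarrow> 'a set" where
  "conj_subgroup G g H = g <#\<^bsub>G\<^esub> H #>\<^bsub>G\<^esub> inv\<^bsub>G\<^esub> g"

definition left_transversal :: "('a, 'b) monoid_scheme \<Rightarrow> 'a set \<Rightarrow> 'a set \<Rightarrow> bool" where
  "left_transversal G L T \<longleftrightarrow>
     T \<subseteq> carrier G \<and> (\<forall>g\<in>carrier G. \<exists>!t. t \<in> T \<inter> (g <#\<^bsub>G\<^esub> L))"

text \<open>The union is required to be nonempty, since uniform averages over it are taken.\<close>

definition finite_union_of_transversals :: "('a, 'b) monoid_scheme \<Rightarrow> 'a set \<Rightarrow> 'a set \<Rightarrow> bool" where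
  "finite_union_of_transversals G L F \<longleftrightarrow>
     (\<exists>\<T>. finite \<T> \<and> \<T> \<noteq> {} \<and> (\<forall>T\<in>\<T>. left_transversal G L T) \<and> disjoint \<T> \<and> F = \<Union>\<T>)"

section \<open>The space of subgroups and its probability measures\<close>

text \<open>The topology induced from the product space of Boolean functions on the carrier, along the
  map sending a subgroup to its indicator function.\<close>

definition chabauty :: "('a, 'b) monoid_scheme \<Rightarrow> 'a set topology" where
  "chabauty G =
     pullback_topology {H. subgroup H G} (\<lambda>H. \<lambda>x\<in>carrier G. x \<in> H)
       (product_topology (\<lambda>_. discrete_topology (UNIV :: bool set)) (carrier G))"

definition sub_borel :: "('a, 'b) monoid_scheme \<Rightarrow> 'a set measure" where
  "sub_borel G = sigma {H. subgroup H G} {U. openin (chabauty G) U}"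

definition sub_prob :: "('a, 'b) monoid_scheme \<Rightarrow> 'a set measure set" where
  "sub_prob G = {\<mu>. prob_space \<mu> \<and> space \<mu> = {H. subgroup H G} \<and> sets \<mu> = sets (sub_borel G)}"

text \<open>The coarsest topology for which integration against each continuous real function
  is continuous.\<close>

definition weak_star :: "('a, 'b) monoid_scheme \<Rightarrow> 'a set measure topology" where
  "weak_star G =
     topology_generated_by
       {{\<mu> \<in> sub_prob G. (\<integral>H. f H \<partial>\<mu>) \<in> U} | f U.
          continuous_map (chabauty G) euclideanreal f \<and> open (U :: real set)}"

definition compatible_metric ::
    "('a, 'b) monoid_scheme \<Rightarrow> ('a set measure \<Rightarrow> 'a set measure \<Rightarrow> real) \<Rightarrow> bool" where
  "compatible_metric G d \<longleftrightarrow>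
     Metric_space (sub_prob G) d \<and> Metric_space.mtopology (sub_prob G) d = weak_star G"

section \<open>Invariant random subgroups\<close>

definition IRS :: "('a, 'b) monoid_scheme \<Rightarrow> 'a set measure set" where
  "IRS G = {\<mu> \<in> sub_prob G. \<forall>g\<in>carrier G. distr \<mu> (sub_borel G) (conj_subgroup G g) = \<mu>}"

text \<open>Measures do not form a real vector space type, so the extreme points of the convex set of
  invariant random subgroups are described by spelling out convex combinations setwise.\<close>

definition ergodic_IRS :: "('a, 'b) monoid_scheme \<Rightarrow> 'a set measure \<Rightarrow> bool" where
  "ergodic_IRS G \<mu> \<longleftrightarrow>
     \<mu> \<in> IRS G \<and>
     (\<forall>\<nu>\<in>IRS G. \<forall>\<nu>'\<in>IRS G. \<forall>t::real. 0 < t \<and> t < 1 \<and>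
        (\<forall>A\<in>sets (sub_borel G). measure \<mu> A = t * measure \<nu> A + (1 - t) * measure \<nu>' A)
        \<longrightarrow> \<nu> = \<mu> \<and> \<nu>' = \<mu>)"

definition IRS_fi :: "('a, 'b) monoid_scheme \<Rightarrow> 'a set measure set" where
  "IRS_fi G = {\<mu> \<in> IRS G. measure \<mu> {H. finite_index_subgroup G H} = 1}"

definition cosofic :: "('a, 'b) monoid_scheme \<Rightarrow> 'a set measure \<Rightarrow> bool" where
  "cosofic G \<mu> \<longleftrightarrow> \<mu> \<in> IRS G \<and> \<mu> \<in> weak_star G closure_of IRS_fi G"

section \<open>Weiss approximations\<close>

definition conj_average :: "('a, 'b) monoid_scheme \<Rightarrow> 'a set \<Rightarrow> 'a set \<Rightarrow> 'a set measure" where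
  "conj_average G F H =
     measure_of {K. subgroup K G} (sets (sub_borel G))
       (\<lambda>A. (\<Sum>f\<in>F. emeasure (return (sub_borel G) (conj_subgroup G f H)) A) / of_nat (card F))"

definition Weiss_approximation ::
    "('a, 'b) monoid_scheme \<Rightarrow> ('a set measure \<Rightarrow> 'a set measure \<Rightarrow> real) \<Rightarrow>
     'a set \<Rightarrow> (nat \<Rightarrow> 'a set) \<Rightarrow> (nat \<Rightarrow> 'a set) \<Rightarrow> bool" where
  "Weiss_approximation G d H K F \<longleftrightarrow>
     (\<forall>i. finite_index_subgroup G (K i) \<and>
          finite_union_of_transversals G (normalizer G (K i)) (F i)) \<and>
     (\<lambda>i. d (conj_average G (F i) (K i)) (conj_average G (F i) H)) \<longlonglongrightarrow> 0"

text \<open>The set function in \<^const>\<open>conj_average\<close> is countably additive, so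
  \<^const>\<open>measure_of\<close> does not fall back to the null measure.\<close>

lemma space_sub_borel: "space (sub_borel G) = {H. subgroup H G}"
  and sets_sub_borel_space: "sigma_sets {H. subgroup H G} (sets (sub_borel G)) = sets (sub_borel G)"
proof -
  have "{U. openin (chabauty G) U} \<subseteq> Pow {H. subgroup H G}"
    by (auto simp: chabauty_def openin_pullback_topology)
  then show sp: "space (sub_borel G) = {H. subgroup H G}"
    by (simp add: sub_borel_def space_measure_of)
  show "sigma_sets {H. subgroup H G} (sets (sub_borel G)) = sets (sub_borel G)"
    using sets.sigma_sets_eq[of "sub_borel G"] by (simp add: sp)
qed

lemma emeasure_conj_average:
  assumes "A \<in> sets (sub_borel G)"
  shows "emeasure (conj_average G F H) A =
    (\<Sum>f\<in>F. indicator A (conj_subgroup G f H)) / of_nat (card F)"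
proof -
  let ?\<mu> = "\<lambda>A. (\<Sum>f\<in>F. emeasure (return (sub_borel G) (conj_subgroup G f H)) A) / of_nat (card F)"
  have ca: "countably_additive (sets (sub_borel G)) ?\<mu>"
    unfolding countably_additive_def
  proof (intro allI impI)
    fix B :: "nat \<Rightarrow> _" assume B: "range B \<subseteq> sets (sub_borel G)" "disjoint_family B"
    have "(\<Sum>n. ?\<mu> (B n)) =
        (\<Sum>n. \<Sum>f\<in>F. emeasure (return (sub_borel G) (conj_subgroup G f H)) (B n)) / of_nat (card F)"
      by simp
    also have "(\<Sum>n. \<Sum>f\<in>F. emeasure (return (sub_borel G) (conj_subgroup G f H)) (B n)) =
        (\<Sum>f\<in>F. \<Sum>n. emeasure (return (sub_borel G) (conj_subgroup G f H)) (B n))"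
      by (intro suminf_sum) auto
    also have "\<dots> = (\<Sum>f\<in>F. emeasure (return (sub_borel G) (conj_subgroup G f H)) (\<Union>n. B n))"
      using B by (intro sum.cong refl suminf_emeasure) auto
    finally show "(\<Sum>n. ?\<mu> (B n)) = ?\<mu> (\<Union>n. B n)" .
  qed
  have "emeasure (conj_average G F H) A = ?\<mu> A"
    unfolding conj_average_def
  proof (rule emeasure_measure_of_sigma[OF _ _ ca assms])
    show "sigma_algebra {K. subgroup K G} (sets (sub_borel G))"
      using sets.sigma_algebra_axioms[of "sub_borel G"] by (simp add: space_sub_borel)
    show "positive (sets (sub_borel G)) ?\<mu>" by (simp add: positive_def)
  qed
  then show ?thesis using assms by simp
qed

end

theory Submission
  imports Defs
begin

text \<open>
  The sets \<open>F\<^sub>i\<close> form a Folner sequence with two extra properties. First, \<open>F\<^sub>i\<close> meets all left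
  cosets of \<open>N\<^sub>i\<close> in equally many points, where \<open>N\<^sub>i\<close> is a decreasing sequence of finite index
  subgroups that is eventually contained in every finite index subgroup; so for fixed \<open>K\<close> and large
  \<open>i\<close>, \<open>F\<^sub>i\<close> is a union of transversals of the normalizer of \<open>K\<close>, and averaging over the
  \<open>F\<^sub>i\<close>-conjugates of \<open>K\<close> gives the uniform measure on its conjugacy class. Second, the sequence
  is tempered strongly enough for a maximal inequality in \<open>L\<^sup>2\<close>, proved by estimating \<open>T T\<^sup>*\<close>. The
  resulting pointwise ergodic theorem says that for ergodic \<open>\<mu>\<close> and \<open>\<mu>\<close>-almost every \<open>H\<close> the
  averages over the \<open>F\<^sub>i\<close>-conjugates of \<open>H\<close> converge to \<open>\<mu>\<close>. Hence almost every \<open>H\<close> is Weiss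
  approximated iff \<open>\<mu>\<close> is a limit of such class measures, and by a Milman-type argument this
  is the same as being co-sofic.
\<close>

text \<open>The sequence \<open>F\<close> has to be fixed before \<mu>, \<open>d\<close> and
  \<open>K\<close> are known, so nothing in its construction may refer to them. Countability makes
  this possible: finite index subgroups of a finitely generated group are themselves finitely
  generated, hence countable in number, so that one decreasing sequence \<open>N\<close> can be
  cofinal among them; the Folner condition concerns countably many group elements; and weak-*
  convergence on the compact space of subgroups can be tested on countably many cylinders. The test
  functions are therefore bounded, and an L^2 maximal inequality does the work that a weak-type
  bound does for general L^1 functions. The metric \<open>d\<close> enters only through the topology
  that it induces. Since \<open>F i\<close> must be a union of transversals exactly and not
  approximately, equidistribution is obtained by trimming an almost invariant set, which spoils its
  invariance only slightly.\<close>

no_notation subset_mset (infix "<#" 50)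

section \<open>Folner sets in amenable groups\<close>

text \<open>Rado's argument: delete as many pairs \<open>D\<close> as Hall's condition allows; if two values were left
  at some \<open>x\<close>, submodularity of the cardinality would permit deleting one more.\<close>

lemma Hall_infinite:
  fixes N :: "'x \<Rightarrow> 'y set"
  assumes fin: "\<And>x. x \<in> X \<Longrightarrow> finite (N x)"
    and Hall: "\<And>W. finite W \<Longrightarrow> W \<subseteq> X \<Longrightarrow> card W \<le> card (\<Union>x\<in>W. N x)"
  obtains f where "inj_on f X" "\<And>x. x \<in> X \<Longrightarrow> f x \<in> N x"
proof -
  define A where "A = {D. \<forall>W. finite W \<longrightarrow> W \<subseteq> X \<longrightarrow> card W \<le> card (\<Union>x\<in>W. N x - D `` {x})}"
  have "\<exists>M\<in>A. \<forall>D\<in>A. M \<subseteq> D \<longrightarrow> D = M"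
  proof (rule subset_Zorn')
    fix C assume C: "subset.chain A C"
    show "\<Union>C \<in> A"
    proof (cases "C = {}")
      case True
      then show ?thesis using Hall by (simp add: A_def)
    next
      case False
      show ?thesis unfolding A_def
      proof (intro CollectI allI impI)
        fix W assume W: "finite W" "W \<subseteq> X"
        \<comment> \<open>Only the finitely many pairs over \<open>W\<close> matter, and a single
          member of the chain already deletes all those of them that the union deletes.\<close>
        let ?Z = "\<Union>C \<inter> (SIGMA x:W. N x)"
        have finS: "finite (SIGMA x:W. N x)" using W fin by auto
        have "finite ?Z" using finS by blast
        moreover have "?Z \<subseteq> \<Union>C" by blast
        ultimately obtain D where D: "D \<in> C" "?Z \<subseteq> D"
          using finite_subset_Union_chain[OF _ _ False C] by blast
        have "(\<Union>x\<in>W. N x - (\<Union>C) `` {x}) = (\<Union>x\<in>W. N x - D `` {x})"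
          using D by blast
        moreover have "D \<in> A" using C D(1) by (auto simp: subset.chain_def)
        ultimately show "card W \<le> card (\<Union>x\<in>W. N x - (\<Union>C) `` {x})"
          using W by (simp add: A_def)
      qed
    qed
  qed
  then obtain M where M: "M \<in> A" and max: "\<And>D. D \<in> A \<Longrightarrow> M \<subseteq> D \<Longrightarrow> D = M" by blast
  define R where "R x = N x - M `` {x}" for x
  have finR: "finite (R x)" if "x \<in> X" for x using fin[OF that] by (simp add: R_def)
  have HR: "card W \<le> card (\<Union>x\<in>W. R x)" if "finite W" "W \<subseteq> X" for W
    using M that by (simp add: A_def R_def)
  \<comment> \<open>By maximality, deleting also \<open>y\<close> at \<open>x\<close> breaks Hall's
    condition at some finite set, which must contain \<open>x\<close>. The witness \<open>W\<close>
    is that set without \<open>x\<close>.\<close>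
  have crit: "\<exists>W. finite W \<and> W \<subseteq> X \<and> x \<notin> W \<and> card ((\<Union>w\<in>W. R w) \<union> (R x - {y})) \<le> card W"
    if x: "x \<in> X" and y: "y \<in> R x" for x y
  proof -
    have "insert (x, y) M \<noteq> M" using y by (auto simp: R_def)
    then have "insert (x, y) M \<notin> A" using max by blast
    then obtain W where W: "finite W" "W \<subseteq> X"
      and lt: "card (\<Union>w\<in>W. N w - (insert (x, y) M) `` {w}) < card W"
      unfolding A_def by (auto simp: not_le)
    have eq: "N w - (insert (x, y) M) `` {w} = (if w = x then R x - {y} else R w)" for w
      by (auto simp: R_def)
    have xW: "x \<in> W"
    proof (rule ccontr)
      assume "x \<notin> W"
      then have "(\<Union>w\<in>W. N w - (insert (x, y) M) `` {w}) = (\<Union>w\<in>W. R w)"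
        unfolding eq by (intro SUP_cong) auto
      with lt HR[OF W] show False by simp
    qed
    have "(\<Union>w\<in>W. N w - (insert (x, y) M) `` {w}) = (\<Union>w\<in>W - {x}. R w) \<union> (R x - {y})"
      unfolding eq using xW by (auto split: if_splits)
    with lt have "card ((\<Union>w\<in>W - {x}. R w) \<union> (R x - {y})) \<le> card (W - {x})"
      using xW W by (simp add: card_Diff_singleton)
    then show ?thesis using W by (intro exI[of _ "W - {x}"]) auto
  qed
  \<comment> \<open>The union of the two critical sets together with \<open>x\<close> asks for one
    value more than \<open>card (W1 \<union> W2)\<close>, their intersection for
    \<open>card (W1 \<inter> W2)\<close>. By inclusion-exclusion the two critical bounds leave one
    value too few.\<close>
  have single: "y1 = y2" if x: "x \<in> X" and y: "y1 \<in> R x" "y2 \<in> R x" for x y1 y2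
  proof (rule ccontr)
    assume ne: "y1 \<noteq> y2"
    obtain W1 where W1: "finite W1" "W1 \<subseteq> X" "x \<notin> W1"
      and c1: "card ((\<Union>w\<in>W1. R w) \<union> (R x - {y1})) \<le> card W1" using crit[OF x y(1)] by blast
    obtain W2 where W2: "finite W2" "W2 \<subseteq> X" "x \<notin> W2"
      and c2: "card ((\<Union>w\<in>W2. R w) \<union> (R x - {y2})) \<le> card W2" using crit[OF x y(2)] by blast
    let ?P = "(\<Union>w\<in>W1. R w) \<union> (R x - {y1})" and ?Q = "(\<Union>w\<in>W2. R w) \<union> (R x - {y2})"
    have fP: "finite ?P" "finite ?Q" using W1 W2 x finR by blast+
    have "(\<Union>w\<in>insert x (W1 \<union> W2). R w) \<subseteq> ?P \<union> ?Q" using ne by blast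
    then have "card (insert x (W1 \<union> W2)) \<le> card (?P \<union> ?Q)"
      using HR[of "insert x (W1 \<union> W2)"] W1 W2 x fP
      by (meson card_mono finite_UnI finite_insert insert_subset le_sup_iff order_trans)
    then have 1: "Suc (card (W1 \<union> W2)) \<le> card (?P \<union> ?Q)" using W1 W2 by simp
    have "(\<Union>w\<in>W1 \<inter> W2. R w) \<subseteq> ?P \<inter> ?Q" by blast
    moreover have "finite (?P \<inter> ?Q)" using fP by blast
    ultimately have 2: "card (W1 \<inter> W2) \<le> card (?P \<inter> ?Q)"
      using HR[of "W1 \<inter> W2"] W1 W2 by (meson card_mono finite_Int inf.coboundedI1 order_trans)
    have "card ?P + card ?Q = card (?P \<union> ?Q) + card (?P \<inter> ?Q)"
      using card_Un_Int[OF fP] by simp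
    moreover have "card W1 + card W2 = card (W1 \<union> W2) + card (W1 \<inter> W2)"
      using card_Un_Int[OF W1(1) W2(1)] by simp
    ultimately show False using 1 2 c1 c2 by linarith
  qed
  have ne: "R x \<noteq> {}" if "x \<in> X" for x using HR[of "{x}"] that by auto
  define f where "f x = (SOME y. y \<in> R x)" for x
  have f: "f x \<in> R x" if "x \<in> X" for x using ne[OF that] unfolding f_def by (simp add: some_in_eq)
  have Rf: "R x = {f x}" if "x \<in> X" for x using f[OF that] single[OF that] by blast
  show thesis
  proof (rule that)
    show "inj_on f X"
    proof (rule inj_onI, rule ccontr)
      fix x x' assume xx: "x \<in> X" "x' \<in> X" "f x = f x'" "x \<noteq> x'"
      have "card {x, x'} \<le> card (\<Union>w\<in>{x, x'}. R w)" using xx by (intro HR) auto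
      also have "(\<Union>w\<in>{x, x'}. R w) = {f x}" using Rf xx by auto
      finally show False using xx by simp
    qed
    show "f x \<in> N x" if "x \<in> X" for x using f[OF that] by (simp add: R_def)
  qed
qed

text \<open>Otherwise the group is paradoxical: Hall's theorem on two copies of the group gives an
  injection \<open>f\<close> that moves each point by an element of \<open>S\<close>. Cut into
  pieces according to that element, the two copies have mass 2, while the translated pieces are
  disjoint in a single copy and have mass at most 1.\<close>

lemma (in group) amenable_not_doubling:
  assumes am: "amenable_group G" and S: "finite S" "S \<subseteq> carrier G"
  shows "\<exists>W. finite W \<and> W \<subseteq> carrier G \<and> card (\<Union>s\<in>S. s <# W) < 2 * card W"
proof (rule ccontr)
  assume "\<not> ?thesis"
  then have dbl: "2 * card W \<le> card (\<Union>s\<in>S. s <# W)" if "finite W" "W \<subseteq> carrier G" for W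
    using that by (meson not_le)
  define X where "X = carrier G \<times> (UNIV :: bool set)"
  define N where "N p = (\<lambda>s. s \<otimes> fst p) ` S" for p :: "'a \<times> bool"
  obtain f where inj: "inj_on f X" and f: "\<And>p. p \<in> X \<Longrightarrow> f p \<in> N p"
  proof (rule Hall_infinite[of X N])
    show "finite (N p)" for p using S by (simp add: N_def)
    fix W assume W: "finite W" "W \<subseteq> X"
    have "card W \<le> card (fst ` W \<times> (UNIV :: bool set))"
      using W by (intro card_mono) (auto intro: rev_image_eqI)
    also have "\<dots> = 2 * card (fst ` W)" by (simp add: card_cartesian_product)
    also have "\<dots> \<le> card (\<Union>s\<in>S. s <# fst ` W)"
      using W by (intro dbl) (auto simp: X_def)
    also have "(\<Union>s\<in>S. s <# fst ` W) = (\<Union>p\<in>W. N p)"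
      by (auto simp: l_coset_def N_def)
    finally show "card W \<le> card (\<Union>p\<in>W. N p)" .
  qed blast
  obtain m :: "'a set \<Rightarrow> real" where m: "\<forall>A. A \<subseteq> carrier G \<longrightarrow> 0 \<le> m A"
    "m (carrier G) = 1"
    "\<forall>A B. A \<subseteq> carrier G \<longrightarrow> B \<subseteq> carrier G \<longrightarrow> A \<inter> B = {} \<longrightarrow> m (A \<union> B) = m A + m B"
    "\<forall>g\<in>carrier G. \<forall>A. A \<subseteq> carrier G \<longrightarrow> m (g <# A) = m A"
    using am unfolding amenable_group_def by (elim conjE exE) (rule that)
  have m0: "0 \<le> m A" if "A \<subseteq> carrier G" for A using m(1) that by simp
  have madd: "m (A \<union> B) = m A + m B" if "A \<subseteq> carrier G" "B \<subseteq> carrier G" "A \<inter> B = {}" for A B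
    using m(3) that by simp
  have minv: "m (g <# A) = m A" if "g \<in> carrier G" "A \<subseteq> carrier G" for g A using m(4) that by simp
  have mempty: "m {} = 0" using madd[of "{}" "{}"] by simp
  have msum: "m (\<Union>i\<in>I. A i) = (\<Sum>i\<in>I. m (A i))"
    if "finite I" "\<And>i. i \<in> I \<Longrightarrow> A i \<subseteq> carrier G" "disjoint_family_on A I" for I :: "('a \<times> bool) set" and A
    using that
  proof (induction I rule: finite_induct)
    case empty then show ?case by (simp add: mempty)
  next
    case (insert i I)
    have "m (A i \<union> (\<Union>i\<in>I. A i)) = m (A i) + m (\<Union>i\<in>I. A i)"
      using insert.prems insert.hyps
      by (intro madd) (auto simp: disjoint_family_on_def)
    then show ?case using insert by (simp add: disjoint_family_on_mono[OF subset_insertI insert.prems(2)])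
  qed
  \<comment> \<open>\<open>A (s, b)\<close> consists of the points that \<open>f\<close> moves by
    \<open>s\<close> in copy \<open>b\<close>. For fixed \<open>b\<close> the pieces partition the
    group; the translates \<open>s <# A (s, b)\<close> are images under \<open>f\<close>, hence
    disjoint over all pairs.\<close>
  define A where "A q = {x \<in> carrier G. f (x, snd q) = fst q \<otimes> x}" for q :: "'a \<times> bool"
  have Asub: "A q \<subseteq> carrier G" for q by (auto simp: A_def)
  have cov: "m (\<Union>q\<in>S \<times> {b}. A q) = 1" for b
  proof -
    have "(\<Union>q\<in>S \<times> {b}. A q) = carrier G"
    proof
      show "carrier G \<subseteq> (\<Union>q\<in>S \<times> {b}. A q)"
      proof
        fix x assume x: "x \<in> carrier G"
        have "f (x, b) \<in> N (x, b)" by (rule f) (use x in \<open>simp add: X_def\<close>)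
        then obtain s where "s \<in> S" "f (x, b) = s \<otimes> x" by (auto simp: N_def)
        then have "(s, b) \<in> S \<times> {b}" "x \<in> A (s, b)" using x by (auto simp: A_def)
        then show "x \<in> (\<Union>q\<in>S \<times> {b}. A q)" by blast
      qed
    qed (use Asub in blast)
    then show ?thesis using m(2) by simp
  qed
  have disj: "disjoint_family_on A (S \<times> {b})" for b
    using S by (auto simp: disjoint_family_on_def A_def subset_iff)
  have disj2: "disjoint_family_on (\<lambda>q. fst q <# A q) (S \<times> UNIV)"
  proof -
    have im: "fst q <# A q = (\<lambda>x. f (x, snd q)) ` A q" for q
      by (auto simp: l_coset_def A_def)
    show ?thesis unfolding disjoint_family_on_def im
    proof (intro ballI impI)
      fix p q :: "'a \<times> bool" assume pq: "p \<in> S \<times> UNIV" "q \<in> S \<times> UNIV" "p \<noteq> q"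
      show "(\<lambda>x. f (x, snd p)) ` A p \<inter> (\<lambda>x. f (x, snd q)) ` A q = {}"
      proof (rule ccontr)
        assume "\<not> ?thesis"
        then obtain x y where xy: "x \<in> A p" "y \<in> A q" "f (x, snd p) = f (y, snd q)" by auto
        then have "(x, snd p) = (y, snd q)"
          by (intro inj_onD[OF inj xy(3)]) (auto simp: X_def A_def)
        with xy pq S show False by (auto simp: A_def subset_iff prod_eq_iff)
      qed
    qed
  qed
  have "2 = m (\<Union>q\<in>S \<times> {True}. A q) + m (\<Union>q\<in>S \<times> {False}. A q)" by (simp only: cov)
  also have "\<dots> = (\<Sum>q\<in>S \<times> {True}. m (A q)) + (\<Sum>q\<in>S \<times> {False}. m (A q))"
    using S Asub disj by (simp add: msum)
  also have "\<dots> = (\<Sum>q\<in>S \<times> UNIV. m (A q))"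
    using S by (subst sum.union_disjoint[symmetric]) (auto intro!: sum.cong)
  also have "\<dots> = (\<Sum>q\<in>S \<times> UNIV. m (fst q <# A q))"
    using S Asub by (intro sum.cong) (auto simp: minv subset_iff)
  also have "\<dots> = m (\<Union>q\<in>S \<times> UNIV. fst q <# A q)"
    using S Asub disj2 by (intro msum[symmetric]) (auto simp: l_coset_subset_G subset_iff l_coset_def)
  also have "\<dots> \<le> 1"
  proof -
    let ?U = "\<Union>q\<in>S \<times> UNIV. fst q <# A q"
    have U: "?U \<subseteq> carrier G" using S Asub by (auto simp: l_coset_def subset_iff)
    have "m (?U \<union> (carrier G - ?U)) = m ?U + m (carrier G - ?U)"
      using U by (intro madd) auto
    moreover have "?U \<union> (carrier G - ?U) = carrier G" using U by blast
    ultimately have "1 = m ?U + m (carrier G - ?U)" using m(2) by simp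
    moreover have "0 \<le> m (carrier G - ?U)" by (rule m0) blast
    ultimately show ?thesis by linarith
  qed
  finally show False by simp
qed

text \<open>If every finite set \<open>W\<close> were expanded by the factor \<open>1 + \<epsilon>\<close> under
  \<open>S\<close>, a power of \<open>S\<close> would double every finite set.\<close>

lemma (in group) amenable_Folner:
  assumes am: "amenable_group G" and S: "finite S" "S \<subseteq> carrier G" and e: "0 < (e::real)"
  shows "\<exists>W. finite W \<and> W \<noteq> {} \<and> W \<subseteq> carrier G \<and> real (card ((\<Union>s\<in>S. s <# W) - W)) \<le> e * card W"
proof (rule ccontr)
  assume neg: "\<not> ?thesis"
  \<comment> \<open>With the unit added, \<open>T W\<close> is the disjoint union of
    \<open>W\<close> and its new points, so the failure of the bound becomes growth by the factor
    \<open>1 + e\<close>.\<close>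
  let ?S = "insert \<one> S"
  define T where "T W = (\<Union>s\<in>?S. s <# W)" for W
  have Tsub: "T W \<subseteq> carrier G" if "W \<subseteq> carrier G" for W
    using that S by (auto simp: T_def l_coset_def subset_iff)
  have Tfin: "finite (T W)" if "finite W" for W
    using that S by (auto simp: T_def l_coset_def)
  have grow: "(1 + e) * card W \<le> card (T W)" if W: "finite W" "W \<subseteq> carrier G" for W
  proof (cases "W = {}")
    case True then show ?thesis by simp
  next
    case False
    have *: "e * card W < card ((\<Union>s\<in>S. s <# W) - W)" using neg W False by (meson not_le)
    have "T W = W \<union> ((\<Union>s\<in>S. s <# W) - W)" using W by (auto simp: T_def l_coset_def subset_iff)
    then have "card (T W) = card W + card ((\<Union>s\<in>S. s <# W) - W)"
      using W S by (subst card_Un_disjoint[symmetric]) (auto simp: l_coset_def)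
    then show ?thesis using * by (simp add: algebra_simps)
  qed
  \<comment> \<open>\<open>P n\<close> is the \<open>n\<close>-th power of \<open>?S\<close> as a
    product set; multiplying \<open>W\<close> by it is the same as applying \<open>T\<close> to
    \<open>W\<close> \<open>n\<close> times.\<close>
  define P where "P n = ((\<lambda>W. T W) ^^ n) {\<one>}" for n :: nat
  have P: "finite (P n) \<and> P n \<subseteq> carrier G" for n
    by (induction n) (auto simp: P_def Tfin dest: subsetD[OF Tsub])
  have iter: "(\<Union>s\<in>P n. s <# W) = ((\<lambda>W. T W) ^^ n) W" if W: "W \<subseteq> carrier G" for n W
  proof (induction n)
    case 0
    then show ?case using W by (auto simp: P_def l_coset_def subset_iff)
  next
    case (Suc n)
    have "(\<Union>s\<in>P (Suc n). s <# W) = T (\<Union>s\<in>P n. s <# W)"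
    proof -
      have PS: "P (Suc n) = T (P n)" by (simp add: P_def)
      have m: "(s \<otimes> p) <# W = s <# (p <# W)" if "s \<in> ?S" "p \<in> P n" for s p
        using that S P[of n] W by (intro lcos_m_assoc[symmetric]) auto
      have "(\<Union>s\<in>P (Suc n). s <# W) = (\<Union>s\<in>?S. \<Union>p\<in>P n. (s \<otimes> p) <# W)"
        unfolding PS T_def l_coset_def by blast
      also have "\<dots> = (\<Union>s\<in>?S. \<Union>p\<in>P n. s <# (p <# W))" using m by simp
      also have "\<dots> = T (\<Union>s\<in>P n. s <# W)" unfolding T_def l_coset_def by blast
      finally show ?thesis .
    qed
    then show ?case using Suc by simp
  qed
  have pow: "(1 + e) ^ n * card W \<le> card (((\<lambda>W. T W) ^^ n) W)
      \<and> finite (((\<lambda>W. T W) ^^ n) W) \<and> ((\<lambda>W. T W) ^^ n) W \<subseteq> carrier G"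
    if W: "finite W" "W \<subseteq> carrier G" for n W
  proof (induction n)
    case 0 then show ?case using W by simp
  next
    case (Suc n)
    let ?V = "((\<lambda>W. T W) ^^ n) W"
    have "(1 + e) ^ Suc n * card W = (1 + e) * ((1 + e) ^ n * card W)" by simp
    also have "\<dots> \<le> (1 + e) * card ?V" using Suc e by (intro mult_left_mono) auto
    also have "\<dots> \<le> card (T ?V)" using Suc by (intro grow) auto
    finally show ?case using Suc Tsub Tfin by auto
  qed
  obtain n where n: "2 < (1 + e) ^ n" using real_arch_pow[of "1 + e" 2] e by auto
  obtain W where W: "finite W" "W \<subseteq> carrier G" and lt: "card (\<Union>s\<in>P n. s <# W) < 2 * card W"
    using amenable_not_doubling[OF am] P[of n] by blast
  have "real (card (\<Union>s\<in>P n. s <# W)) < 2 * card W" using lt by linarith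
  also have "\<dots> \<le> (1 + e) ^ n * card W" using mult_right_mono[of 2 "(1 + e) ^ n" "real (card W)"] n by simp
  also have "\<dots> \<le> card (\<Union>s\<in>P n. s <# W)" using pow[OF W] iter[OF W(2)] by simp
  finally show False by simp
qed

section \<open>Cosets of finite index subgroups\<close>

context group begin

lemma mem_l_coset_iff:
  assumes "H \<subseteq> carrier G" "g \<in> carrier G"
  shows "x \<in> g <# H \<longleftrightarrow> x \<in> carrier G \<and> inv g \<otimes> x \<in> H"
proof
  assume "x \<in> g <# H"
  then show "x \<in> carrier G \<and> inv g \<otimes> x \<in> H"
    using assms by (auto simp: l_coset_def subset_iff m_assoc[symmetric])
next
  assume x: "x \<in> carrier G \<and> inv g \<otimes> x \<in> H"
  then have "x = g \<otimes> (inv g \<otimes> x)" using assms by (simp add: m_assoc[symmetric])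
  then show "x \<in> g <# H" using x unfolding l_coset_def by blast
qed

text \<open>The definition counts right cosets while transversals are made of left cosets; inversion
  exchanges the two. The covering set \<open>T\<close> may hit a coset more than once, so it can be
  enlarged or moved freely.\<close>

lemma finite_index_iff:
  "finite_index_subgroup G K \<longleftrightarrow>
     subgroup K G \<and> (\<exists>T. finite T \<and> T \<subseteq> carrier G \<and> (\<forall>g\<in>carrier G. \<exists>t\<in>T. g \<in> t <# K))"
proof
  assume K: "finite_index_subgroup G K"
  then have sub: "subgroup K G" and fin: "finite (rcosets K)" by (auto simp: finite_index_subgroup_def)
  have sK: "K \<subseteq> carrier G" using sub by (rule subgroup.subset)
  let ?T = "(\<lambda>R. inv (SOME r. r \<in> R)) ` (rcosets K)"
  have pick: "(SOME r. r \<in> R) \<in> R" "(SOME r. r \<in> R) \<in> carrier G" if "R \<in> rcosets K" for R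
  proof -
    have "R \<noteq> {}" using that sub by (auto simp: RCOSETS_def r_coset_def dest: subgroup.one_closed)
    then show "(SOME r. r \<in> R) \<in> R" by (simp add: some_in_eq)
    moreover have "R \<subseteq> carrier G" using that sK by (simp add: rcosets_part_G[OF sub, symmetric] Union_upper)
    ultimately show "(SOME r. r \<in> R) \<in> carrier G" by blast
  qed
  have "\<exists>t\<in>?T. g \<in> t <# K" if g: "g \<in> carrier G" for g
  proof -
    have R: "K #> inv g \<in> rcosets K" using g by (auto simp: RCOSETS_def)
    let ?r = "SOME r. r \<in> K #> inv g"
    obtain k where k: "k \<in> K" "?r = k \<otimes> inv g" using pick(1)[OF R] by (auto simp: r_coset_def)
    have "g \<in> inv ?r <# K"
      using k g sK pick(2)[OF R] by (subst mem_l_coset_iff) (auto simp: m_assoc subset_iff)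
    then show ?thesis using R by blast
  qed
  moreover have "finite ?T" "?T \<subseteq> carrier G" using fin pick(2) by auto
  ultimately show "subgroup K G \<and> (\<exists>T. finite T \<and> T \<subseteq> carrier G \<and> (\<forall>g\<in>carrier G. \<exists>t\<in>T. g \<in> t <# K))"
    using sub by blast
next
  assume "subgroup K G \<and> (\<exists>T. finite T \<and> T \<subseteq> carrier G \<and> (\<forall>g\<in>carrier G. \<exists>t\<in>T. g \<in> t <# K))"
  then obtain T where sub: "subgroup K G" and T: "finite T" "T \<subseteq> carrier G"
    "\<And>g. g \<in> carrier G \<Longrightarrow> \<exists>t\<in>T. g \<in> t <# K" by blast
  have sK: "K \<subseteq> carrier G" using sub by (rule subgroup.subset)
  have "rcosets K \<subseteq> (\<lambda>t. K #> inv t) ` T"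
  proof
    fix R assume "R \<in> rcosets K"
    then obtain x where x: "x \<in> carrier G" "R = K #> x" by (auto simp: RCOSETS_def)
    obtain t where t: "t \<in> T" "inv x \<in> t <# K" using T(3)[of "inv x"] x by auto
    then obtain k where k: "k \<in> K" "inv x = t \<otimes> k" by (auto simp: l_coset_def)
    have tk: "t \<in> carrier G" "k \<in> carrier G" using t k T sK by auto
    have "x = inv (t \<otimes> k)" using k(2) x(1) by (metis inv_inv)
    then have "x = inv k \<otimes> inv t" using tk by (simp add: inv_mult_group)
    then have "x \<in> K #> inv t" using k subgroup.m_inv_closed[OF sub] by (auto simp: r_coset_def)
    then have "K #> inv t = K #> x" using tk by (intro repr_independence[OF _ _ sub]) auto
    then show "R \<in> (\<lambda>t. K #> inv t) ` T" using x t by auto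
  qed
  then show "finite_index_subgroup G K"
    using sub T(1) by (auto simp: finite_index_subgroup_def intro: finite_subset)
qed

lemma finite_index_carrier: "finite_index_subgroup G (carrier G)"
  unfolding finite_index_iff
proof
  have "\<forall>g\<in>carrier G. \<exists>t\<in>{\<one>}. g \<in> t <# carrier G" by (auto simp: mem_l_coset_iff)
  then show "\<exists>T. finite T \<and> T \<subseteq> carrier G \<and> (\<forall>g\<in>carrier G. \<exists>t\<in>T. g \<in> t <# carrier G)"
    by (intro exI[of _ "{\<one>}"]) simp
qed (rule subgroup_self)

lemma finite_index_Int:
  assumes "finite_index_subgroup G K" "finite_index_subgroup G L"
  shows "finite_index_subgroup G (K \<inter> L)"
proof -
  have sub: "subgroup K G" "subgroup L G" and fin: "finite (rcosets K)" "finite (rcosets L)"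
    using assms by (auto simp: finite_index_subgroup_def)
  have "rcosets (K \<inter> L) \<subseteq> (\<lambda>(A, B). A \<inter> B) ` ((rcosets K) \<times> (rcosets L))"
  proof
    fix R assume "R \<in> rcosets (K \<inter> L)"
    then obtain x where x: "x \<in> carrier G" "R = (K \<inter> L) #> x" by (auto simp: RCOSETS_def)
    have "(K \<inter> L) #> x = (K #> x) \<inter> (L #> x)"
      using x sub[THEN subgroup.subset] by (auto simp: r_coset_def subset_iff)
    then show "R \<in> (\<lambda>(A, B). A \<inter> B) ` ((rcosets K) \<times> (rcosets L))"
      using x by (auto simp: RCOSETS_def)
  qed
  moreover have "finite ((\<lambda>(A, B). A \<inter> B) ` ((rcosets K) \<times> (rcosets L)))" using fin by blast
  ultimately show ?thesis
    using sub by (auto simp: finite_index_subgroup_def intro: subgroups_Inter_pair finite_subset)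
qed

lemma finite_index_mono:
  assumes "finite_index_subgroup G K" "K \<subseteq> L" "subgroup L G"
  shows "finite_index_subgroup G L"
proof -
  obtain T where T: "finite T" "T \<subseteq> carrier G" "\<forall>g\<in>carrier G. \<exists>t\<in>T. g \<in> t <# K"
    using assms(1) by (auto simp: finite_index_iff)
  have "\<forall>g\<in>carrier G. \<exists>t\<in>T. g \<in> t <# L" using T(3) assms(2) by (fastforce simp: l_coset_def)
  then show ?thesis using T assms(3) by (auto simp: finite_index_iff)
qed

text \<open>Schreier's lemma: \<open>Y\<close> consists of the products
  \<open>inv t' \<otimes> s \<otimes> t\<close> that lie in \<open>K\<close>. With \<open>L\<close>
  the subgroup generated by \<open>Y\<close>, the set \<open>T L\<close> is stable under the
  generators of the group, so every \<open>k \<in> K\<close> is \<open>t \<otimes> l\<close>, and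
  then \<open>t\<close> lies in \<open>T \<inter> K\<close>.\<close>

lemma finite_index_imp_finitely_generated:
  assumes fg: "finite S" "S \<subseteq> carrier G" "generate G S = carrier G"
    and K: "finite_index_subgroup G K"
  shows "\<exists>Y. finite Y \<and> Y \<subseteq> carrier G \<and> K = generate G Y"
proof -
  obtain T0 where sub: "subgroup K G" and T0: "finite T0" "T0 \<subseteq> carrier G"
    "\<And>g. g \<in> carrier G \<Longrightarrow> \<exists>t\<in>T0. g \<in> t <# K"
    using K unfolding finite_index_iff by blast
  have sK: "K \<subseteq> carrier G" using sub by (rule subgroup.subset)
  define T where "T = insert \<one> T0"
  have T: "finite T" "T \<subseteq> carrier G" "\<one> \<in> T" using T0 by (auto simp: T_def)
  have cov: "\<exists>t\<in>T. g \<in> t <# K" if "g \<in> carrier G" for g using T0(3)[OF that] by (auto simp: T_def)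
  \<comment> \<open>The unit is included here and in \<open>T\<close> so that the representatives
    lying in \<open>K\<close> belong to \<open>Y\<close> themselves.\<close>
  define S' where "S' = insert \<one> (S \<union> m_inv G ` S)"
  have S': "finite S'" "S' \<subseteq> carrier G" using fg by (auto simp: S'_def)
  define Y where "Y = K \<inter> (\<lambda>(t', s, t). inv t' \<otimes> (s \<otimes> t)) ` (T \<times> S' \<times> T)"
  have Y: "finite Y" "Y \<subseteq> carrier G" "Y \<subseteq> K" using T S' sK by (auto simp: Y_def)
  define L where "L = generate G Y"
  have L: "subgroup L G" unfolding L_def by (rule generate_is_subgroup[OF Y(2)])
  have LK: "L \<subseteq> K" unfolding L_def by (rule generate_subgroup_incl[OF Y(3) sub])
  have YL: "Y \<subseteq> L" unfolding L_def by (auto intro: generate.incl)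
  have sL: "L \<subseteq> carrier G" using L by (rule subgroup.subset)
  define TL where "TL = (\<Union>t\<in>T. t <# L)"
  have step: "s \<otimes> x \<in> TL" if s: "s \<in> S'" and x: "x \<in> TL" for s x
  proof -
    obtain t l where t: "t \<in> T" "l \<in> L" "x = t \<otimes> l" using x by (auto simp: TL_def l_coset_def)
    have tc: "t \<in> carrier G" "l \<in> carrier G" "s \<in> carrier G" using t T sL s S' by auto
    obtain t' where t': "t' \<in> T" "s \<otimes> t \<in> t' <# K" using cov[of "s \<otimes> t"] tc by auto
    have t'c: "t' \<in> carrier G" using t' T by auto
    have "inv t' \<otimes> (s \<otimes> t) \<in> K" using t' t'c sK by (simp add: mem_l_coset_iff)
    then have "inv t' \<otimes> (s \<otimes> t) \<in> Y" using t' t s by (force simp: Y_def)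
    then have "inv t' \<otimes> (s \<otimes> t) \<otimes> l \<in> L" using YL t L by (auto intro: subgroup.m_closed)
    then have "s \<otimes> x \<in> t' <# L" using t tc t'c sL by (simp add: mem_l_coset_iff m_assoc)
    then show ?thesis using t' by (auto simp: TL_def)
  qed
  have "g \<in> carrier G \<and> (\<forall>x\<in>TL. g \<otimes> x \<in> TL)" if "g \<in> generate G S" for g
    using that
  proof (induction rule: generate.induct)
    case one
    have "x \<in> carrier G" if "x \<in> TL" for x using that T sL by (auto simp: TL_def l_coset_def subset_iff)
    then show ?case by simp
  next
    case (incl h) then show ?case using step S' by (auto simp: S'_def)
  next
    case (inv h) then show ?case using step S' by (auto simp: S'_def)
  next
    case (eng h1 h2)
    have "x \<in> carrier G" if "x \<in> TL" for x using that T sL by (auto simp: TL_def l_coset_def subset_iff)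
    then show ?case using eng by (auto simp: m_assoc)
  qed
  then have act: "g \<otimes> x \<in> TL" if "g \<in> carrier G" "x \<in> TL" for g x using that fg(3) by blast
  have "\<one> \<in> \<one> <# L" using L by (simp add: mem_l_coset_iff[OF sL] subgroup.one_closed)
  then have oneTL: "\<one> \<in> TL" using T by (auto simp: TL_def)
  have "K \<subseteq> L"
  proof
    fix k assume k: "k \<in> K"
    have kc: "k \<in> carrier G" using k sK by auto
    have "k \<in> TL" using act[OF kc oneTL] kc by simp
    then obtain t l where t: "t \<in> T" "l \<in> L" "k = t \<otimes> l" by (auto simp: TL_def l_coset_def)
    have tc: "t \<in> carrier G" "l \<in> carrier G" using t T sL by auto
    have "k \<otimes> inv l = t" using t(3) tc by (simp add: m_assoc)
    moreover have "k \<otimes> inv l \<in> K" using k t LK sub by (auto intro: subgroup.m_closed subgroup.m_inv_closed)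
    ultimately have "t \<in> K" by simp
    moreover have "t = inv \<one> \<otimes> (\<one> \<otimes> t)" using tc by simp
    ultimately have "t \<in> Y" using t T by (force simp: Y_def S'_def)
    then show "k \<in> L" using t YL L by (auto intro: subgroup.m_closed)
  qed
  then have "K = generate G Y" using LK by (simp add: L_def)
  then show ?thesis using Y by blast
qed

lemma countable_generate:
  assumes "countable S" "S \<subseteq> carrier G"
  shows "countable (generate G S)"
proof -
  let ?X = "S \<union> m_inv G ` S"
  let ?ev = "\<lambda>xs. foldr (\<otimes>) xs \<one>"
  have X: "?X \<subseteq> carrier G" using assms by auto
  have evc: "?ev xs \<in> carrier G" if "set xs \<subseteq> ?X" for xs
    using that X by (induction xs) auto
  have app: "?ev (xs @ ys) = ?ev xs \<otimes> ?ev ys" if "set xs \<subseteq> ?X" "set ys \<subseteq> ?X" for xs ys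
    using that
  proof (induction xs)
    case Nil then show ?case using evc[of ys] by simp
  next
    case (Cons a xs)
    then show ?case using evc[of ys] evc[of xs] X by (auto simp: m_assoc subset_iff)
  qed
  have "x \<in> ?ev ` lists ?X" if "x \<in> generate G S" for x
    using that
  proof (induction rule: generate.induct)
    case one then show ?case by (intro image_eqI[of _ _ "[]"]) auto
  next
    case (incl h) then show ?case using assms by (intro image_eqI[of _ _ "[h]"]) auto
  next
    case (inv h) then show ?case using assms by (intro image_eqI[of _ _ "[inv h]"]) auto
  next
    case (eng h1 h2)
    then obtain xs ys where "xs \<in> lists ?X" "h1 = ?ev xs" "ys \<in> lists ?X" "h2 = ?ev ys" by blast
    then show ?case using app[of xs ys] by (intro image_eqI[of _ _ "xs @ ys"]) (auto simp: lists_eq_set)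
  qed
  then have "generate G S \<subseteq> ?ev ` lists ?X" by blast
  moreover have "countable (?ev ` lists ?X)" using assms by (intro countable_image countable_lists) auto
  ultimately show ?thesis by (rule countable_subset)
qed

lemma countable_carrier:
  assumes "finitely_generated_group G" shows "countable (carrier G)"
proof -
  obtain S where S: "finite S" "S \<subseteq> carrier G" "generate G S = carrier G"
    using assms by (auto simp: finitely_generated_group_def)
  show ?thesis using countable_generate[OF countable_finite[OF S(1)] S(2)] S(3) by simp
qed

text \<open>Finite subsets of a countable group are countable in number, and each finite index
  subgroup is generated by one. This gives the cofinal sequence \<open>N\<close> and also makes the
  set of finite index subgroups Borel.\<close>

lemma countable_finite_index:
  assumes "finitely_generated_group G"
  shows "countable {K. finite_index_subgroup G K}"
proof -
  obtain S where S: "finite S" "S \<subseteq> carrier G" "generate G S = carrier G"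
    using assms by (auto simp: finitely_generated_group_def)
  have "{K. finite_index_subgroup G K} \<subseteq> generate G ` {Y. finite Y \<and> Y \<subseteq> carrier G}"
    using finite_index_imp_finitely_generated[OF S] by blast
  then show ?thesis
    using countable_Collect_finite_subset[OF countable_carrier[OF assms]]
    by (meson countable_image countable_subset)
qed

text \<open>A finite set meeting all left cosets of \<open>L\<close> in equally many points is a finite disjoint
  union of transversals, not only of \<open>L\<close> but of every larger subgroup. This replaces Weiss's
  theorem on monotilings.\<close>

definition equidistributed :: "'a set \<Rightarrow> 'a set \<Rightarrow> bool" where
  "equidistributed F L \<longleftrightarrow>
     finite F \<and> F \<subseteq> carrier G \<and> (\<exists>c>0. \<forall>g\<in>carrier G. card (F \<inter> (g <# L)) = c)"

lemma equidistributed_nonempty: "equidistributed F L \<Longrightarrow> F \<noteq> {}"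
  by (auto simp: equidistributed_def)

lemma l_coset_eqI:
  assumes "subgroup L G" "g \<in> carrier G" "x \<in> g <# L" shows "x <# L = g <# L"
  using l_repr_independence[OF assms(3,2,1)] by simp

text \<open>Number the \<open>c\<close> points of \<open>F\<close> inside each left coset; the
  \<open>j\<close>-th transversal collects the points with number \<open>j\<close>. The numbering
  \<open>h\<close> is attached to the coset as a set, so it does not depend on a
  representative.\<close>

lemma equidistributed_imp_transversals:
  assumes eq: "equidistributed F L" and L: "subgroup L G"
  shows "finite_union_of_transversals G L F"
proof -
  obtain c where F: "finite F" "F \<subseteq> carrier G" "c > 0"
    and c: "\<And>g. g \<in> carrier G \<Longrightarrow> card (F \<inter> (g <# L)) = c"
    using eq by (auto simp: equidistributed_def)
  have cL: "L \<subseteq> carrier G" using L by (rule subgroup.subset)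
  have "\<exists>h. bij_betw h {..<c} (F \<inter> (g <# L))" if "g \<in> carrier G" for g
    using ex_bij_betw_nat_finite[of "F \<inter> (g <# L)"] F c[OF that] by (auto simp: atLeast0LessThan)
  then have ex: "\<exists>h. bij_betw h {..<c} (F \<inter> D)" if "D \<in> (\<lambda>g. g <# L) ` carrier G" for D
    using that by blast
  define h where "h D = (SOME h. bij_betw h {..<c} (F \<inter> D))" for D
  have h: "bij_betw (h (g <# L)) {..<c} (F \<inter> (g <# L))" if "g \<in> carrier G" for g
    unfolding h_def by (rule someI_ex[OF ex[OF imageI[OF that]]])
  have hin: "h (g <# L) j \<in> F" "h (g <# L) j \<in> g <# L" if "g \<in> carrier G" "j < c" for g j
    using h[OF that(1)] that(2) by (auto simp: bij_betw_def)
  define T where "T j = (\<lambda>g. h (g <# L) j) ` carrier G" for j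
  have Tin: "t \<in> T j \<longleftrightarrow> t \<in> carrier G \<and> t = h (t <# L) j" if j: "j < c" for t j
  proof
    assume "t \<in> T j"
    then obtain g where g: "g \<in> carrier G" "t = h (g <# L) j" by (auto simp: T_def)
    have "t <# L = g <# L" using hin[OF g(1) j] g by (intro l_coset_eqI[OF L]) auto
    then show "t \<in> carrier G \<and> t = h (t <# L) j" using g hin[OF g(1) j] F by auto
  qed (auto simp: T_def)
  have self: "g \<in> g <# L" if "g \<in> carrier G" for g
    using that L by (simp add: mem_l_coset_iff[OF cL] subgroup.one_closed)
  have trans: "left_transversal G L (T j)" if j: "j < c" for j
    unfolding left_transversal_def
  proof (intro conjI ballI)
    show "T j \<subseteq> carrier G" using Tin[OF j] by blast
    fix g assume g: "g \<in> carrier G"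
    show "\<exists>!t. t \<in> T j \<inter> (g <# L)"
    proof
      show "h (g <# L) j \<in> T j \<inter> (g <# L)" using hin[OF g j] g by (auto simp: T_def)
      fix t assume "t \<in> T j \<inter> (g <# L)"
      then show "t = h (g <# L) j" using Tin[OF j] l_coset_eqI[OF L g] by auto
    qed
  qed
  have dis: "T i \<inter> T j = {}" if "i < c" "j < c" "i \<noteq> j" for i j
  proof (rule ccontr)
    assume "T i \<inter> T j \<noteq> {}"
    then obtain t where t: "t \<in> T i" "t \<in> T j" by blast
    then have "t \<in> carrier G" "h (t <# L) i = h (t <# L) j" using Tin that by auto
    then show False using h[of t] that by (auto simp: bij_betw_def inj_on_def)
  qed
  have "F = (\<Union>j<c. T j)"
  proof
    show "F \<subseteq> (\<Union>j<c. T j)"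
    proof
      fix t assume t: "t \<in> F"
      then have tc: "t \<in> carrier G" using F by auto
      then have "t \<in> h (t <# L) ` {..<c}" using h[OF tc] t self by (auto simp: bij_betw_def)
      then show "t \<in> (\<Union>j<c. T j)" using tc by (auto simp: T_def)
    qed
    show "(\<Union>j<c. T j) \<subseteq> F" using hin by (auto simp: T_def)
  qed
  then show ?thesis unfolding finite_union_of_transversals_def
    using trans dis F(3)
    by (intro exI[of _ "T ` {..<c}"]) (fastforce simp: pairwise_def disjnt_def)
qed

text \<open>A set \<open>E\<close> that is almost invariant under translations carrying each coset
  of \<open>N\<close> to each other one meets all cosets in nearly equally many points. Keeping only
  the minimal number \<open>m\<close> of points in every coset discards at most
  \<open>r * card D\<close> points, where \<open>r\<close> is the index of \<open>N\<close>.\<close>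

lemma equidistributed_Folner:
  assumes am: "amenable_group G" and Q: "finite Q" "Q \<subseteq> carrier G" and e: "0 < (e::real)"
    and N: "finite_index_subgroup G N"
  shows "\<exists>F. equidistributed F N \<and> real (card ((\<Union>q\<in>Q. q <# F) - F)) \<le> e * card F"
proof -
  obtain T where sN: "subgroup N G" and T: "finite T" "T \<subseteq> carrier G"
    "\<And>g. g \<in> carrier G \<Longrightarrow> \<exists>t\<in>T. g \<in> t <# N"
    using N unfolding finite_index_iff by blast
  have cN: "N \<subseteq> carrier G" using sN by (rule subgroup.subset)
  define Cs where "Cs = (\<lambda>t. t <# N) ` T"
  have inCs: "g <# N \<in> Cs" if g: "g \<in> carrier G" for g
  proof -
    obtain t where t: "t \<in> T" "g \<in> t <# N" using T(3)[OF g] by blast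
    then have "g <# N = t <# N" using T(2) by (intro l_coset_eqI[OF sN]) auto
    then show ?thesis using t(1) by (simp add: Cs_def)
  qed
  have Csfin: "finite Cs" and Csne: "Cs \<noteq> {}" using T inCs[of \<one>] by (auto simp: Cs_def)
  have Csdisj: "C = C'" if C: "C \<in> Cs" "C' \<in> Cs" and y: "y \<in> C" "y \<in> C'" for C C' y
  proof -
    obtain t t' where t: "t \<in> T" "C = t <# N" "t' \<in> T" "C' = t' <# N"
      using C unfolding Cs_def by blast
    have "y <# N = C" "y <# N = C'"
      using t y T(2) l_coset_eqI[OF sN, of t y] l_coset_eqI[OF sN, of t' y] by auto
    then show ?thesis by simp
  qed
  have self: "g \<in> g <# N" if "g \<in> carrier G" for g
    using that sN by (simp add: mem_l_coset_iff[OF cN] subgroup.one_closed)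
  define r where "r = real (card Cs)"
  have r: "r \<ge> 1" using Csfin Csne by (simp add: r_def Suc_leI card_gt_0_iff)
  \<comment> \<open>Left multiplication by \<open>s \<otimes> inv t\<close> carries the coset of
    \<open>t\<close> onto the coset of \<open>s\<close>.\<close>
  define Q' where "Q' = Q \<union> (\<lambda>(s, t). s \<otimes> inv t) ` (T \<times> T)"
  have Q': "finite Q'" "Q' \<subseteq> carrier G" using Q T by (auto simp: Q'_def)
  \<comment> \<open>The first bound ensures that trimming loses at most half of \<open>E\<close>;
    the second keeps the final error, \<open>(1 + r) * \<eta> * card E\<close> with
    \<open>card E \<le> 2 * card F\<close>, below \<open>e * card F\<close>.\<close>
  define \<eta> where "\<eta> = min (1 / (2 * r)) (e / (2 * (1 + r)))"
  have eta: "0 < \<eta>" "2 * r * \<eta> \<le> 1" "2 * (1 + r) * \<eta> \<le> e"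
  proof -
    have p: "0 < 2 * r" "0 < 2 * (1 + r)" using r by auto
    show "0 < \<eta>" using e p by (simp add: \<eta>_def)
    have "\<eta> \<le> 1 / (2 * r)" "\<eta> \<le> e / (2 * (1 + r))" by (simp_all add: \<eta>_def)
    then show "2 * r * \<eta> \<le> 1" "2 * (1 + r) * \<eta> \<le> e"
      using p by (simp_all only: pos_le_divide_eq mult.commute[of _ \<eta>])
  qed
  obtain E where E: "finite E" "E \<noteq> {}" "E \<subseteq> carrier G"
    and ED: "real (card ((\<Union>s\<in>Q'. s <# E) - E)) \<le> \<eta> * card E"
    using amenable_Folner[OF am Q' eta(1)] by blast
  define D where "D = (\<Union>s\<in>Q'. s <# E) - E"
  have Dfin: "finite D" using Q' E by (auto simp: D_def l_coset_def)
  have cmp: "card (E \<inter> C) \<le> card (E \<inter> C') + card D" if C: "C \<in> Cs" "C' \<in> Cs" for C C'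
  proof -
    obtain t s where t: "t \<in> T" "C = t <# N" "s \<in> T" "C' = s <# N" using C by (auto simp: Cs_def)
    have tc: "t \<in> carrier G" "s \<in> carrier G" using t T by auto
    define q where "q = s \<otimes> inv t"
    have q: "q \<in> Q'" "q \<in> carrier G" using t tc by (auto simp: q_def Q'_def)
    have "(\<lambda>x. q \<otimes> x) ` (E \<inter> C) \<subseteq> (E \<inter> C') \<union> D"
    proof
      fix y assume "y \<in> (\<lambda>x. q \<otimes> x) ` (E \<inter> C)"
      then obtain x where x: "x \<in> E" "x \<in> C" "y = q \<otimes> x" by blast
      have xc: "x \<in> carrier G" using x E by auto
      have "inv s \<otimes> y = inv t \<otimes> x"
        using tc xc by (simp add: x q_def m_assoc) (simp add: m_assoc[symmetric])
      then have "y \<in> C'" using t tc x xc q by (simp add: mem_l_coset_iff[OF cN])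
      moreover have "y \<in> E \<or> y \<in> D" using x q by (auto simp: D_def l_coset_def)
      ultimately show "y \<in> (E \<inter> C') \<union> D" by blast
    qed
    then have "card ((\<lambda>x. q \<otimes> x) ` (E \<inter> C)) \<le> card ((E \<inter> C') \<union> D)"
      using E Dfin by (intro card_mono) auto
    also have "\<dots> \<le> card (E \<inter> C') + card D" by (rule card_Un_le)
    also have "card ((\<lambda>x. q \<otimes> x) ` (E \<inter> C)) = card (E \<inter> C)"
      using q E by (intro card_image inj_onI) (auto simp: subset_iff)
    finally show ?thesis .
  qed
  define m where "m = Min ((\<lambda>C. card (E \<inter> C)) ` Cs)"
  have mle: "m \<le> card (E \<inter> C)" if "C \<in> Cs" for C using that Csfin by (simp add: m_def)
  have "m \<in> (\<lambda>C. card (E \<inter> C)) ` Cs" unfolding m_def using Csfin Csne by (intro Min_in) auto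
  then obtain C0 where C0: "C0 \<in> Cs" "m = card (E \<inter> C0)" by blast
  have "\<exists>B. B \<subseteq> E \<inter> C \<and> card B = m" if "C \<in> Cs" for C
    using obtain_subset_with_card_n[OF mle[OF that]] by metis
  then obtain B where B: "\<And>C. C \<in> Cs \<Longrightarrow> B C \<subseteq> E \<inter> C" "\<And>C. C \<in> Cs \<Longrightarrow> card (B C) = m" by metis
  define F where "F = (\<Union>C\<in>Cs. B C)"
  have FE: "F \<subseteq> E" using B by (auto simp: F_def)
  have FC: "F \<inter> C = B C" if "C \<in> Cs" for C
  proof
    show "B C \<subseteq> F \<inter> C" using B that by (auto simp: F_def)
    show "F \<inter> C \<subseteq> B C"
    proof
      fix y assume "y \<in> F \<inter> C"
      then obtain C' where "C' \<in> Cs" "y \<in> B C'" "y \<in> C" by (auto simp: F_def)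
      then show "y \<in> B C" using Csdisj[of C' C y] B(1)[of C'] that by auto
    qed
  qed
  have cardsum: "card V = (\<Sum>C\<in>Cs. card (V \<inter> C))" if "V \<subseteq> E" for V
  proof -
    have "v \<in> (\<Union>C\<in>Cs. V \<inter> C)" if "v \<in> V" for v
    proof
      show "v <# N \<in> Cs" "v \<in> V \<inter> (v <# N)"
        using \<open>V \<subseteq> E\<close> \<open>v \<in> V\<close> E(3) inCs self by blast+
    qed
    then have "V = (\<Union>C\<in>Cs. V \<inter> C)" by blast
    also have "card \<dots> = (\<Sum>C\<in>Cs. card (V \<inter> C))"
    proof (rule card_UN_disjoint[OF Csfin])
      show "\<forall>C\<in>Cs. finite (V \<inter> C)" using that E(1) by (auto intro: finite_subset)
      show "\<forall>C\<in>Cs. \<forall>C'\<in>Cs. C \<noteq> C' \<longrightarrow> V \<inter> C \<inter> (V \<inter> C') = {}" using Csdisj by blast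
    qed
    finally show ?thesis .
  qed
  have cF: "card F = card Cs * m" using cardsum[OF FE] FC B by simp
  have "card E \<le> (\<Sum>C\<in>Cs. m + card D)"
    unfolding cardsum[OF order_refl] using cmp C0 by (intro sum_mono) auto
  then have "card E \<le> card F + card Cs * card D" by (simp add: cF algebra_simps)
  then have cE: "real (card E) \<le> real (card F) + r * card D"
    unfolding r_def by (metis of_nat_add of_nat_le_iff of_nat_mult)
  have rD: "r * card D \<le> r * (\<eta> * card E)" using ED r by (intro mult_left_mono) (auto simp: D_def)
  have half: "real (card E) \<le> 2 * card F"
  proof -
    have "2 * (r * (\<eta> * card E)) = (2 * r * \<eta>) * card E" by simp
    also have "\<dots> \<le> 1 * real (card E)" using eta by (intro mult_right_mono) auto
    finally show ?thesis using cE rD by linarith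
  qed
  have "card E > 0" using E by (simp add: card_gt_0_iff)
  then have "card F > 0" using half by linarith
  then have "m > 0" using cF by simp
  then have eqd: "equidistributed F N"
  proof -
    have "\<forall>g\<in>carrier G. card (F \<inter> (g <# N)) = m" using FC B inCs by simp
    moreover have "finite F" "F \<subseteq> carrier G" using FE E by (auto intro: finite_subset)
    ultimately show ?thesis unfolding equidistributed_def using \<open>m > 0\<close> by blast
  qed
  have "card ((\<Union>q\<in>Q. q <# F) - F) \<le> card (D \<union> (E - F))"
  proof (rule card_mono)
    have "q <# F \<subseteq> q <# E" for q using FE by (auto simp: l_coset_def)
    then show "(\<Union>q\<in>Q. q <# F) - F \<subseteq> D \<union> (E - F)" unfolding D_def Q'_def by blast
  qed (use Dfin E in simp)
  also have "\<dots> \<le> card D + card (E - F)" by (rule card_Un_le)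
  also have "card (E - F) = card E - card F" using FE E by (intro card_Diff_subset) (auto intro: finite_subset)
  finally have "real (card ((\<Union>q\<in>Q. q <# F) - F)) \<le> real (card D) + (real (card E) - card F)"
    using card_mono[OF E(1) FE] by linarith
  also have "\<dots> \<le> \<eta> * card E + r * (\<eta> * card E)" using cE rD ED by (simp add: D_def)
  also have "\<dots> = (1 + r) * \<eta> * card E" by (simp add: algebra_simps)
  also have "\<dots> \<le> (1 + r) * \<eta> * (2 * real (card F))" using half r eta by (intro mult_left_mono) auto
  also have "\<dots> = (2 * (1 + r) * \<eta>) * card F" by simp
  also have "\<dots> \<le> e * card F" using eta by (intro mult_right_mono) auto
  finally show ?thesis using eqd by blast
qed

end

section \<open>Sums over unions of transversals, and the construction of the sequence\<close>

context group begin

lemma sum_transversal_eq: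
  fixes u :: "'a \<Rightarrow> real"
  assumes L: "subgroup L G" and T: "left_transversal G L T" "left_transversal G L T'"
    and u: "\<And>g l. g \<in> carrier G \<Longrightarrow> l \<in> L \<Longrightarrow> u (g \<otimes> l) = u g"
  shows "(\<Sum>t\<in>T. u t) = (\<Sum>t\<in>T'. u t)"
proof -
  have cL: "L \<subseteq> carrier G" using L by (rule subgroup.subset)
  have Tc: "T \<subseteq> carrier G" "T' \<subseteq> carrier G" using T by (auto simp: left_transversal_def)
  have uniq: "\<exists>!s. s \<in> S \<inter> (t <# L)" if "S = T \<or> S = T'" "t \<in> carrier G" for S t
    using T that by (auto simp: left_transversal_def)
  define p where "p S t = (THE s. s \<in> S \<inter> (t <# L))" for S t
  have p: "p S t \<in> S" "p S t \<in> t <# L" if "S = T \<or> S = T'" "t \<in> carrier G" for S t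
    using theI'[OF uniq[OF that]] by (auto simp: p_def)
  have pu: "s = p S t" if "S = T \<or> S = T'" "t \<in> carrier G" "s \<in> S" "s \<in> t <# L" for S s t
    using uniq[OF that(1,2)] p[OF that(1,2)] that(3,4) by blast
  have sym: "t \<in> s <# L" if "t \<in> carrier G" "s \<in> t <# L" for s t
  proof -
    have "s <# L = t <# L" by (rule l_coset_eqI[OF L that])
    moreover have "t \<in> t <# L" using that L by (simp add: mem_l_coset_iff[OF cL] subgroup.one_closed)
    ultimately show ?thesis by simp
  qed
  have q: "p S t \<in> S" "p S' (p S t) = t" "u (p S t) = u t"
    if S: "S = T \<or> S = T'" "S' = T \<or> S' = T'" "t \<in> S'" for S S' t
  proof -
    have tc: "t \<in> carrier G" using S Tc by blast
    note q = p[OF S(1) tc]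
    have qc: "p S t \<in> carrier G" using q S Tc by blast
    show "p S t \<in> S" by (rule q)
    show "p S' (p S t) = t" by (rule pu[OF S(2) qc S(3) sym[OF tc q(2)], symmetric])
    show "u (p S t) = u t" using q(2) tc u by (auto simp: l_coset_def)
  qed
  show ?thesis by (rule sum.reindex_bij_witness[of _ "p T" "p T'"]) (use q[of T T'] q[of T' T] in auto)
qed

text \<open>Left translation permutes left cosets and so carries transversals to transversals, and
  the sum of a function that is constant on left cosets is the same over all of them. With
  \<open>L\<close> the normalizer of \<open>K\<close> and \<open>u f\<close> a function of the
  conjugate of \<open>K\<close> by \<open>f\<close>, this is exact conjugation invariance of the
  averages over \<open>F\<close>.\<close>

lemma sum_union_transversals_translate:
  fixes u :: "'a \<Rightarrow> real"
  assumes L: "subgroup L G" and F: "finite_union_of_transversals G L F" "finite F"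
    and u: "\<And>g l. g \<in> carrier G \<Longrightarrow> l \<in> L \<Longrightarrow> u (g \<otimes> l) = u g"
    and g: "g \<in> carrier G"
  shows "(\<Sum>f\<in>F. u (g \<otimes> f)) = (\<Sum>f\<in>F. u f)"
proof -
  obtain \<T> where \<T>: "finite \<T>" "\<And>T. T \<in> \<T> \<Longrightarrow> left_transversal G L T" "disjoint \<T>" "F = \<Union>\<T>"
    using F by (auto simp: finite_union_of_transversals_def)
  have cL: "L \<subseteq> carrier G" using L by (rule subgroup.subset)
  have fin: "finite T" if "T \<in> \<T>" for T using F(2) \<T>(4) that by (auto intro: finite_subset)
  have one: "(\<Sum>t\<in>T. u (g \<otimes> t)) = (\<Sum>t\<in>T. u t)" if T: "T \<in> \<T>" for T
  proof -
    have Tc: "T \<subseteq> carrier G" using \<T>(2)[OF T] by (simp add: left_transversal_def)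
    have inj: "inj_on (\<lambda>t. g \<otimes> t) T" using g Tc by (intro inj_onI) (auto simp: subset_iff)
    have "left_transversal G L ((\<lambda>t. g \<otimes> t) ` T)"
      unfolding left_transversal_def
    proof (intro conjI ballI)
      show "(\<lambda>t. g \<otimes> t) ` T \<subseteq> carrier G" using g Tc by auto
      fix x assume x: "x \<in> carrier G"
      have "\<exists>!t. t \<in> T \<inter> ((inv g \<otimes> x) <# L)"
        using \<T>(2)[OF T] g x by (simp add: left_transversal_def)
      moreover have "t \<in> (inv g \<otimes> x) <# L \<longleftrightarrow> g \<otimes> t \<in> x <# L" if "t \<in> T" for t
        using that Tc g x by (auto simp: mem_l_coset_iff[OF cL] inv_mult_group m_assoc subset_iff)
      ultimately show "\<exists>!t. t \<in> (\<lambda>t. g \<otimes> t) ` T \<inter> (x <# L)" by auto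
    qed
    from sum_transversal_eq[OF L this \<T>(2)[OF T] u] show ?thesis
      by (simp add: sum.reindex[OF inj])
  qed
  have "(\<Sum>f\<in>F. u (g \<otimes> f)) = (\<Sum>T\<in>\<T>. \<Sum>t\<in>T. u (g \<otimes> t))"
    unfolding \<T>(4) using fin \<T>(3)
    by (subst sum.Union_disjoint) (auto simp: pairwise_def disjnt_def)
  also have "\<dots> = (\<Sum>T\<in>\<T>. \<Sum>t\<in>T. u t)" using one by simp
  also have "\<dots> = (\<Sum>f\<in>F. u f)"
    unfolding \<T>(4) using fin \<T>(3)
    by (subst sum.Union_disjoint) (auto simp: pairwise_def disjnt_def)
  finally show ?thesis .
qed

text \<open>The indicator of \<open>L\<close> is invariant under right multiplication by
  \<open>N\<close>, so its sum over \<open>F\<close> does not change under translation of the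
  argument; these sums are the numbers of points of \<open>F\<close> in the cosets of
  \<open>L\<close>. The cosets of \<open>N\<close> inside \<open>L\<close> never have to be
  counted.\<close>

lemma equidistributed_mono:
  assumes eq: "equidistributed F N" and N: "subgroup N G" and L: "subgroup L G" "N \<subseteq> L"
  shows "equidistributed F L"
proof -
  have F: "finite F" "F \<subseteq> carrier G" using eq by (auto simp: equidistributed_def)
  have sL: "L \<subseteq> carrier G" using L(1) by (rule subgroup.subset)
  have card_eq: "card (F \<inter> (g <# L)) = card (F \<inter> L)" if g: "g \<in> carrier G" for g
  proof -
    have "x \<otimes> l \<in> L \<longleftrightarrow> x \<in> L" if x: "x \<in> carrier G" and l: "l \<in> N" for x l
    proof
      assume xl: "x \<otimes> l \<in> L"
      have lc: "l \<in> L" "l \<in> carrier G" using l L(2) sL by auto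
      have "x \<otimes> l \<otimes> inv l \<in> L"
        by (rule subgroup.m_closed[OF L(1) xl subgroup.m_inv_closed[OF L(1) lc(1)]])
      then show "x \<in> L" using x lc by (simp add: m_assoc)
    qed (use l L in \<open>auto intro: subgroup.m_closed\<close>)
    then have "(\<Sum>f\<in>F. indicator L (inv g \<otimes> f)) = (\<Sum>f\<in>F. indicator L f :: real)"
      using equidistributed_imp_transversals[OF eq N] g
      by (intro sum_union_transversals_translate[OF N _ F(1)]) (auto simp: indicator_def)
    moreover have "(\<Sum>f\<in>F. indicator L (inv g \<otimes> f)) = (\<Sum>f\<in>F. indicator (g <# L) f :: real)"
      using F g by (intro sum.cong) (auto simp: indicator_def mem_l_coset_iff[OF sL])
    moreover have "(\<Sum>f\<in>F. indicator X f :: real) = card (F \<inter> X)" for X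
      using F(1) by (simp add: indicator_def of_bool_def sum.If_cases)
    ultimately show ?thesis by simp
  qed
  obtain f where f: "f \<in> F" using equidistributed_nonempty[OF eq] by blast
  then have "f \<in> F \<inter> (f <# L)" using F L(1) by (auto simp: mem_l_coset_iff[OF sL] subgroup.one_closed)
  then have "card (F \<inter> (f <# L)) > 0" using F(1) by (auto simp: card_gt_0_iff)
  then have "card (F \<inter> L) > 0" using card_eq f F(2) by auto
  then show ?thesis unfolding equidistributed_def using F card_eq by blast
qed

text \<open>\<open>F i\<close> is chosen after all earlier \<open>F j\<close>, so temperedness is
  just almost invariance of \<open>F i\<close> under the finite set of their inverses. The same set
  of test elements contains an initial segment of an enumeration of the group, which yields the
  Folner condition in the limit.\<close>

lemma ex_tempered_Folner_sequence:
  assumes fg: "finitely_generated_group G" and am: "amenable_group G"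
  obtains F N :: "nat \<Rightarrow> 'a set"
  where "\<And>i. finite_index_subgroup G (N i)" "\<And>i. N (Suc i) \<subseteq> N i"
    "\<And>K. finite_index_subgroup G K \<Longrightarrow> \<exists>i. N i \<subseteq> K"
    "\<And>i. equidistributed (F i) (N i)"
    "\<And>i. real (card ((\<Union>j<i. \<Union>f\<in>F j. inv f <# F i) - F i)) \<le> (1 / 2) ^ Suc i * card (F i)"
    "\<And>g. g \<in> carrier G \<Longrightarrow> (\<lambda>i. real (card ((g <# F i) - F i)) / card (F i)) \<longlonglongrightarrow> 0"
proof -
  define g where "g = from_nat_into (carrier G)"
  have g: "g i \<in> carrier G" for i unfolding g_def by (rule from_nat_into) auto
  define Ks where "Ks = from_nat_into {K. finite_index_subgroup G K}"
  have Ks: "finite_index_subgroup G (Ks i)" for i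
    using from_nat_into[of "{K. finite_index_subgroup G K}" i] finite_index_carrier
    by (auto simp: Ks_def)
  define N where "N i = (\<Inter>k\<le>i. Ks k)" for i :: nat
  have N: "finite_index_subgroup G (N i)" for i
  proof (induction i)
    case (Suc i)
    have "N (Suc i) = Ks (Suc i) \<inter> N i" by (simp add: N_def atMost_Suc)
    then show ?case using Suc Ks finite_index_Int by simp
  qed (simp add: N_def Ks)
  \<comment> \<open>The inverses of \<open>A\<close> are there for temperedness, the elements
    \<open>g 0\<close> to \<open>g i\<close> for the Folner property.\<close>
  define Q where "Q A i = m_inv G ` A \<union> g ` {..i}" for A and i :: nat
  define P where "P i s \<longleftrightarrow> finite (fst s) \<and> fst s \<subseteq> carrier G \<and> equidistributed (snd s) (N i) \<and>
    real (card ((\<Union>q\<in>Q (fst s) i. q <# snd s) - snd s)) \<le> (1 / 2) ^ Suc i * card (snd s)" for i s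
  have ex: "\<exists>F. P i (A, F)" if A: "finite A" "A \<subseteq> carrier G" for A i
    using equidistributed_Folner[OF am _ _ _ N, of "Q A i" "(1 / 2) ^ Suc i" i] A g
    by (auto simp: P_def Q_def)
  \<comment> \<open>The state is a pair: the accumulated union of all earlier sets, and the current
    set.\<close>
  have "\<exists>s. \<forall>i. P i (s i) \<and> fst (s (Suc i)) = fst (s i) \<union> snd (s i)"
  proof (rule dependent_nat_choice)
    show "\<exists>s. P 0 s" using ex[of "{}" 0] by blast
    fix s i assume s: "P i s"
    then have "finite (fst s \<union> snd s)" "fst s \<union> snd s \<subseteq> carrier G"
      by (auto simp: P_def equidistributed_def)
    from ex[OF this, of "Suc i"] show "\<exists>t. P (Suc i) t \<and> fst t = fst s \<union> snd s" by auto
  qed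
  then obtain s where s: "\<And>i. P i (s i)" "\<And>i. fst (s (Suc i)) = fst (s i) \<union> snd (s i)" by blast
  define F where "F i = snd (s i)" for i
  have acc: "F j \<subseteq> fst (s i)" if "j < i" for i j
    using that by (induction i) (auto simp: s(2) F_def less_Suc_eq)
  have eqd: "equidistributed (F i) (N i)" for i using s(1)[of i] by (simp add: P_def F_def)
  have bound: "real (card (V - F i)) \<le> (1 / 2) ^ Suc i * card (F i)"
    if V: "V \<subseteq> (\<Union>q\<in>Q (fst (s i)) i. q <# F i)" for V i
  proof -
    have fin: "finite (\<Union>q\<in>Q (fst (s i)) i. q <# F i)"
      using s(1)[of i] by (auto simp: P_def F_def Q_def l_coset_def equidistributed_def)
    have "card (V - F i) \<le> card ((\<Union>q\<in>Q (fst (s i)) i. q <# F i) - F i)"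
      using V fin by (intro card_mono) auto
    also have "real \<dots> \<le> (1 / 2) ^ Suc i * card (F i)" using s(1)[of i] by (simp add: P_def F_def)
    finally show ?thesis by simp
  qed
  show thesis
  proof (rule that[of N F])
    show "finite_index_subgroup G (N i)" "equidistributed (F i) (N i)" for i by fact+
    show "N (Suc i) \<subseteq> N i" for i by (auto simp: N_def)
    show "\<exists>i. N i \<subseteq> K" if "finite_index_subgroup G K" for K
    proof -
      have "K \<in> range Ks" unfolding Ks_def
        using from_nat_into_surj[OF countable_finite_index[OF fg], of K] that by blast
      then show ?thesis by (auto simp: N_def)
    qed
    show "real (card ((\<Union>j<i. \<Union>f\<in>F j. inv f <# F i) - F i)) \<le> (1 / 2) ^ Suc i * card (F i)" for i
      using acc by (intro bound) (auto simp: Q_def)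
    show "(\<lambda>i. real (card ((x <# F i) - F i)) / card (F i)) \<longlonglongrightarrow> 0" if x: "x \<in> carrier G" for x
    proof (rule real_tendsto_sandwich[of "\<lambda>_. 0" _ _ "\<lambda>i. (1 / 2) ^ Suc i"])
      obtain k where k: "g k = x"
        using from_nat_into_surj[OF countable_carrier[OF fg] x] by (auto simp: g_def)
      have le: "real (card ((x <# F i) - F i)) / card (F i) \<le> (1 / 2) ^ Suc i" if "i \<ge> k" for i
      proof -
        have "real (card ((x <# F i) - F i)) \<le> (1 / 2) ^ Suc i * card (F i)"
          using k that by (intro bound) (auto simp: Q_def)
        moreover have "card (F i) > 0"
          using eqd[of i] equidistributed_nonempty[OF eqd[of i]] by (auto simp: equidistributed_def card_gt_0_iff)
        ultimately show ?thesis by (simp add: pos_divide_le_eq)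
      qed
      show "\<forall>\<^sub>F i in sequentially. real (card ((x <# F i) - F i)) / card (F i) \<le> (1 / 2) ^ Suc i"
        using le by (auto simp: eventually_sequentially)
      show "(\<lambda>i. (1 / 2 :: real) ^ Suc i) \<longlonglongrightarrow> 0"
        by (intro LIMSEQ_Suc LIMSEQ_power_zero) simp
    qed auto
  qed
qed

end

section \<open>A maximal inequality along tempered sequences\<close>

text \<open>The action laws are required only on \<open>space M\<close>, because conjugation obeys
  them for subgroups and not for arbitrary sets.\<close>

locale pmp_action = group G + prob_space M
  for G :: "('a, 'b) monoid_scheme" (structure) and M :: "'x measure" +
  fixes \<tau> :: "'a \<Rightarrow> 'x \<Rightarrow> 'x"
  assumes act_measurable: "g \<in> carrier G \<Longrightarrow> \<tau> g \<in> measurable M M"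
    and act_distr: "g \<in> carrier G \<Longrightarrow> distr M M (\<tau> g) = M"
    and act_one: "x \<in> space M \<Longrightarrow> \<tau> \<one> x = x"
    and act_mult: "g \<in> carrier G \<Longrightarrow> h \<in> carrier G \<Longrightarrow> x \<in> space M \<Longrightarrow> \<tau> (g \<otimes> h) x = \<tau> g (\<tau> h x)"
begin

text \<open>A class closed under arithmetic and under the action, which settles all integrability
  conditions. The bound holds at every point of the space, so translates inherit it without
  exceptional sets.\<close>

definition bounded_meas :: "('x \<Rightarrow> real) \<Rightarrow> bool" where
  "bounded_meas f \<longleftrightarrow> f \<in> borel_measurable M \<and> (\<exists>B. \<forall>x\<in>space M. \<bar>f x\<bar> \<le> B)"

lemma bmI: "f \<in> borel_measurable M \<Longrightarrow> (\<And>x. x \<in> space M \<Longrightarrow> \<bar>f x\<bar> \<le> B) \<Longrightarrow> bounded_meas f"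
  by (auto simp: bounded_meas_def)

lemma bm_measurable: "bounded_meas f \<Longrightarrow> f \<in> borel_measurable M"
  by (simp add: bounded_meas_def)

lemma bm_integrable: "bounded_meas f \<Longrightarrow> integrable M f"
  unfolding bounded_meas_def by (auto intro!: integrable_const_bound[of f] AE_I2)

lemma bm_const: "bounded_meas (\<lambda>x. c)"
  by (rule bmI[of _ "\<bar>c\<bar>"]) auto

lemma bm_add: assumes "bounded_meas f" "bounded_meas g" shows "bounded_meas (\<lambda>x. f x + g x)"
proof -
  obtain B C where "\<And>x. x \<in> space M \<Longrightarrow> \<bar>f x\<bar> \<le> B" "\<And>x. x \<in> space M \<Longrightarrow> \<bar>g x\<bar> \<le> C"
    using assms by (auto simp: bounded_meas_def)
  then show ?thesis using assms
    by (intro bmI[of _ "B + C"]) (auto simp: bounded_meas_def intro: order_trans[OF abs_triangle_ineq] add_mono)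
qed

lemma bm_mult: assumes "bounded_meas f" "bounded_meas g" shows "bounded_meas (\<lambda>x. f x * g x)"
proof -
  obtain B C where BC: "\<And>x. x \<in> space M \<Longrightarrow> \<bar>f x\<bar> \<le> B" "\<And>x. x \<in> space M \<Longrightarrow> \<bar>g x\<bar> \<le> C"
    using assms by (auto simp: bounded_meas_def)
  show ?thesis
  proof (rule bmI[of _ "B * C"])
    fix x assume x: "x \<in> space M"
    have "0 \<le> B" using BC(1)[OF x] by linarith
    then show "\<bar>f x * g x\<bar> \<le> B * C" unfolding abs_mult using BC[OF x] by (intro mult_mono) auto
  qed (use assms in \<open>auto simp: bounded_meas_def\<close>)
qed

lemma bm_diff: assumes "bounded_meas f" "bounded_meas g" shows "bounded_meas (\<lambda>x. f x - g x)"
  using bm_add[OF assms(1) bm_mult[OF bm_const[of "-1"] assms(2)]] by simp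

lemma bm_divide: "bounded_meas f \<Longrightarrow> bounded_meas (\<lambda>x. f x / c)"
  using bm_mult[OF _ bm_const[of "inverse c"]] by (simp add: divide_inverse)

lemma bm_power2: "bounded_meas f \<Longrightarrow> bounded_meas (\<lambda>x. (f x)\<^sup>2)"
  using bm_mult[of f f] by (simp add: power2_eq_square)

lemma bm_abs: "bounded_meas f \<Longrightarrow> bounded_meas (\<lambda>x. \<bar>f x\<bar>)"
  by (auto simp: bounded_meas_def)

lemma bm_sum: "(\<And>i. i \<in> I \<Longrightarrow> bounded_meas (f i)) \<Longrightarrow> bounded_meas (\<lambda>x. \<Sum>i\<in>I. f i x)"
  by (induction I rule: infinite_finite_induct) (auto intro: bm_add bm_const)

lemma bm_indicator: "E \<in> sets M \<Longrightarrow> bounded_meas (indicator E)"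
  by (rule bmI[of _ 1]) (auto simp: indicator_def)

lemma act_space: "g \<in> carrier G \<Longrightarrow> x \<in> space M \<Longrightarrow> \<tau> g x \<in> space M"
  using act_measurable by (rule measurable_space)

lemma bm_act: assumes "bounded_meas f" "g \<in> carrier G" shows "bounded_meas (\<lambda>x. f (\<tau> g x))"
proof -
  obtain B where "\<And>x. x \<in> space M \<Longrightarrow> \<bar>f x\<bar> \<le> B" using assms by (auto simp: bounded_meas_def)
  then show ?thesis
    using assms act_space measurable_compose[OF act_measurable bm_measurable] by (intro bmI[of _ B]) auto
qed

lemmas bm_intros = bm_const bm_add bm_mult bm_diff bm_divide bm_power2 bm_abs bm_sum bm_indicator bm_act

lemma integral_act:
  assumes "bounded_meas f" "g \<in> carrier G" shows "(\<integral>x. f (\<tau> g x) \<partial>M) = (\<integral>x. f x \<partial>M)"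
proof -
  have "(\<integral>x. f (\<tau> g x) \<partial>M) = (\<integral>x. f x \<partial>distr M M (\<tau> g))"
    using assms by (intro integral_distr[symmetric] act_measurable bm_measurable)
  then show ?thesis using assms by (simp add: act_distr)
qed

lemma AE_act: assumes "g \<in> carrier G" "AE x in M. P x" shows "AE x in M. P (\<tau> g x)"
proof (rule AE_distrD[of _ M M])
  show "\<tau> g \<in> measurable M M" by (rule act_measurable[OF assms(1)])
  show "AE x in distr M M (\<tau> g). P x" unfolding act_distr[OF assms(1)] by (rule assms(2))
qed

lemma act_inv: "g \<in> carrier G \<Longrightarrow> x \<in> space M \<Longrightarrow> \<tau> (inv g) (\<tau> g x) = x"
  by (metis act_mult act_one inv_closed l_inv)

lemma integral_mono_bm:
  assumes "bounded_meas f" "bounded_meas g" "\<And>x. x \<in> space M \<Longrightarrow> f x \<le> g x"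
  shows "(\<integral>x. f x \<partial>M) \<le> (\<integral>x. g x \<partial>M)"
  using assms by (intro integral_mono bm_integrable)

end

text \<open>\<open>F_tempered\<close> is Shulman's condition with constant 2: the translates of
  \<open>F i\<close> by inverses of earlier elements contribute at most \<open>card (F i)\<close>
  new points.\<close>

locale tempered_Folner_action = pmp_action G M \<tau>
  for G :: "('a, 'b) monoid_scheme" (structure) and M :: "'x measure" and \<tau> :: "'a \<Rightarrow> 'x \<Rightarrow> 'x" +
  fixes F :: "nat \<Rightarrow> 'a set"
  assumes F_finite: "finite (F i)" and F_nonempty: "F i \<noteq> {}" and F_carrier: "F i \<subseteq> carrier G"
    and F_tempered: "card ((\<Union>j<i. \<Union>f\<in>F j. inv f <# F i) - F i) \<le> card (F i)"
    and F_Folner: "g \<in> carrier G \<Longrightarrow> (\<lambda>i. real (card ((g <# F i) - F i)) / card (F i)) \<longlonglongrightarrow> 0"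
begin

section \<open>Averaging operators, their adjoints, and the maximal inequality\<close>

definition avg :: "nat \<Rightarrow> ('x \<Rightarrow> real) \<Rightarrow> 'x \<Rightarrow> real" where
  "avg i f x = (\<Sum>g\<in>F i. f (\<tau> g x)) / card (F i)"

text \<open>The adjoint of \<open>avg i\<close> in L^2, by invariance of the measure.\<close>

definition dual_avg :: "nat \<Rightarrow> ('x \<Rightarrow> real) \<Rightarrow> 'x \<Rightarrow> real" where
  "dual_avg i f x = (\<Sum>g\<in>F i. f (\<tau> (inv g) x)) / card (F i)"

lemma F_in: "g \<in> F i \<Longrightarrow> g \<in> carrier G"
  using F_carrier by auto

lemma card_F_pos: "0 < real (card (F i))"
  using F_finite F_nonempty by (simp add: card_gt_0_iff)

lemma bm_avg: "bounded_meas f \<Longrightarrow> bounded_meas (avg i f)"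
  unfolding avg_def by (intro bm_intros F_in)

lemma bm_dual_avg: "bounded_meas f \<Longrightarrow> bounded_meas (dual_avg i f)"
  unfolding dual_avg_def by (intro bm_intros inv_closed F_in)

lemma avg_diff: "avg i (\<lambda>x. f x - h x) x = avg i f x - avg i h x"
  by (simp add: avg_def sum_subtractf diff_divide_distrib)

lemma abs_avg_le: "\<bar>avg i f x\<bar> \<le> avg i (\<lambda>x. \<bar>f x\<bar>) x"
  unfolding avg_def by (simp add: divide_right_mono sum_abs)

lemma avg_const: "avg i (\<lambda>x. c) x = c"
  using card_F_pos[of i] by (simp add: avg_def)

lemma integral_avg: assumes "bounded_meas f" shows "(\<integral>x. avg i f x \<partial>M) = (\<integral>x. f x \<partial>M)"
proof -
  have "(\<integral>x. avg i f x \<partial>M) = (\<Sum>g\<in>F i. \<integral>x. f (\<tau> g x) \<partial>M) / card (F i)"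
    unfolding avg_def using assms by (subst integral_divide_zero, subst Bochner_Integration.integral_sum)
      (auto intro!: bm_integrable bm_intros F_in)
  also have "(\<Sum>g\<in>F i. \<integral>x. f (\<tau> g x) \<partial>M) = (\<Sum>g\<in>F i. \<integral>x. f x \<partial>M)"
    using assms by (intro sum.cong integral_act F_in) auto
  finally show ?thesis using card_F_pos[of i] by simp
qed

lemma integral_dual_avg:
  assumes f: "bounded_meas f" and h: "bounded_meas h"
  shows "(\<integral>x. dual_avg i f x * h x \<partial>M) = (\<integral>x. f x * avg i h x \<partial>M)"
proof -
  have *: "(\<integral>x. f (\<tau> (inv g) x) * h x \<partial>M) = (\<integral>x. f x * h (\<tau> g x) \<partial>M)" if g: "g \<in> carrier G" for g
  proof -
    have "(\<integral>x. f (\<tau> (inv g) x) * h x \<partial>M) = (\<integral>x. f (\<tau> (inv g) (\<tau> g x)) * h (\<tau> g x) \<partial>M)"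
      using f h g by (intro integral_act[symmetric] bm_intros) auto
    also have "\<dots> = (\<integral>x. f x * h (\<tau> g x) \<partial>M)"
      using g by (intro Bochner_Integration.integral_cong) (auto simp: act_inv)
    finally show ?thesis .
  qed
  have "(\<integral>x. dual_avg i f x * h x \<partial>M) = (\<integral>x. (\<Sum>g\<in>F i. f (\<tau> (inv g) x) * h x) / card (F i) \<partial>M)"
    by (simp add: dual_avg_def sum_distrib_right)
  also have "\<dots> = (\<Sum>g\<in>F i. \<integral>x. f (\<tau> (inv g) x) * h x \<partial>M) / card (F i)"
    using f h by (subst integral_divide_zero, subst Bochner_Integration.integral_sum)
      (auto intro!: bm_integrable bm_intros intro: F_in)
  also have "\<dots> = (\<Sum>g\<in>F i. \<integral>x. f x * h (\<tau> g x) \<partial>M) / card (F i)"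
    using * F_in by simp
  also have "\<dots> = (\<integral>x. (\<Sum>g\<in>F i. f x * h (\<tau> g x)) / card (F i) \<partial>M)"
    using f h by (subst integral_divide_zero, subst Bochner_Integration.integral_sum)
      (auto intro!: bm_integrable bm_intros F_in)
  also have "\<dots> = (\<integral>x. f x * avg i h x \<partial>M)"
    by (simp add: avg_def sum_distrib_left)
  finally show ?thesis .
qed

text \<open>The averaging operators almost absorb the dual operators of smaller index: this is where
  temperedness enters.\<close>

lemma avg_dual_avg_le:
  assumes l: "l < k" and f: "\<And>y. y \<in> space M \<Longrightarrow> 0 \<le> f y" and x: "x \<in> space M"
  defines "R \<equiv> (\<Union>j<k. \<Union>f\<in>F j. inv f <# F k) - F k"
  shows "avg k (dual_avg l f) x \<le> (\<Sum>c\<in>F k \<union> R. f (\<tau> c x)) / card (F k)"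
proof -
  let ?S = "\<Sum>c\<in>F k \<union> R. f (\<tau> c x)"
  have Rc: "R \<subseteq> carrier G" "finite R"
    using F_in F_finite by (auto simp: R_def l_coset_def)
  \<comment> \<open>For \<open>b \<in> F l\<close> with \<open>l < k\<close> the translate
    \<open>inv b <# F k\<close> stays inside \<open>F k \<union> R\<close>, so this bound is uniform
    in \<open>b\<close> and survives the average over \<open>F l\<close>.\<close>
  have one: "(\<Sum>a\<in>F k. f (\<tau> (inv b) (\<tau> a x))) \<le> ?S" if b: "b \<in> F l" for b
  proof -
    have bc: "b \<in> carrier G" using b by (rule F_in)
    have inj: "inj_on (\<lambda>a. inv b \<otimes> a) (F k)" using bc F_in by (intro inj_onI) auto
    have "(\<Sum>a\<in>F k. f (\<tau> (inv b) (\<tau> a x))) = (\<Sum>a\<in>F k. f (\<tau> (inv b \<otimes> a) x))"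
      using bc x F_in by (intro sum.cong) (auto simp: act_mult)
    also have "\<dots> = (\<Sum>c\<in>(\<lambda>a. inv b \<otimes> a) ` F k. f (\<tau> c x))"
      by (simp add: sum.reindex[OF inj])
    also have "\<dots> \<le> ?S"
    proof (rule sum_mono2)
      show "finite (F k \<union> R)" using Rc F_finite by simp
      show "(\<lambda>a. inv b \<otimes> a) ` F k \<subseteq> F k \<union> R"
        using b l by (auto simp: R_def l_coset_def)
      show "0 \<le> f (\<tau> c x)" if "c \<in> F k \<union> R - (\<lambda>a. inv b \<otimes> a) ` F k" for c
        using that Rc F_in x by (intro f act_space) auto
    qed
    finally show ?thesis .
  qed
  have "avg k (dual_avg l f) x = (\<Sum>a\<in>F k. \<Sum>b\<in>F l. f (\<tau> (inv b) (\<tau> a x))) / card (F l) / card (F k)"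
    by (simp add: avg_def dual_avg_def sum_divide_distrib)
  also have "(\<Sum>a\<in>F k. \<Sum>b\<in>F l. f (\<tau> (inv b) (\<tau> a x))) = (\<Sum>b\<in>F l. \<Sum>a\<in>F k. f (\<tau> (inv b) (\<tau> a x)))"
    by (rule sum.swap)
  also have "\<dots> / card (F l) / card (F k) \<le> (\<Sum>b\<in>F l. ?S) / card (F l) / card (F k)"
    using one by (intro divide_right_mono sum_mono) auto
  finally show ?thesis using card_F_pos[of l] by simp
qed

lemma square_sum_eq:
  fixes a :: "nat \<Rightarrow> real"
  shows "(\<Sum>k<n. a k)\<^sup>2 = (\<Sum>k<n. (a k)\<^sup>2) + 2 * (\<Sum>k<n. a k * (\<Sum>l<k. a l))"
  by (induction n) (auto simp: power2_eq_square algebra_simps)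

text \<open>\<open>S\<close> is the adjoint of the linearized maximal operator, which sends \<phi>
  to the sum of \<open>indicator (E k) * avg k \<phi>\<close>, applied to the constant 1. When its
  square is expanded, a product of terms with indices \<open>l < k\<close> turns into
  \<open>avg k\<close> applied to a dual average of smaller index, which temperedness controls. The
  sets are disjoint, so the sum over \<open>l\<close> costs no factor \<open>n\<close>.\<close>

lemma dual_square_bound:
  fixes n :: nat and E :: "nat \<Rightarrow> 'x set"
  assumes E: "\<And>k. k < n \<Longrightarrow> E k \<in> sets M" and disj: "disjoint_family_on E {..<n}"
  defines "U \<equiv> \<Union>k<n. E k"
  defines "S \<equiv> \<lambda>x. \<Sum>k<n. dual_avg k (indicator (E k)) x"
  shows "(\<integral>x. (S x)\<^sup>2 \<partial>M) \<le> 10 * prob U"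
proof -
  have U: "U \<in> sets M" using E by (auto simp: U_def)
  define a where "a k = dual_avg k (indicator (E k))" for k
  have bma: "bounded_meas (a k)" if "k < n" for k unfolding a_def by (intro bm_dual_avg bm_indicator E that)
  have a01: "0 \<le> a k x" "a k x \<le> 1" for k x
  proof -
    show "0 \<le> a k x" by (auto simp: a_def dual_avg_def intro!: divide_nonneg_nonneg sum_nonneg)
    have "(\<Sum>g\<in>F k. indicator (E k) (\<tau> (inv g) x)) \<le> (\<Sum>g\<in>F k. (1::real))"
      by (intro sum_mono) (auto simp: indicator_def)
    then show "a k x \<le> 1" using card_F_pos[of k] by (simp add: a_def dual_avg_def)
  qed
  have inta: "(\<integral>x. a k x \<partial>M) = prob (E k)" if "k < n" for k
  proof -
    have "(\<integral>x. a k x * 1 \<partial>M) = (\<integral>x. indicator (E k) x * avg k (\<lambda>x. 1) x \<partial>M)"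
      unfolding a_def by (intro integral_dual_avg bm_intros E that)
    then show ?thesis using E that by (simp add: avg_const)
  qed
  have probU: "(\<Sum>k<n. prob (E k)) = prob U"
    unfolding U_def using E disj by (intro finite_measure_finite_Union[symmetric]) auto
  have bmS: "bounded_meas S" unfolding S_def a_def[symmetric] by (intro bm_sum bma) auto
  \<comment> \<open>The summand \<open>prob (E k)\<close> comes from the new points
    \<open>R\<close>: there are at most \<open>card (F k)\<close> of them, so they add at most 1 to
    the average.\<close>
  have cross: "(\<integral>x. a k x * (\<Sum>l<k. a l x) \<partial>M) \<le> (\<integral>x. a k x * indicator U x \<partial>M) + prob (E k)"
    if k: "k < n" for k
  proof -
    have bms: "bounded_meas (\<lambda>x. \<Sum>l<k. a l x)" using k by (intro bm_sum bma) auto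
    define R where "R = (\<Union>j<k. \<Union>f\<in>F j. inv f <# F k) - F k"
    have Rfin: "finite R" using F_finite by (auto simp: R_def l_coset_def)
    have pt: "avg k (\<lambda>x. \<Sum>l<k. a l x) x \<le> avg k (indicator U) x + 1" if x: "x \<in> space M" for x
    proof -
      have "avg k (\<lambda>x. \<Sum>l<k. a l x) x = (\<Sum>l<k. avg k (a l) x)"
        unfolding avg_def by (subst sum.swap) (simp add: sum_divide_distrib)
      also have "\<dots> \<le> (\<Sum>l<k. (\<Sum>c\<in>F k \<union> R. indicator (E l) (\<tau> c x)) / card (F k))"
        unfolding a_def R_def using x by (intro sum_mono avg_dual_avg_le) auto
      also have "\<dots> = (\<Sum>c\<in>F k \<union> R. \<Sum>l<k. indicator (E l) (\<tau> c x)) / card (F k)"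
        by (simp add: sum_divide_distrib[symmetric] sum.swap[of _ "{..<k}"])
      also have "\<dots> \<le> (\<Sum>c\<in>F k \<union> R. indicator U (\<tau> c x)) / card (F k)"
      proof (rule divide_right_mono[OF sum_mono])
        fix c
        have "(\<Sum>l<k. indicator (E l) (\<tau> c x)) = (indicator (\<Union>l<k. E l) (\<tau> c x) :: real)"
          using k disj by (intro indicator_UN_disjoint[symmetric]) (auto simp: disjoint_family_on_def)
        also have "\<dots> \<le> indicator U (\<tau> c x)" using k by (auto simp: U_def indicator_def)
        finally show "(\<Sum>l<k. indicator (E l) (\<tau> c x)) \<le> (indicator U (\<tau> c x) :: real)" .
      qed auto
      also have "(\<Sum>c\<in>F k \<union> R. indicator U (\<tau> c x)) =
          (\<Sum>c\<in>F k. indicator U (\<tau> c x)) + (\<Sum>c\<in>R. indicator U (\<tau> c x) :: real)"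
        using F_finite Rfin by (intro sum.union_disjoint) (auto simp: R_def)
      also have "\<dots> / card (F k) \<le> ((\<Sum>c\<in>F k. indicator U (\<tau> c x)) + real (card (F k))) / real (card (F k))"
      proof (intro divide_right_mono add_left_mono)
        have "(\<Sum>c\<in>R. indicator U (\<tau> c x) :: real) \<le> (\<Sum>c\<in>R. 1)"
          by (intro sum_mono) (auto simp: indicator_def)
        also have "\<dots> \<le> card (F k)" using F_tempered[of k] by (simp add: R_def)
        finally show "(\<Sum>c\<in>R. indicator U (\<tau> c x) :: real) \<le> card (F k)" .
      qed auto
      also have "\<dots> = avg k (indicator U) x + 1"
        using card_F_pos[of k] by (simp add: avg_def add_divide_distrib)
      finally show ?thesis .
    qed
    have "(\<integral>x. a k x * (\<Sum>l<k. a l x) \<partial>M) = (\<integral>x. indicator (E k) x * avg k (\<lambda>x. \<Sum>l<k. a l x) x \<partial>M)"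
      unfolding a_def[of k] by (intro integral_dual_avg bms bm_indicator E k)
    also have "\<dots> \<le> (\<integral>x. indicator (E k) x * (avg k (indicator U) x + 1) \<partial>M)"
    proof (rule integral_mono_bm)
      show "bounded_meas (\<lambda>x. indicator (E k) x * avg k (\<lambda>x. \<Sum>l<k. a l x) x)"
        by (rule bm_mult[OF bm_indicator[OF E[OF k]] bm_avg[OF bms]])
      show "bounded_meas (\<lambda>x. indicator (E k) x * (avg k (indicator U) x + 1))"
        by (rule bm_mult[OF bm_indicator[OF E[OF k]] bm_add[OF bm_avg[OF bm_indicator[OF U]] bm_const]])
      show "indicator (E k) x * avg k (\<lambda>x. \<Sum>l<k. a l x) x \<le> indicator (E k) x * (avg k (indicator U) x + 1)"
        if "x \<in> space M" for x
        using pt[OF that] by (intro mult_left_mono) auto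
    qed
    also have "\<dots> = (\<integral>x. indicator (E k) x * avg k (indicator U) x \<partial>M) + (\<integral>x. indicator (E k) x \<partial>M)"
      using k U by (subst Bochner_Integration.integral_add[symmetric])
        (auto intro!: bm_integrable bm_intros bm_avg E simp: algebra_simps)
    also have "(\<integral>x. indicator (E k) x * avg k (indicator U) x \<partial>M) = (\<integral>x. a k x * indicator U x \<partial>M)"
      unfolding a_def by (intro integral_dual_avg[symmetric] bm_indicator E k U)
    finally show ?thesis using E k by simp
  qed
  have "(\<integral>x. (S x)\<^sup>2 \<partial>M) = (\<integral>x. (\<Sum>k<n. (a k x)\<^sup>2) + 2 * (\<Sum>k<n. a k x * (\<Sum>l<k. a l x)) \<partial>M)"
    unfolding S_def a_def[symmetric] square_sum_eq ..
  also have "\<dots> = (\<Sum>k<n. \<integral>x. (a k x)\<^sup>2 \<partial>M) + 2 * (\<Sum>k<n. \<integral>x. a k x * (\<Sum>l<k. a l x) \<partial>M)"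
  proof -
    have 1: "bounded_meas (\<lambda>x. (a k x)\<^sup>2)" if "k < n" for k by (rule bm_power2[OF bma[OF that]])
    have 2: "bounded_meas (\<lambda>x. a k x * (\<Sum>l<k. a l x))" if "k < n" for k
      using that by (intro bm_mult bm_sum bma) auto
    have 3: "bounded_meas (\<lambda>x. \<Sum>k<n. a k x * (\<Sum>l<k. a l x))" by (rule bm_sum) (simp add: 2)
    have "(\<integral>x. (\<Sum>k<n. (a k x)\<^sup>2) + 2 * (\<Sum>k<n. a k x * (\<Sum>l<k. a l x)) \<partial>M) =
        (\<integral>x. (\<Sum>k<n. (a k x)\<^sup>2) \<partial>M) + (\<integral>x. 2 * (\<Sum>k<n. a k x * (\<Sum>l<k. a l x)) \<partial>M)"
      by (intro Bochner_Integration.integral_add bm_integrable bm_sum bm_mult[OF bm_const 3]) (simp add: 1)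
    also have "(\<integral>x. (\<Sum>k<n. (a k x)\<^sup>2) \<partial>M) = (\<Sum>k<n. \<integral>x. (a k x)\<^sup>2 \<partial>M)"
      by (intro Bochner_Integration.integral_sum bm_integrable) (simp add: 1)
    also have "(\<integral>x. 2 * (\<Sum>k<n. a k x * (\<Sum>l<k. a l x)) \<partial>M) =
        2 * (\<Sum>k<n. \<integral>x. a k x * (\<Sum>l<k. a l x) \<partial>M)"
      by (subst integral_mult_right_zero, subst Bochner_Integration.integral_sum)
        (auto intro: bm_integrable 2)
    finally show ?thesis .
  qed
  also have "\<dots> \<le> (\<Sum>k<n. prob (E k)) + 2 * (\<Sum>k<n. (\<integral>x. a k x * indicator U x \<partial>M) + prob (E k))"
  proof (intro add_mono mult_left_mono sum_mono)
    fix k assume k: "k \<in> {..<n}"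
    have "(\<integral>x. (a k x)\<^sup>2 \<partial>M) \<le> (\<integral>x. a k x \<partial>M)"
      using k a01 by (intro integral_mono_bm bm_intros bma) (auto simp: power2_eq_square mult_left_le)
    then show "(\<integral>x. (a k x)\<^sup>2 \<partial>M) \<le> prob (E k)" using inta k by simp
  qed (use cross in auto)
  also have "\<dots> = 3 * prob U + 2 * (\<Sum>k<n. \<integral>x. a k x * indicator U x \<partial>M)"
    by (simp add: sum.distrib probU)
  also have "(\<Sum>k<n. \<integral>x. a k x * indicator U x \<partial>M) = (\<integral>x. S x * indicator U x \<partial>M)"
    unfolding S_def a_def[symmetric] sum_distrib_right using U
    by (intro Bochner_Integration.integral_sum[symmetric] bm_integrable bm_intros bma) auto
  \<comment> \<open>By \<open>S \<le> S\<^sup>2 / 4 + 1\<close> the linear term is absorbed into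
    half of the integral being estimated; solving for that integral gives the constant 10.\<close>
  also have "3 * prob U + 2 * (\<integral>x. S x * indicator U x \<partial>M) \<le> 5 * prob U + (\<integral>x. (S x)\<^sup>2 \<partial>M) / 2"
  proof -
    have "(\<integral>x. S x * indicator U x \<partial>M) \<le> (\<integral>x. (S x)\<^sup>2 / 4 + indicator U x \<partial>M)"
    proof (intro integral_mono_bm bm_intros bmS U)
      fix x
      have "0 \<le> (S x / 2 - 1)\<^sup>2" by simp
      then have "S x \<le> (S x)\<^sup>2 / 4 + 1" by (simp add: power2_eq_square algebra_simps)
      then show "S x * indicator U x \<le> (S x)\<^sup>2 / 4 + indicator U x" by (simp add: indicator_def)
    qed
    also have "\<dots> = (\<integral>x. (S x)\<^sup>2 / 4 \<partial>M) + (\<integral>x. indicator U x \<partial>M)"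
      by (intro Bochner_Integration.integral_add bm_integrable bm_intros bmS U)
    finally show ?thesis using U by simp
  qed
  finally show ?thesis by simp
qed

text \<open>Split the exceptional set by the first index at which the average exceeds
  \<open>e\<close>. Moving the averages to the other factor bounds \<open>e * prob U\<close> by the
  integral of \<open>S * \<phi>\<close>, to which the square bound for \<open>S\<close> applies. The
  estimate is uniform in \<open>n\<close>.\<close>

lemma maximal_inequality:
  assumes \<phi>: "bounded_meas \<phi>" "\<And>x. x \<in> space M \<Longrightarrow> 0 \<le> \<phi> x" and e: "0 < (e::real)"
  shows "prob {x \<in> space M. \<exists>k<n. e < avg k \<phi> x} \<le> 10 / e\<^sup>2 * (\<integral>x. (\<phi> x)\<^sup>2 \<partial>M)"
proof -
  define E where "E k = {x \<in> space M. e < avg k \<phi> x \<and> (\<forall>j<k. \<not> e < avg j \<phi> x)}" for k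
  have [measurable]: "avg k \<phi> \<in> borel_measurable M" for k by (intro bm_measurable bm_avg \<phi>)
  have E[measurable]: "E k \<in> sets M" for k unfolding E_def by measurable
  have disj: "disjoint_family_on E {..<n}"
    unfolding disjoint_family_on_def E_def
    by (auto simp: nat_neq_iff)
  define U where "U = (\<Union>k<n. E k)"
  have Ueq: "{x \<in> space M. \<exists>k<n. e < avg k \<phi> x} = U"
  proof
    show "U \<subseteq> {x \<in> space M. \<exists>k<n. e < avg k \<phi> x}" by (auto simp: U_def E_def)
    show "{x \<in> space M. \<exists>k<n. e < avg k \<phi> x} \<subseteq> U"
    proof
      fix x assume x: "x \<in> {x \<in> space M. \<exists>k<n. e < avg k \<phi> x}"
      then obtain k0 where k0: "k0 < n" "e < avg k0 \<phi> x" by blast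
      define k where "k = (LEAST k. e < avg k \<phi> x)"
      have "e < avg k \<phi> x" unfolding k_def by (rule LeastI[of _ k0]) (rule k0)
      moreover have "k < n" using Least_le[of "\<lambda>k. e < avg k \<phi> x" k0] k0 unfolding k_def by linarith
      moreover have "\<not> e < avg j \<phi> x" if "j < k" for j
        using not_less_Least[of j "\<lambda>k. e < avg k \<phi> x"] that unfolding k_def by blast
      ultimately show "x \<in> U" using x unfolding U_def E_def by blast
    qed
  qed
  have U: "U \<in> sets M" by (auto simp: U_def)
  define S where "S = (\<lambda>x. \<Sum>k<n. dual_avg k (indicator (E k)) x)"
  have bmS: "bounded_meas S" unfolding S_def by (intro bm_sum bm_dual_avg bm_indicator E)
  have S2: "(\<integral>x. (S x)\<^sup>2 \<partial>M) \<le> 10 * prob U"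
    unfolding S_def U_def by (rule dual_square_bound[OF E disj])
  have "e * prob U = (\<Sum>k<n. e * prob (E k))"
    unfolding U_def sum_distrib_left[symmetric] using E disj
    by (subst finite_measure_finite_Union) auto
  also have "\<dots> \<le> (\<Sum>k<n. \<integral>x. dual_avg k (indicator (E k)) x * \<phi> x \<partial>M)"
  proof (intro sum_mono)
    fix k
    have "e * prob (E k) = (\<integral>x. indicator (E k) x * e \<partial>M)" by simp
    also have "\<dots> \<le> (\<integral>x. indicator (E k) x * avg k \<phi> x \<partial>M)"
      by (rule integral_mono_bm[OF bm_mult[OF bm_indicator[OF E] bm_const]
            bm_mult[OF bm_indicator[OF E] bm_avg[OF \<phi>(1)]]]) (auto simp: indicator_def E_def)
    also have "\<dots> = (\<integral>x. dual_avg k (indicator (E k)) x * \<phi> x \<partial>M)"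
      by (rule integral_dual_avg[OF bm_indicator[OF E] \<phi>(1), symmetric])
    finally show "e * prob (E k) \<le> (\<integral>x. dual_avg k (indicator (E k)) x * \<phi> x \<partial>M)" .
  qed
  also have "\<dots> = (\<integral>x. S x * \<phi> x \<partial>M)"
    unfolding S_def sum_distrib_right
    by (rule Bochner_Integration.integral_sum[symmetric])
      (rule bm_integrable[OF bm_mult[OF bm_dual_avg[OF bm_indicator[OF E]] \<phi>(1)]])
  \<comment> \<open>A weighted arithmetic-geometric mean inequality in place of Cauchy-Schwarz; the
    weight \<open>e / 20\<close> turns \<open>10 * prob U\<close> into half of the left hand
    side.\<close>
  also have "\<dots> \<le> (\<integral>x. (\<phi> x)\<^sup>2 * (5 / e) + (S x)\<^sup>2 * (e / 20) \<partial>M)"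
  proof (rule integral_mono_bm[OF bm_mult[OF bmS \<phi>(1)]
        bm_add[OF bm_mult[OF bm_power2[OF \<phi>(1)] bm_const] bm_mult[OF bm_power2[OF bmS] bm_const]]])
    fix x
    have "0 \<le> (10 * \<phi> x - e * S x)\<^sup>2 / (20 * e)" using e by simp
    also have "\<dots> = (\<phi> x)\<^sup>2 * (5 / e) + (S x)\<^sup>2 * (e / 20) - S x * \<phi> x"
      using e by (simp add: field_simps power2_eq_square)
    finally show "S x * \<phi> x \<le> (\<phi> x)\<^sup>2 * (5 / e) + (S x)\<^sup>2 * (e / 20)" by simp
  qed
  also have "\<dots> = (\<integral>x. (\<phi> x)\<^sup>2 \<partial>M) * (5 / e) + (\<integral>x. (S x)\<^sup>2 \<partial>M) * (e / 20)"
    by (subst Bochner_Integration.integral_add[OF bm_integrable[OF bm_mult[OF bm_power2[OF \<phi>(1)] bm_const]]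
          bm_integrable[OF bm_mult[OF bm_power2[OF bmS] bm_const]]]) simp
  also have "\<dots> \<le> (\<integral>x. (\<phi> x)\<^sup>2 \<partial>M) * (5 / e) + (10 * prob U) * (e / 20)"
    using S2 e by (intro add_left_mono mult_right_mono) auto
  finally have "e * prob U \<le> 10 / e * (\<integral>x. (\<phi> x)\<^sup>2 \<partial>M)" by simp
  then have "prob U \<le> (10 / e * (\<integral>x. (\<phi> x)\<^sup>2 \<partial>M)) / e"
    using e by (simp add: pos_le_divide_eq mult.commute)
  then show ?thesis unfolding Ueq by (simp add: power2_eq_square)
qed

end

section \<open>The pointwise ergodic theorem\<close>

text \<open>Monotone convergence makes the sum of the absolute values integrable, hence finite
  almost everywhere. Applied to increments, it replaces completeness of L^2 by almost sure
  convergence of a fast Cauchy sequence.\<close>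

lemma (in prob_space) AE_summable_of_L1_geometric:
  fixes d :: "nat \<Rightarrow> 'a \<Rightarrow> real"
  assumes d: "\<And>k. integrable M (d k)" and le: "\<And>k. (\<integral>x. \<bar>d k x\<bar> \<partial>M) \<le> c * (1 / 2) ^ k"
  shows "AE x in M. summable (\<lambda>k. \<bar>d k x\<bar>)"
proof -
  have [measurable]: "d k \<in> borel_measurable M" for k using d by auto
  have nn: "(\<integral>\<^sup>+x. ennreal \<bar>d k x\<bar> \<partial>M) \<le> ennreal (c * (1 / 2) ^ k)" for k
    using d[of k] le[of k] by (subst nn_integral_eq_integral) (auto intro: ennreal_leI)
  have c: "0 \<le> c"
  proof -
    have "0 \<le> (\<integral>x. \<bar>d 0 x\<bar> \<partial>M)" by simp
    also have "\<dots> \<le> c" using le[of 0] by simp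
    finally show ?thesis .
  qed
  have sc: "summable (\<lambda>k. c * (1 / 2 :: real) ^ k)" by (intro summable_mult summable_geometric) simp
  have "(\<integral>\<^sup>+x. (\<Sum>k. ennreal \<bar>d k x\<bar>) \<partial>M) = (\<Sum>k. \<integral>\<^sup>+x. ennreal \<bar>d k x\<bar> \<partial>M)"
    by (intro nn_integral_suminf) auto
  also have "\<dots> \<le> (\<Sum>k. ennreal (c * (1 / 2) ^ k))" by (intro suminf_le nn) auto
  also have "\<dots> = ennreal (\<Sum>k. c * (1 / 2) ^ k)" using c sc by (intro suminf_ennreal2) auto
  finally have "(\<integral>\<^sup>+x. (\<Sum>k. ennreal \<bar>d k x\<bar>) \<partial>M) \<noteq> \<infinity>" by (auto simp: top_unique)
  then have "AE x in M. (\<Sum>k. ennreal \<bar>d k x\<bar>) \<noteq> \<infinity>"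
    by (intro nn_integral_PInf_AE) auto
  then show ?thesis
  proof eventually_elim
    case (elim x)
    then show ?case by (intro summable_suminf_not_top) auto
  qed
qed

section \<open>Convex combinations of translates\<close>

context tempered_Folner_action
begin

text \<open>Repeated translations and midpoints of \<open>f\<close> reach all dyadic convex combinations of
  translates, without bookkeeping of weights.\<close>

inductive conv_translates :: "('x \<Rightarrow> real) \<Rightarrow> ('x \<Rightarrow> real) \<Rightarrow> bool" for f where
  base: "conv_translates f f"
| translate: "conv_translates f u \<Longrightarrow> g \<in> carrier G \<Longrightarrow> conv_translates f (\<lambda>x. u (\<tau> g x))"
| midpoint: "conv_translates f u \<Longrightarrow> conv_translates f v \<Longrightarrow> conv_translates f (\<lambda>x. (u x + v x) / 2)"

lemma conv_translates_bm: "conv_translates f u \<Longrightarrow> bounded_meas f \<Longrightarrow> bounded_meas u"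
proof (induction rule: conv_translates.induct)
  case (translate u g) then show ?case by (intro bm_act)
next
  case (midpoint u v) then show ?case by (intro bm_divide bm_add)
qed

lemma conv_translates_bound:
  "conv_translates f u \<Longrightarrow> (\<And>x. x \<in> space M \<Longrightarrow> \<bar>f x\<bar> \<le> B) \<Longrightarrow> x \<in> space M \<Longrightarrow> \<bar>u x\<bar> \<le> B"
proof (induction arbitrary: x rule: conv_translates.induct)
  case base then show ?case by simp
next
  case (translate u g)
  show ?case by (rule translate.IH) (simp_all add: translate.prems act_space translate.hyps)
next
  case (midpoint u v)
  have "\<bar>u x\<bar> \<le> B" by (rule midpoint.IH(1)) (simp_all add: midpoint.prems)
  moreover have "\<bar>v x\<bar> \<le> B" by (rule midpoint.IH(2)) (simp_all add: midpoint.prems)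
  ultimately show ?case using abs_triangle_ineq[of "u x" "v x"] by simp
qed

lemma conv_translates_integral:
  "conv_translates f u \<Longrightarrow> bounded_meas f \<Longrightarrow> (\<integral>x. u x \<partial>M) = (\<integral>x. f x \<partial>M)"
proof (induction rule: conv_translates.induct)
  case (translate u g) then show ?case using conv_translates_bm integral_act by simp
next
  case (midpoint u v)
  have "(\<integral>x. u x + v x \<partial>M) = (\<integral>x. u x \<partial>M) + (\<integral>x. v x \<partial>M)"
    using midpoint conv_translates_bm[of f] by (intro Bochner_Integration.integral_add) (auto intro: bm_integrable)
  then show ?case using midpoint by simp
qed simp

text \<open>The average of the translate of \<open>u\<close> is the average of \<open>u\<close> over
  \<open>g <# F n\<close>, so only the symmetric difference of \<open>F n\<close> and
  \<open>g <# F n\<close> counts. Its two halves have equal size, whence the factor 2. The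
  convergence holds at every point, not just almost everywhere.\<close>

lemma avg_translate_diff_tendsto:
  assumes u: "\<And>x. x \<in> space M \<Longrightarrow> \<bar>u x\<bar> \<le> B" and g: "g \<in> carrier G" and x: "x \<in> space M"
  shows "(\<lambda>n. avg n u x - avg n (\<lambda>x. u (\<tau> g x)) x) \<longlonglongrightarrow> 0"
proof (rule Lim_null_comparison)
  have B: "0 \<le> B" using u[OF x] by linarith
  have "\<bar>avg n u x - avg n (\<lambda>x. u (\<tau> g x)) x\<bar> \<le> 2 * B * (card ((g <# F n) - F n) / card (F n))" for n
  proof -
    have gF: "g <# F n = (\<lambda>h. g \<otimes> h) ` F n" by (auto simp: l_coset_def)
    have inj: "inj_on (\<lambda>h. g \<otimes> h) (F n)" using g F_in by (intro inj_onI) auto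
    have fin: "finite (g <# F n)" and cd: "card (g <# F n) = card (F n)"
      unfolding gF using F_finite inj by (auto simp: card_image)
    have gc: "g <# F n \<subseteq> carrier G" using g F_in by (auto simp: gF)
    let ?u = "\<lambda>c. u (\<tau> c x)"
    have sb: "\<bar>sum ?u D\<bar> \<le> B * card D" if "D \<subseteq> carrier G" for D
    proof -
      have "\<bar>sum ?u D\<bar> \<le> (\<Sum>c\<in>D. \<bar>?u c\<bar>)" by (rule sum_abs)
      also have "\<dots> \<le> (\<Sum>c\<in>D. B)"
      proof (rule sum_mono)
        fix c assume "c \<in> D"
        then show "\<bar>?u c\<bar> \<le> B" using that x by (intro u act_space) auto
      qed
      finally show ?thesis by (simp add: mult.commute)
    qed
    have "(\<Sum>h\<in>F n. u (\<tau> g (\<tau> h x))) = (\<Sum>h\<in>F n. ?u (g \<otimes> h))"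
      using g x F_in by (intro sum.cong) (auto simp: act_mult)
    also have "\<dots> = sum ?u (g <# F n)" unfolding gF by (simp add: sum.reindex[OF inj])
    finally have "avg n u x - avg n (\<lambda>x. u (\<tau> g x)) x = (sum ?u (F n) - sum ?u (g <# F n)) / card (F n)"
      by (simp add: avg_def diff_divide_distrib)
    also have "sum ?u (F n) - sum ?u (g <# F n) = sum ?u (F n - (g <# F n)) - sum ?u ((g <# F n) - F n)"
      using sum.Int_Diff[OF F_finite[of n], of ?u "g <# F n"] sum.Int_Diff[OF fin, of ?u "F n"]
      by (simp add: Int_commute)
    finally have "\<bar>avg n u x - avg n (\<lambda>x. u (\<tau> g x)) x\<bar> =
        \<bar>sum ?u (F n - (g <# F n)) - sum ?u ((g <# F n) - F n)\<bar> / card (F n)"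
      by simp
    also have "\<dots> \<le> (B * card (F n - (g <# F n)) + B * card ((g <# F n) - F n)) / card (F n)"
    proof (rule divide_right_mono)
      have "F n - (g <# F n) \<subseteq> carrier G" "(g <# F n) - F n \<subseteq> carrier G" using gc F_carrier by auto
      then show "\<bar>sum ?u (F n - (g <# F n)) - sum ?u ((g <# F n) - F n)\<bar>
          \<le> B * card (F n - (g <# F n)) + B * card ((g <# F n) - F n)"
        using sb[of "F n - (g <# F n)"] sb[of "(g <# F n) - F n"] by linarith
    qed simp
    also have "card (F n - (g <# F n)) = card ((g <# F n) - F n)"
      using F_finite fin cd by (simp add: card_Diff_subset_Int Int_commute)
    finally show ?thesis by (simp add: algebra_simps)
  qed
  then show "\<forall>\<^sub>F n in sequentially. norm (avg n u x - avg n (\<lambda>x. u (\<tau> g x)) x)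
      \<le> 2 * B * (card ((g <# F n) - F n) / card (F n))" by simp
  show "(\<lambda>n. 2 * B * (card ((g <# F n) - F n) / card (F n))) \<longlonglongrightarrow> 0"
    by (rule tendsto_mult_right_zero[OF F_Folner[OF g]])
qed

lemma avg_conv_translates_diff_tendsto:
  assumes "conv_translates f u" and f: "\<And>x. x \<in> space M \<Longrightarrow> \<bar>f x\<bar> \<le> B" and x: "x \<in> space M"
  shows "(\<lambda>n. avg n (\<lambda>x. f x - u x) x) \<longlonglongrightarrow> 0"
  using assms(1)
proof (induction rule: conv_translates.induct)
  case base show ?case by (simp add: avg_const)
next
  case (translate u g)
  have "\<bar>u y\<bar> \<le> B" if "y \<in> space M" for y by (rule conv_translates_bound[OF translate(1) f that])
  then have "(\<lambda>n. avg n u x - avg n (\<lambda>x. u (\<tau> g x)) x) \<longlonglongrightarrow> 0"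
    by (rule avg_translate_diff_tendsto[OF _ translate(2) x])
  from tendsto_add[OF translate.IH this] show ?case by (simp add: avg_diff)
next
  case (midpoint u v)
  have "(\<lambda>n. (avg n (\<lambda>x. f x - u x) x + avg n (\<lambda>x. f x - v x) x) / 2) \<longlonglongrightarrow> (0 + 0) / 2"
    using midpoint by (intro tendsto_divide tendsto_add tendsto_const) auto
  moreover have "avg n (\<lambda>x. f x - (u x + v x) / 2) x
      = (avg n (\<lambda>x. f x - u x) x + avg n (\<lambda>x. f x - v x) x) / 2" for n
  proof -
    have "avg n (\<lambda>x. (u x + v x) / 2) x = (avg n u x + avg n v x) / 2"
      by (simp add: avg_def sum.distrib add_divide_distrib sum_divide_distrib[symmetric])
    then show ?thesis unfolding avg_diff by (simp only:) (simp add: field_simps)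
  qed
  ultimately show ?case by (simp only: add_0 div_0)
qed

text \<open>Integrate the pointwise bound of \<open>\<bar>d\<bar>\<close> by
  \<open>(1 / 2) ^ k / 2 + d\<^sup>2 * (2 ^ k / 2)\<close>; the two parts contribute one half and
  two times \<open>(1 / 2) ^ k\<close>. The factor 4 in the hypothesis is the one that the
  parallelogram identity produces.\<close>

lemma L1_le_of_L2:
  assumes d: "bounded_meas d" and le: "(\<integral>x. (d x)\<^sup>2 \<partial>M) \<le> 4 * (1 / 4) ^ k"
  shows "(\<integral>x. \<bar>d x\<bar> \<partial>M) \<le> 3 * (1 / 2) ^ k"
proof -
  have p: "(4::real) ^ k = 2 ^ k * 2 ^ k" by (simp flip: power_mult_distrib)
  note b = bm_mult[OF bm_power2[OF d] bm_const[of "2 ^ k / 2"]]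
  have "(\<integral>x. \<bar>d x\<bar> \<partial>M) \<le> (\<integral>x. (1 / 2) ^ k / 2 + (d x)\<^sup>2 * (2 ^ k / 2) \<partial>M)"
  proof (rule integral_mono_bm[OF bm_abs[OF d] bm_add[OF bm_const b]])
    fix x
    have "0 \<le> (1 - 2 ^ k * \<bar>d x\<bar>)\<^sup>2 / (2 * 2 ^ k)" by simp
    also have "\<dots> = (1 / 2) ^ k / 2 + (d x)\<^sup>2 * (2 ^ k / 2) - \<bar>d x\<bar>"
      by (simp add: power2_eq_square field_simps power_divide)
    finally show "\<bar>d x\<bar> \<le> (1 / 2) ^ k / 2 + (d x)\<^sup>2 * (2 ^ k / 2)" by simp
  qed
  also have "\<dots> = (1 / 2) ^ k / 2 + (\<integral>x. (d x)\<^sup>2 \<partial>M) * (2 ^ k / 2)"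
    by (subst Bochner_Integration.integral_add[OF bm_integrable[OF bm_const] bm_integrable[OF b]])
      (simp add: prob_space)
  also have "\<dots> \<le> (1 / 2) ^ k / 2 + (4 * (1 / 4) ^ k) * (2 ^ k / 2)"
    using le by (intro add_left_mono mult_right_mono) auto
  also have "\<dots> \<le> 3 * (1 / 2) ^ k" by (simp add: power_divide p field_simps)
  finally show ?thesis .
qed

end

text \<open>Ergodicity for functions that are invariant only up to a null set depending on
  \<open>g\<close>, which is the form in which almost sure limits turn out to be invariant.\<close>

locale ergodic_Folner_action = tempered_Folner_action G M \<tau> F
  for G :: "('a, 'b) monoid_scheme" (structure) and M :: "'x measure" and \<tau> :: "'a \<Rightarrow> 'x \<Rightarrow> 'x"
    and F :: "nat \<Rightarrow> 'a set" +
  assumes ergodic: "bounded_meas \<phi> \<Longrightarrow> (\<And>g. g \<in> carrier G \<Longrightarrow> AE x in M. \<phi> (\<tau> g x) = \<phi> x) \<Longrightarrow>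
    AE x in M. \<phi> x = (\<integral>x. \<phi> x \<partial>M)"
begin

text \<open>Near-minimizers of the L^2 distance to \<open>c\<close> among convex combinations of
  translates are close to each other by the parallelogram identity, hence converge. A translate of a
  near-minimizer is again one, so the limit is invariant; by ergodicity it is constant, and its
  integral is \<open>c\<close>.\<close>

lemma mean_ergodic:
  assumes f: "bounded_meas f"
  defines "c \<equiv> \<integral>x. f x \<partial>M"
  obtains u where "\<And>k. conv_translates f (u k)" "(\<lambda>k. \<integral>x. (u k x - c)\<^sup>2 \<partial>M) \<longlonglongrightarrow> 0"
proof -
  obtain B where B: "\<And>x. x \<in> space M \<Longrightarrow> \<bar>f x\<bar> \<le> B" using f unfolding bounded_meas_def by blast
  define q where "q u = (\<integral>x. (u x - c)\<^sup>2 \<partial>M)" for u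
  define \<delta> where "\<delta> = Inf (q ` {u. conv_translates f u})"
  have bb: "bdd_below (q ` {u. conv_translates f u})"
    by (rule bdd_belowI[of _ 0]) (auto simp: q_def)
  have dle: "\<delta> \<le> q u" if "conv_translates f u" for u
    unfolding \<delta>_def using that bb by (intro cInf_lower) auto
  have "\<exists>u. conv_translates f u \<and> q u < \<delta> + (1 / 4) ^ k" for k :: nat
  proof (rule ccontr)
    assume "\<not> ?thesis"
    then have "\<delta> + (1 / 4) ^ k \<le> q u" if "conv_translates f u" for u using that by (meson not_le)
    then have "\<delta> + (1 / 4) ^ k \<le> \<delta>"
      unfolding \<delta>_def[of] using conv_translates.base by (intro cInf_greatest) auto
    then show False using zero_less_power[of "1 / 4 :: real" k] by linarith
  qed
  then obtain u where u: "\<And>k. conv_translates f (u k)" and uq: "\<And>k. q (u k) < \<delta> + (1 / 4) ^ k" by metis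
  have bmu: "bounded_meas (u k)" for k by (rule conv_translates_bm[OF u f])
  have ub: "\<bar>u k x\<bar> \<le> B" if "x \<in> space M" for k x by (rule conv_translates_bound[OF u B that])
  have [measurable]: "u k \<in> borel_measurable M" for k by (rule bm_measurable[OF bmu])
  \<comment> \<open>The midpoint is again admissible, so its distance is at least \<delta>;
    subtracting four times \<delta> from the two contributions
    \<open>2 * (\<delta> + \<eta>)\<close> leaves \<open>4 * \<eta>\<close>.\<close>
  have par: "(\<integral>x. (v x - w x)\<^sup>2 \<partial>M) \<le> 4 * \<eta>"
    if v: "conv_translates f v" "q v \<le> \<delta> + \<eta>" and w: "conv_translates f w" "q w \<le> \<delta> + \<eta>" for v w \<eta>
  proof -
    have bmv: "bounded_meas v" "bounded_meas w" by (rule conv_translates_bm[OF _ f], fact)+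
    have i: "integrable M (\<lambda>x. (v x - c)\<^sup>2 * 2)" "integrable M (\<lambda>x. (w x - c)\<^sup>2 * 2)"
      "integrable M (\<lambda>x. ((v x + w x) / 2 - c)\<^sup>2 * 4)"
      by (rule bm_integrable[OF bm_mult[OF bm_power2[OF bm_diff[OF _ bm_const]] bm_const]],
          intro bmv bm_divide bm_add)+
    have "(\<integral>x. (v x - w x)\<^sup>2 \<partial>M) =
        (\<integral>x. (v x - c)\<^sup>2 * 2 + (w x - c)\<^sup>2 * 2 - ((v x + w x) / 2 - c)\<^sup>2 * 4 \<partial>M)"
      by (intro Bochner_Integration.integral_cong) (auto simp: power2_eq_square field_simps)
    also have "\<dots> = (\<integral>x. (v x - c)\<^sup>2 * 2 \<partial>M) + (\<integral>x. (w x - c)\<^sup>2 * 2 \<partial>M)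
        - (\<integral>x. ((v x + w x) / 2 - c)\<^sup>2 * 4 \<partial>M)"
      by (simp only: Bochner_Integration.integral_diff Bochner_Integration.integral_add
          Bochner_Integration.integrable_add i)
    also have "\<dots> = q v * 2 + q w * 2 - q (\<lambda>x. (v x + w x) / 2) * 4"
      unfolding q_def by simp
    also have "\<dots> \<le> 4 * \<eta>"
      using v w dle[OF conv_translates.midpoint[OF v(1) w(1)]] by simp
    finally show ?thesis .
  qed
  define d where "d k x = u (Suc k) x - u k x" for k x
  have bmd: "bounded_meas (d k)" for k unfolding d_def by (rule bm_diff[OF bmu bmu])
  have "(\<integral>x. (d k x)\<^sup>2 \<partial>M) \<le> 4 * (1 / 4) ^ k" for k
  proof -
    have "(1 / 4 :: real) ^ Suc k \<le> (1 / 4) ^ k" by (rule power_decreasing) auto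
    then show ?thesis unfolding d_def using uq[of k] uq[of "Suc k"]
      by (intro par[OF u _ u]) linarith+
  qed
  then have "AE x in M. summable (\<lambda>k. \<bar>d k x\<bar>)"
    by (intro AE_summable_of_L1_geometric[of _ 3] bm_integrable[OF bmd] L1_le_of_L2[OF bmd])
  then have conv: "AE x in M. convergent (\<lambda>k. u k x)"
  proof eventually_elim
    case (elim x)
    then have "summable (\<lambda>k. d k x)" by (rule summable_rabs_cancel)
    then have "convergent (\<lambda>n. u 0 x + (\<Sum>k<n. d k x))"
      by (intro convergent_add convergent_const) (simp add: summable_iff_convergent)
    moreover have "u 0 x + (\<Sum>k<n. d k x) = u n x" for n
      by (induction n) (auto simp: d_def)
    ultimately show ?case by simp
  qed
  \<comment> \<open>Where the sequence diverges, \<open>lim\<close> is an arbitrary value.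
    Truncation makes \<phi> bounded everywhere and changes nothing where the sequence converges, its
    terms being bounded by \<open>B\<close>.\<close>
  define \<phi> where "\<phi> x = max (- B) (min B (lim (\<lambda>k. u k x)))" for x
  have lim: "AE x in M. (\<lambda>k. u k x) \<longlonglongrightarrow> \<phi> x"
    using conv AE_space
  proof eventually_elim
    case (elim x)
    then have l: "(\<lambda>k. u k x) \<longlonglongrightarrow> lim (\<lambda>k. u k x)" by (simp add: convergent_LIMSEQ_iff)
    have "\<bar>lim (\<lambda>k. u k x)\<bar> \<le> B"
      using ub elim by (intro tendsto_upperbound[OF tendsto_rabs[OF l]]) auto
    then have "\<phi> x = lim (\<lambda>k. u k x)" by (auto simp: \<phi>_def)
    then show ?case using l by simp
  qed
  have [measurable]: "\<phi> \<in> borel_measurable M" unfolding \<phi>_def by measurable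
  have bm\<phi>: "bounded_meas \<phi>" by (rule bmI[of _ "\<bar>B\<bar>"]) (auto simp: \<phi>_def)
  \<comment> \<open>\<open>u k\<close> and its translate have the same distance to \<open>c\<close>,
    so \<open>par\<close> bounds their difference by the same geometric rate.\<close>
  have inv: "AE x in M. \<phi> (\<tau> g x) = \<phi> x" if g: "g \<in> carrier G" for g
  proof -
    define e where "e k x = u k (\<tau> g x) - u k x" for k x
    have bme: "bounded_meas (e k)" for k unfolding e_def by (rule bm_diff[OF bm_act[OF bmu g] bmu])
    have "(\<integral>x. (e k x)\<^sup>2 \<partial>M) \<le> 4 * (1 / 4) ^ k" for k
    proof -
      have "q (\<lambda>x. u k (\<tau> g x)) = q (u k)" unfolding q_def
        by (rule integral_act[OF bm_power2[OF bm_diff[OF bmu bm_const]] g])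
      then show ?thesis unfolding e_def using uq[of k]
        by (intro par[OF conv_translates.translate[OF u g] _ u]) linarith+
    qed
    then have "AE x in M. summable (\<lambda>k. \<bar>e k x\<bar>)"
      by (intro AE_summable_of_L1_geometric[of _ 3] bm_integrable[OF bme] L1_le_of_L2[OF bme])
    with lim AE_act[OF g lim] show ?thesis
    proof eventually_elim
      case (elim x)
      have "(\<lambda>k. e k x) \<longlonglongrightarrow> \<phi> (\<tau> g x) - \<phi> x" unfolding e_def using elim by (intro tendsto_diff)
      moreover have "(\<lambda>k. e k x) \<longlonglongrightarrow> 0"
        by (rule summable_LIMSEQ_zero, rule summable_rabs_cancel) (use elim in blast)
      ultimately have "\<phi> (\<tau> g x) - \<phi> x = 0" by (rule LIMSEQ_unique)
      then show ?case by simp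
    qed
  qed
  have "(\<lambda>k. \<integral>x. u k x \<partial>M) \<longlonglongrightarrow> (\<integral>x. \<phi> x \<partial>M)"
    using lim ub by (intro integral_dominated_convergence[where w = "\<lambda>_. B"]) auto
  then have int: "(\<integral>x. \<phi> x \<partial>M) = c"
    using conv_translates_integral[OF u f] by (simp add: c_def LIMSEQ_const_iff)
  have phic: "AE x in M. \<phi> x = c" using ergodic[OF bm\<phi> inv] int by simp
  have "(\<lambda>k. \<integral>x. (u k x - c)\<^sup>2 \<partial>M) \<longlonglongrightarrow> (\<integral>x. 0 \<partial>M)"
  proof (rule integral_dominated_convergence[where w = "\<lambda>_. (B + \<bar>c\<bar>)\<^sup>2"])
    show "AE x in M. (\<lambda>k. (u k x - c)\<^sup>2) \<longlonglongrightarrow> 0"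
      using lim phic
    proof eventually_elim
      case (elim x)
      then have "(\<lambda>k. u k x) \<longlonglongrightarrow> c" by simp
      then have "(\<lambda>k. (u k x - c)\<^sup>2) \<longlonglongrightarrow> (c - c)\<^sup>2" by (intro tendsto_intros)
      then show ?case by simp
    qed
    show "AE x in M. norm ((u k x - c)\<^sup>2) \<le> (B + \<bar>c\<bar>)\<^sup>2" for k
    proof (rule AE_I2)
      fix x assume "x \<in> space M"
      then have "\<bar>u k x - c\<bar> \<le> B + \<bar>c\<bar>" using ub[of x k] by linarith
      then show "norm ((u k x - c)\<^sup>2) \<le> (B + \<bar>c\<bar>)\<^sup>2"
        using power_mono[of "\<bar>u k x - c\<bar>" "B + \<bar>c\<bar>" 2] by simp
    qed
  qed auto
  then show thesis using that[of u] u by simp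
qed

text \<open>Write \<open>f - c\<close> as \<open>f - u k\<close> plus \<open>u k - c\<close>. The
  averages of the first part tend to 0 at every point; those of the second are at most
  \<open>e\<close> outside \<open>Q e k\<close>, a set whose measure tends to 0 with growing
  \<open>k\<close> by the maximal inequality.\<close>

theorem pointwise_ergodic:
  assumes f: "bounded_meas f"
  shows "AE x in M. (\<lambda>n. avg n f x) \<longlonglongrightarrow> (\<integral>x. f x \<partial>M)"
proof -
  define c where "c = (\<integral>x. f x \<partial>M)"
  obtain B where B: "\<And>x. x \<in> space M \<Longrightarrow> \<bar>f x\<bar> \<le> B" using f unfolding bounded_meas_def by blast
  obtain u where u: "\<And>k. conv_translates f (u k)" and uc: "(\<lambda>k. \<integral>x. (u k x - c)\<^sup>2 \<partial>M) \<longlonglongrightarrow> 0"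
    using mean_ergodic[OF f] unfolding c_def by blast
  define h where "h k x = \<bar>u k x - c\<bar>" for k x
  have bmh: "bounded_meas (h k)" for k
    unfolding h_def by (rule bm_abs[OF bm_diff[OF conv_translates_bm[OF u f] bm_const]])
  have [measurable]: "avg n (h k) \<in> borel_measurable M" for n k by (rule bm_measurable[OF bm_avg[OF bmh]])
  define Q where "Q e k = {x \<in> space M. \<exists>n. e < avg n (h k) x}" for e k
  have Qs: "Q e k \<in> sets M" for e k unfolding Q_def by measurable
  have Qle: "prob (Q e k) \<le> 10 / e\<^sup>2 * (\<integral>x. (u k x - c)\<^sup>2 \<partial>M)" if e: "0 < e" for e k
  proof -
    define R where "R n = {x \<in> space M. \<exists>j<n. e < avg j (h k) x}" for n
    have Rs: "R n \<in> sets M" for n unfolding R_def by measurable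
    have "incseq R" by (rule incseq_SucI) (auto simp: R_def less_Suc_eq)
    then have "(\<lambda>n. prob (R n)) \<longlonglongrightarrow> prob (\<Union>n. R n)"
      using Rs by (intro finite_Lim_measure_incseq) auto
    moreover have "(\<Union>n. R n) = Q e k" by (auto simp: R_def Q_def)
    moreover have "prob (R n) \<le> 10 / e\<^sup>2 * (\<integral>x. (h k x)\<^sup>2 \<partial>M)" for n
      unfolding R_def by (rule maximal_inequality[OF bmh _ e]) (simp add: h_def)
    ultimately show ?thesis by (intro tendsto_upperbound[of _ _ sequentially]) (auto simp: h_def)
  qed
  \<comment> \<open>The index \<open>k\<close> may depend on the point, so it is enough that the
    intersection of all \<open>Q e k\<close> is null; no summability of their measures
    enters.\<close>
  have null: "AE x in M. \<exists>k. x \<notin> Q e k" if e: "0 < e" for e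
  proof -
    have "prob (\<Inter>k. Q e k) \<le> prob (Q e k)" for k using Qs by (intro finite_measure_mono) auto
    then have "prob (\<Inter>k. Q e k) \<le> 10 / e\<^sup>2 * (\<integral>x. (u k x - c)\<^sup>2 \<partial>M)" for k
      using Qle[OF e] order_trans by blast
    moreover have "(\<lambda>k. 10 / e\<^sup>2 * (\<integral>x. (u k x - c)\<^sup>2 \<partial>M)) \<longlonglongrightarrow> 0"
      by (rule tendsto_mult_right_zero[OF uc])
    ultimately have "prob (\<Inter>k. Q e k) \<le> 0"
      by (intro tendsto_lowerbound[of _ 0 sequentially]) auto
    then have "prob (\<Inter>k. Q e k) = 0" using measure_nonneg[of M] by (meson antisym)
    moreover have "(\<Inter>k. Q e k) \<in> sets M" using Qs by auto
    ultimately have "(\<Inter>k. Q e k) \<in> null_sets M" by (simp add: null_sets_def emeasure_eq_measure)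
    then show ?thesis by (rule AE_I') auto
  qed
  have "AE x in M. \<forall>m. \<exists>k. x \<notin> Q (inverse (real (Suc m))) k"
    unfolding AE_all_countable by (intro allI null) simp
  then show ?thesis using AE_space
  proof eventually_elim
    case (elim x)
    show ?case unfolding c_def[symmetric]
    proof (rule LIMSEQ_I)
      fix r :: real assume r: "0 < r"
      obtain m where m: "inverse (real (Suc m)) < r / 2" using reals_Archimedean[of "r / 2"] r by auto
      obtain k where k: "x \<notin> Q (inverse (real (Suc m))) k" using elim by blast
      have "(\<lambda>n. avg n (\<lambda>x. f x - u k x) x) \<longlonglongrightarrow> 0"
        by (rule avg_conv_translates_diff_tendsto[OF u B elim(2)])
      from LIMSEQ_D[OF this, of "r / 2"] obtain n0
        where n0: "\<And>n. n \<ge> n0 \<Longrightarrow> \<bar>avg n (\<lambda>x. f x - u k x) x\<bar> < r / 2"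
        using r by auto
      have "norm (avg n f x - c) < r" if "n \<ge> n0" for n
      proof -
        have "avg n f x - c = avg n (\<lambda>x. f x - u k x) x + avg n (\<lambda>x. u k x - c) x"
          by (simp add: avg_diff avg_const)
        moreover have "\<bar>avg n (\<lambda>x. u k x - c) x\<bar> \<le> avg n (h k) x"
          unfolding h_def by (rule abs_avg_le)
        moreover have "avg n (h k) x \<le> inverse (real (Suc m))"
          using k elim(2) unfolding Q_def by (simp add: not_less)
        ultimately show ?thesis using n0[OF that] m by simp
      qed
      then show "\<exists>n0. \<forall>n\<ge>n0. norm (avg n f x - c) < r" by blast
    qed
  qed
qed

end

section \<open>The Chabauty topology\<close>

lemma limitin_topology_generated_by:
  assumes l: "l \<in> topspace (topology_generated_by \<S>)"
    and ev: "\<And>U. U \<in> \<S> \<Longrightarrow> l \<in> U \<Longrightarrow> eventually (\<lambda>i. f i \<in> U) F"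
  shows "limitin (topology_generated_by \<S>) f l F"
proof -
  have "l \<in> U \<longrightarrow> eventually (\<lambda>i. f i \<in> U) F" if "generate_topology_on \<S> U" for U
    using that
  proof (induction rule: generate_topology_on.induct)
    case (Int a b) then show ?case by (auto intro: eventually_conj)
  next
    case (UN K)
    show ?case
    proof
      assume "l \<in> \<Union>K"
      then obtain k where "k \<in> K" "l \<in> k" by blast
      with UN have "eventually (\<lambda>i. f i \<in> k) F" by blast
      then show "eventually (\<lambda>i. f i \<in> \<Union>K) F" by (rule eventually_mono) (use \<open>k \<in> K\<close> in blast)
    qed
  qed (use ev in auto)
  then show ?thesis using l by (auto simp: limitin_def openin_topology_generated_by_iff)
qed

lemma openin_boolean_productI:
  assumes S: "S \<subseteq> Pi\<^sub>E I (\<lambda>_. UNIV)"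
    and window: "\<And>h. h \<in> S \<Longrightarrow> \<exists>B. finite B \<and> B \<subseteq> I \<and>
      (\<forall>k \<in> Pi\<^sub>E I (\<lambda>_. UNIV). (\<forall>i\<in>B. k i = h i) \<longrightarrow> k \<in> S)"
  shows "openin (product_topology (\<lambda>_. discrete_topology (UNIV :: bool set)) I) S"
  unfolding openin_product_topology_alt
proof
  fix h assume h: "h \<in> S"
  from window[OF h] obtain B where B: "finite B" "B \<subseteq> I"
    "\<forall>k \<in> Pi\<^sub>E I (\<lambda>_. UNIV). (\<forall>i\<in>B. k i = h i) \<longrightarrow> k \<in> S" by (elim exE conjE)
  let ?X = "\<lambda>i. if i \<in> B then {h i} else UNIV"
  have "finite {i \<in> I. ?X i \<noteq> UNIV}" by (rule finite_subset[OF _ B(1)]) auto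
  moreover have "h \<in> Pi\<^sub>E I ?X" using h S by (auto simp: PiE_iff)
  moreover have "Pi\<^sub>E I ?X \<subseteq> S"
  proof
    fix k assume k: "k \<in> Pi\<^sub>E I ?X"
    show "k \<in> S"
    proof (rule B(3)[rule_format])
      show "k i = h i" if "i \<in> B" for i using k B(2) that by (auto simp: PiE_iff split: if_splits)
    qed (use k in \<open>auto simp: PiE_iff\<close>)
  qed
  ultimately show "\<exists>X. finite {i \<in> I. X i \<noteq> topspace (discrete_topology (UNIV :: bool set))} \<and>
      (\<forall>i\<in>I. openin (discrete_topology UNIV) (X i)) \<and> h \<in> Pi\<^sub>E I X \<and> Pi\<^sub>E I X \<subseteq> S"
    by (intro exI[of _ ?X]) auto
qed

text \<open>The basic open sets of the Chabauty topology: \<open>B\<close> is the window,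
  \<open>S\<close> the prescribed trace on it. The cylinder is empty unless
  \<open>S \<subseteq> B\<close>.\<close>

definition cyl :: "('a, 'b) monoid_scheme \<Rightarrow> 'a set \<Rightarrow> 'a set \<Rightarrow> 'a set set" where
  "cyl G B S = {H. subgroup H G \<and> H \<inter> B = S}"

text \<open>The working description of the topology: membership in an open set is decided on a
  finite window. It hides the pullback from the product of Boolean factors.\<close>

lemma openin_chabauty_iff:
  "openin (chabauty G) U \<longleftrightarrow> U \<subseteq> {H. subgroup H G} \<and>
     (\<forall>H\<in>U. \<exists>B. finite B \<and> B \<subseteq> carrier G \<and> cyl G B (H \<inter> B) \<subseteq> U)"
proof -
  let ?P = "product_topology (\<lambda>_. discrete_topology (UNIV :: bool set)) (carrier G)"
  let ?f = "\<lambda>H. \<lambda>x\<in>carrier G. x \<in> H"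
  show ?thesis
  proof
    assume "openin (chabauty G) U"
    then obtain V where V: "openin ?P V" "U = ?f -` V \<inter> {H. subgroup H G}"
      by (auto simp: chabauty_def openin_pullback_topology)
    have "\<exists>B. finite B \<and> B \<subseteq> carrier G \<and> cyl G B (H \<inter> B) \<subseteq> U" if H: "H \<in> U" for H
    proof -
      have "?f H \<in> V" using H V by auto
      then obtain X where X: "finite {i \<in> carrier G. X i \<noteq> UNIV}"
        "?f H \<in> Pi\<^sub>E (carrier G) X" "Pi\<^sub>E (carrier G) X \<subseteq> V"
        using V(1) unfolding openin_product_topology_alt by fastforce
      let ?B = "{i \<in> carrier G. X i \<noteq> UNIV}"
      have "H' \<in> U" if H': "H' \<in> cyl G ?B (H \<inter> ?B)" for H'
      proof -
        have "?f H' i \<in> X i" if i: "i \<in> carrier G" for i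
        proof (cases "X i = UNIV")
          case False
          then have "i \<in> H' \<longleftrightarrow> i \<in> H" using H' i by (auto simp: cyl_def)
          moreover have "?f H i \<in> X i" using X(2) i by (rule PiE_mem)
          ultimately show ?thesis using i by simp
        qed simp
        then have "?f H' \<in> Pi\<^sub>E (carrier G) X" by (intro PiE_I) auto
        then have "?f H' \<in> V" using X(3) by blast
        then show ?thesis using V(2) H' by (simp add: cyl_def)
      qed
      then show ?thesis using X(1) by (intro exI[of _ ?B]) auto
    qed
    then show "U \<subseteq> {H. subgroup H G} \<and> (\<forall>H\<in>U. \<exists>B. finite B \<and> B \<subseteq> carrier G \<and> cyl G B (H \<inter> B) \<subseteq> U)"
      using V(2) by auto
  next
    assume R: "U \<subseteq> {H. subgroup H G} \<and>
      (\<forall>H\<in>U. \<exists>B. finite B \<and> B \<subseteq> carrier G \<and> cyl G B (H \<inter> B) \<subseteq> U)"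
    \<comment> \<open>\<open>V\<close> also contains functions that are not indicators of subgroups:
      those agreeing on a suitable window with a member of \<open>U\<close>. This makes it open in
      the full product while its trace on subgroups is still \<open>U\<close>.\<close>
    define V where "V = {h \<in> Pi\<^sub>E (carrier G) (\<lambda>_. UNIV). \<exists>H\<in>U. \<exists>B. finite B \<and> B \<subseteq> carrier G \<and>
      cyl G B (H \<inter> B) \<subseteq> U \<and> (\<forall>i\<in>B. h i = (i \<in> H))}"
    have "openin ?P V"
    proof (rule openin_boolean_productI)
      fix h assume "h \<in> V"
      then obtain H B where HB: "H \<in> U" "finite B" "B \<subseteq> carrier G" "cyl G B (H \<inter> B) \<subseteq> U"
        "\<forall>i\<in>B. h i = (i \<in> H)" unfolding V_def by blast
      have "k \<in> V" if "k \<in> Pi\<^sub>E (carrier G) (\<lambda>_. UNIV)" "\<forall>i\<in>B. k i = h i" for k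
      proof -
        have "\<forall>i\<in>B. k i = (i \<in> H)" using that(2) HB(5) by simp
        then show ?thesis unfolding V_def using that(1) HB by blast
      qed
      then show "\<exists>B. finite B \<and> B \<subseteq> carrier G \<and>
          (\<forall>k \<in> Pi\<^sub>E (carrier G) (\<lambda>_. UNIV). (\<forall>i\<in>B. k i = h i) \<longrightarrow> k \<in> V)"
        using HB(2,3) by blast
    qed (simp add: V_def)
    moreover have "U = ?f -` V \<inter> {H. subgroup H G}"
    proof
      show "U \<subseteq> ?f -` V \<inter> {H. subgroup H G}"
      proof
        fix H assume H: "H \<in> U"
        then obtain B where B: "finite B" "B \<subseteq> carrier G" "cyl G B (H \<inter> B) \<subseteq> U" using R by blast
        then have "\<forall>i\<in>B. ?f H i = (i \<in> H)" by auto
        then have "?f H \<in> V" unfolding V_def using H B by (intro CollectI conjI bexI[of _ H] exI[of _ B]) auto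
        then show "H \<in> ?f -` V \<inter> {H. subgroup H G}" using H R by auto
      qed
      show "?f -` V \<inter> {H. subgroup H G} \<subseteq> U"
      proof
        fix K assume K: "K \<in> ?f -` V \<inter> {H. subgroup H G}"
        then obtain H B where HB: "H \<in> U" "B \<subseteq> carrier G" "cyl G B (H \<inter> B) \<subseteq> U"
          "\<forall>i\<in>B. ?f K i = (i \<in> H)" unfolding V_def by blast
        have "i \<in> K \<longleftrightarrow> i \<in> H" if "i \<in> B" for i
          using HB(4)[rule_format, OF that] HB(2) that by auto
        then have "K \<in> cyl G B (H \<inter> B)" using K by (auto simp: cyl_def)
        then show "K \<in> U" using HB by blast
      qed
    qed
    ultimately show "openin (chabauty G) U"
      unfolding chabauty_def openin_pullback_topology by blast
  qed
qed

lemma openin_chabautyI: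
  assumes "\<And>H. H \<in> U \<Longrightarrow> subgroup H G"
    and "\<And>H. H \<in> U \<Longrightarrow> \<exists>B. finite B \<and> B \<subseteq> carrier G \<and> cyl G B (H \<inter> B) \<subseteq> U"
  shows "openin (chabauty G) U"
  using assms by (auto simp: openin_chabauty_iff)

lemma topspace_chabauty: "topspace (chabauty G) = {H. subgroup H G}"
proof
  show "topspace (chabauty G) \<subseteq> {H. subgroup H G}"
    using openin_topspace[of "chabauty G"] unfolding openin_chabauty_iff by blast
  have "openin (chabauty G) {H. subgroup H G}"
    by (rule openin_chabautyI) (auto simp: cyl_def)
  then show "{H. subgroup H G} \<subseteq> topspace (chabauty G)" by (rule openin_subset)
qed

lemma openin_cyl:
  assumes "finite B" "B \<subseteq> carrier G" shows "openin (chabauty G) (cyl G B S)"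
  by (rule openin_chabautyI) (use assms in \<open>auto simp: cyl_def\<close>)

lemma open_in_sets_sub_borel: "openin (chabauty G) U \<Longrightarrow> U \<in> sets (sub_borel G)"
proof -
  have "{U. openin (chabauty G) U} \<subseteq> Pow {H. subgroup H G}"
    by (auto simp: openin_chabauty_iff)
  then have "sets (sub_borel G) = sigma_sets {H. subgroup H G} {U. openin (chabauty G) U}"
    by (simp add: sub_borel_def)
  then show "openin (chabauty G) U \<Longrightarrow> U \<in> sets (sub_borel G)" by auto
qed

lemma cyl_sets: "finite B \<Longrightarrow> B \<subseteq> carrier G \<Longrightarrow> cyl G B S \<in> sets (sub_borel G)"
  by (intro open_in_sets_sub_borel openin_cyl)

lemma closed_in_sets_sub_borel:
  assumes "openin (chabauty G) ({H. subgroup H G} - A)" "A \<subseteq> {H. subgroup H G}"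
  shows "A \<in> sets (sub_borel G)"
proof -
  have "{H. subgroup H G} - ({H. subgroup H G} - A) \<in> sets (sub_borel G)"
    using sets.compl_sets[OF open_in_sets_sub_borel[OF assms(1)]] by (simp add: space_sub_borel)
  then show ?thesis using assms(2) by (simp add: double_diff)
qed

lemma singleton_sets_sub_borel:
  assumes "subgroup H G" shows "{H} \<in> sets (sub_borel G)"
proof (rule closed_in_sets_sub_borel)
  show "openin (chabauty G) ({H. subgroup H G} - {H})"
  proof (rule openin_chabautyI)
    fix K assume "K \<in> {H. subgroup H G} - {H}"
    then have K: "subgroup K G" "K \<noteq> H" by auto
    then obtain x where x: "x \<in> K \<and> x \<notin> H \<or> x \<notin> K \<and> x \<in> H" by blast
    have "x \<in> carrier G" using x subgroup.subset[OF K(1)] subgroup.subset[OF assms] by blast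
    moreover have "cyl G {x} (K \<inter> {x}) \<subseteq> {H. subgroup H G} - {H}" using x by (auto simp: cyl_def)
    ultimately show "\<exists>B. finite B \<and> B \<subseteq> carrier G \<and> cyl G B (K \<inter> B) \<subseteq> {H. subgroup H G} - {H}"
      by (intro exI[of _ "{x}"]) auto
  qed auto
qed (use assms in auto)

text \<open>For infinite \<open>N\<close> no finite window verifies the inclusion, but one missing
  element refutes it: the set is closed. It serves to exhaust the finite index subgroups by the
  supergroups of \<open>N i\<close>.\<close>

lemma supergroups_sets_sub_borel:
  assumes "N \<subseteq> carrier G" shows "{K. subgroup K G \<and> N \<subseteq> K} \<in> sets (sub_borel G)"
proof (rule closed_in_sets_sub_borel)
  show "openin (chabauty G) ({H. subgroup H G} - {K. subgroup K G \<and> N \<subseteq> K})"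
  proof (rule openin_chabautyI)
    fix K assume K: "K \<in> {H. subgroup H G} - {K. subgroup K G \<and> N \<subseteq> K}"
    then obtain x where x: "x \<in> N" "x \<notin> K" by blast
    have "cyl G {x} (K \<inter> {x}) \<subseteq> {H. subgroup H G} - {K. subgroup K G \<and> N \<subseteq> K}"
      using x by (auto simp: cyl_def)
    then show "\<exists>B. finite B \<and> B \<subseteq> carrier G \<and>
        cyl G B (K \<inter> B) \<subseteq> {H. subgroup H G} - {K. subgroup K G \<and> N \<subseteq> K}"
      using x assms by (intro exI[of _ "{x}"]) auto
  qed auto
qed auto

lemma continuous_map_sub_borel:
  assumes "continuous_map (chabauty G) euclideanreal f"
  shows "f \<in> borel_measurable (sub_borel G)"
proof (rule borel_measurableI)
  fix S :: "real set" assume "open S"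
  then have "openin (chabauty G) {H \<in> topspace (chabauty G). f H \<in> S}"
    using assms by (auto simp: continuous_map_def)
  moreover have "{H \<in> topspace (chabauty G). f H \<in> S} = f -` S \<inter> space (sub_borel G)"
    by (auto simp: topspace_chabauty space_sub_borel)
  ultimately show "f -` S \<inter> space (sub_borel G) \<in> sets (sub_borel G)"
    by (simp add: open_in_sets_sub_borel)
qed

lemma continuous_map_chabautyI:
  fixes f :: "'a set \<Rightarrow> real"
  assumes B: "finite B" "B \<subseteq> carrier G"
    and f: "\<And>H K. subgroup H G \<Longrightarrow> subgroup K G \<Longrightarrow> H \<inter> B = K \<inter> B \<Longrightarrow> f H = f K"
  shows "continuous_map (chabauty G) euclideanreal f"
  unfolding continuous_map_def
proof (intro conjI allI impI)
  fix U :: "real set"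
  show "openin (chabauty G) {H \<in> topspace (chabauty G). f H \<in> U}"
  proof (rule openin_chabautyI)
    fix H assume H: "H \<in> {H \<in> topspace (chabauty G). f H \<in> U}"
    have "cyl G B (H \<inter> B) \<subseteq> {H \<in> topspace (chabauty G). f H \<in> U}"
    proof
      fix K assume K: "K \<in> cyl G B (H \<inter> B)"
      then have "f K = f H" using H by (intro f) (auto simp: cyl_def topspace_chabauty)
      then show "K \<in> {H \<in> topspace (chabauty G). f H \<in> U}"
        using H K by (simp add: topspace_chabauty cyl_def)
    qed
    then show "\<exists>C. finite C \<and> C \<subseteq> carrier G \<and> cyl G C (H \<inter> C) \<subseteq> {H \<in> topspace (chabauty G). f H \<in> U}"
      using B by blast
  qed (simp add: topspace_chabauty)
qed simp

section \<open>Compactness of the space of subgroups and uniform continuity\<close>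

context group begin

text \<open>A violated subgroup axiom involves at most three elements. Hence the indicators of
  subgroups form a closed set in the Boolean product.\<close>

lemma not_subgroup_finite_witness:
  assumes H: "H \<subseteq> carrier G" "\<not> subgroup H G"
  shows "\<exists>B. finite B \<and> B \<subseteq> carrier G \<and> (\<forall>K. K \<inter> B = H \<inter> B \<longrightarrow> \<not> subgroup K G)"
proof -
  have "\<not> (\<one> \<in> H \<and> (\<forall>x\<in>H. \<forall>y\<in>H. x \<otimes> y \<in> H) \<and> (\<forall>x\<in>H. inv x \<in> H))"
    using H by (auto intro!: subgroup.intro)
  then consider "\<one> \<notin> H" | x y where "x \<in> H" "y \<in> H" "x \<otimes> y \<notin> H" | x where "x \<in> H" "inv x \<notin> H"
    by blast
  then show ?thesis
  proof cases
    case 1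
    have "\<not> subgroup K G" if "K \<inter> {\<one>} = H \<inter> {\<one>}" for K
      using that 1 subgroup.one_closed by blast
    then show ?thesis by (intro exI[of _ "{\<one>}"]) auto
  next
    case (2 x y)
    have "\<not> subgroup K G" if "K \<inter> {x, y, x \<otimes> y} = H \<inter> {x, y, x \<otimes> y}" for K
    proof
      assume K: "subgroup K G"
      have "x \<in> K" "y \<in> K" "x \<otimes> y \<notin> K" using that 2 by blast+
      then show False using subgroup.m_closed[OF K] by blast
    qed
    then show ?thesis using 2 H by (intro exI[of _ "{x, y, x \<otimes> y}"]) auto
  next
    case (3 x)
    have "\<not> subgroup K G" if "K \<inter> {x, inv x} = H \<inter> {x, inv x}" for K
    proof
      assume K: "subgroup K G"
      have "x \<in> K" "inv x \<notin> K" using that 3 by blast+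
      then show False using subgroup.m_inv_closed[OF K] by blast
    qed
    then show ?thesis using 3 H by (intro exI[of _ "{x, inv x}"]) auto
  qed
qed

text \<open>By Tychonoff's theorem the image in the Boolean product is closed in a compact space;
  covers are then carried along the pullback and back.\<close>

lemma compact_space_chabauty: "compact_space (chabauty G)"
proof -
  let ?P = "product_topology (\<lambda>_. discrete_topology (UNIV :: bool set)) (carrier G)"
  let ?f = "\<lambda>H. \<lambda>x\<in>carrier G. x \<in> H"
  let ?K = "?f ` {H. subgroup H G}"
  have cP: "compact_space ?P" by (simp add: compact_space_product_topology compact_space_discrete_topology)
  have top: "topspace ?P = Pi\<^sub>E (carrier G) (\<lambda>_. UNIV)" by simp
  have "openin ?P (topspace ?P - ?K)"
  proof (rule openin_boolean_productI)
    fix h assume h: "h \<in> topspace ?P - ?K"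
    define H where "H = {i \<in> carrier G. h i}"
    have hf: "h = ?f H"
    proof
      fix i show "h i = ?f H i" using h by (cases "i \<in> carrier G") (auto simp: H_def PiE_iff extensional_def)
    qed
    then have "\<not> subgroup H G" using h by blast
    then obtain B where B: "finite B" "B \<subseteq> carrier G" "\<And>K. K \<inter> B = H \<inter> B \<Longrightarrow> \<not> subgroup K G"
      using not_subgroup_finite_witness[of H] unfolding H_def by blast
    have "k \<in> topspace ?P - ?K" if k: "k \<in> Pi\<^sub>E (carrier G) (\<lambda>_. UNIV)" "\<forall>i\<in>B. k i = h i" for k
    proof
      show "k \<notin> ?K"
      proof
        assume "k \<in> ?K"
        then obtain K where K: "subgroup K G" "k = ?f K" by blast
        have "i \<in> K \<longleftrightarrow> i \<in> H" if "i \<in> B" for i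
          using k(2)[rule_format, OF that] that K(2) B(2) by (auto simp: hf subset_iff)
        then have "K \<inter> B = H \<inter> B" by blast
        then show False using B(3) K(1) by blast
      qed
    qed (use k in simp)
    then show "\<exists>B. finite B \<and> B \<subseteq> carrier G \<and>
        (\<forall>k \<in> Pi\<^sub>E (carrier G) (\<lambda>_. UNIV). (\<forall>i\<in>B. k i = h i) \<longrightarrow> k \<in> topspace ?P - ?K)"
      using B(1,2) by blast
  qed auto
  moreover have "?K \<subseteq> topspace ?P" by auto
  ultimately have "closedin ?P ?K" by (simp add: closedin_def)
  then have cK: "compactin ?P ?K" by (rule closedin_compact_space[OF cP])
  show ?thesis
    unfolding compact_space_def compactin_def
  proof (intro conjI allI impI)
    fix \<U> assume U: "Ball \<U> (openin (chabauty G)) \<and> topspace (chabauty G) \<subseteq> \<Union>\<U>"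
    have "\<exists>V. openin ?P V \<and> U = ?f -` V \<inter> {H. subgroup H G}" if "U \<in> \<U>" for U
      using U that by (auto simp: chabauty_def openin_pullback_topology)
    then obtain V where V: "\<And>U. U \<in> \<U> \<Longrightarrow> openin ?P (V U)"
      "\<And>U. U \<in> \<U> \<Longrightarrow> U = ?f -` V U \<inter> {H. subgroup H G}" by metis
    have "?K \<subseteq> \<Union>(V ` \<U>)"
    proof
      fix k assume "k \<in> ?K"
      then obtain H where H: "subgroup H G" "k = ?f H" by blast
      then obtain W where "W \<in> \<U>" "H \<in> W" using U by (auto simp: topspace_chabauty)
      then show "k \<in> \<Union>(V ` \<U>)" using V(2) H by blast
    qed
    moreover have "\<forall>W\<in>V ` \<U>. openin ?P W" using V(1) by blast
    ultimately obtain \<F> where F: "finite \<F>" "\<F> \<subseteq> V ` \<U>" "?K \<subseteq> \<Union>\<F>"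
      using cK unfolding compactin_def by meson
    then obtain \<G> where Gs: "finite \<G>" "\<G> \<subseteq> \<U>" "\<F> = V ` \<G>" by (meson finite_subset_image)
    have "topspace (chabauty G) \<subseteq> \<Union>\<G>"
    proof
      fix H assume "H \<in> topspace (chabauty G)"
      then have H: "subgroup H G" by (simp add: topspace_chabauty)
      then obtain W where "W \<in> \<G>" "?f H \<in> V W" using F(3) Gs(3) by blast
      then show "H \<in> \<Union>\<G>" using V(2) Gs(2) H by blast
    qed
    then show "\<exists>\<F>. finite \<F> \<and> \<F> \<subseteq> \<U> \<and> topspace (chabauty G) \<subseteq> \<Union>\<F>" using Gs by blast
  qed simp
qed

text \<open>Finitely many cylinders on which \<open>f\<close> varies little cover the space; the
  union of their windows works everywhere. It follows that functions of a finite window are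
  uniformly dense among the continuous ones.\<close>

lemma continuous_map_chabauty_uniform:
  assumes f: "continuous_map (chabauty G) euclideanreal f" and e: "0 < (e::real)"
  shows "\<exists>B. finite B \<and> B \<subseteq> carrier G \<and>
    (\<forall>H K. subgroup H G \<longrightarrow> subgroup K G \<longrightarrow> H \<inter> B = K \<inter> B \<longrightarrow> \<bar>f H - f K\<bar> < e)"
proof -
  have "\<exists>B. finite B \<and> B \<subseteq> carrier G \<and> (\<forall>K\<in>cyl G B (H \<inter> B). \<bar>f K - f H\<bar> < e / 2)"
    if H: "subgroup H G" for H
  proof -
    have "openin (chabauty G) {K \<in> topspace (chabauty G). f K \<in> ball (f H) (e / 2)}"
      by (rule openin_continuous_map_preimage[OF f]) simp
    moreover have "H \<in> {K \<in> topspace (chabauty G). f K \<in> ball (f H) (e / 2)}"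
      using H e by (simp add: topspace_chabauty)
    ultimately obtain B where "finite B" "B \<subseteq> carrier G"
      "cyl G B (H \<inter> B) \<subseteq> {K \<in> topspace (chabauty G). f K \<in> ball (f H) (e / 2)}"
      unfolding openin_chabauty_iff by blast
    then show ?thesis by (intro exI[of _ B]) (auto simp: dist_real_def abs_minus_commute)
  qed
  then obtain B where B: "\<And>H. subgroup H G \<Longrightarrow> finite (B H)" "\<And>H. subgroup H G \<Longrightarrow> B H \<subseteq> carrier G"
    "\<And>H K. subgroup H G \<Longrightarrow> K \<in> cyl G (B H) (H \<inter> B H) \<Longrightarrow> \<bar>f K - f H\<bar> < e / 2" by metis
  have "\<forall>U\<in>(\<lambda>H. cyl G (B H) (H \<inter> B H)) ` {H. subgroup H G}. openin (chabauty G) U"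
    using B openin_cyl by blast
  moreover have "topspace (chabauty G) \<subseteq> \<Union>((\<lambda>H. cyl G (B H) (H \<inter> B H)) ` {H. subgroup H G})"
    by (auto simp: topspace_chabauty cyl_def)
  ultimately obtain \<F> where F: "finite \<F>" "\<F> \<subseteq> (\<lambda>H. cyl G (B H) (H \<inter> B H)) ` {H. subgroup H G}"
    "topspace (chabauty G) \<subseteq> \<Union>\<F>"
    using compact_space_chabauty unfolding compact_space_def compactin_def by meson
  from finite_subset_image[OF F(1,2)] obtain Hs where Hs: "finite Hs" "Hs \<subseteq> {H. subgroup H G}"
    "topspace (chabauty G) \<subseteq> \<Union>((\<lambda>H. cyl G (B H) (H \<inter> B H)) ` Hs)"
    using F(3) by blast
  show ?thesis
  proof (intro exI[of _ "\<Union>(B ` Hs)"] conjI allI impI)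
    show "finite (\<Union>(B ` Hs))" using Hs(1,2) B(1) by auto
    show "\<Union>(B ` Hs) \<subseteq> carrier G" using Hs(2) B(2) by blast
    fix H K assume HK: "subgroup H G" "subgroup K G" "H \<inter> \<Union>(B ` Hs) = K \<inter> \<Union>(B ` Hs)"
    then obtain L where L: "L \<in> Hs" "H \<in> cyl G (B L) (L \<inter> B L)"
      using Hs(3) by (auto simp: topspace_chabauty)
    then have "K \<in> cyl G (B L) (L \<inter> B L)" using HK unfolding cyl_def by blast
    then have "\<bar>f K - f L\<bar> < e / 2" "\<bar>f H - f L\<bar> < e / 2" using B(3) L Hs(2) by blast+
    then show "\<bar>f H - f K\<bar> < e" by linarith
  qed
qed

section \<open>Weak-* convergence tested on cylinders\<close>

lemma topspace_weak_star: "topspace (weak_star G) = sub_prob G"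
proof -
  have "sub_prob G \<in> {{\<mu> \<in> sub_prob G. (\<integral>H. f H \<partial>\<mu>) \<in> U} | f U.
          continuous_map (chabauty G) euclideanreal f \<and> open (U :: real set)}"
    by (intro CollectI exI[of _ "\<lambda>_. 0"] exI[of _ UNIV]) auto
  then show ?thesis unfolding weak_star_def topology_generated_by_topspace by blast
qed

text \<open>A continuous function lies within \<open>r / 3\<close> of a finite combination of
  cylinder indicators, simultaneously for all measures, so three thirds give the estimate.\<close>

lemma limitin_weak_starI:
  assumes \<nu>: "\<And>i. \<nu> i \<in> sub_prob G" and \<mu>: "\<mu> \<in> sub_prob G"
    and cyl: "\<And>B S. finite B \<Longrightarrow> B \<subseteq> carrier G \<Longrightarrow> S \<subseteq> B \<Longrightarrow>
      (\<lambda>i. measure (\<nu> i) (cyl G B S)) \<longlonglongrightarrow> measure \<mu> (cyl G B S)"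
  shows "limitin (weak_star G) \<nu> \<mu> sequentially"
  unfolding weak_star_def
proof (rule limitin_topology_generated_by)
  show "\<mu> \<in> topspace (topology_generated_by {{\<mu> \<in> sub_prob G. (\<integral>H. f H \<partial>\<mu>) \<in> U} | f U.
          continuous_map (chabauty G) euclideanreal f \<and> open (U :: real set)})"
    using \<mu> topspace_weak_star unfolding weak_star_def by blast
  fix W assume "W \<in> {{\<mu> \<in> sub_prob G. (\<integral>H. f H \<partial>\<mu>) \<in> U} | f U.
          continuous_map (chabauty G) euclideanreal f \<and> open (U :: real set)}" and W: "\<mu> \<in> W"
  then obtain f U where f: "continuous_map (chabauty G) euclideanreal f" and U: "open (U :: real set)"
    and Weq: "W = {\<mu> \<in> sub_prob G. (\<integral>H. f H \<partial>\<mu>) \<in> U}" by blast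
  have "(\<lambda>i. \<integral>H. f H \<partial>\<nu> i) \<longlonglongrightarrow> (\<integral>H. f H \<partial>\<mu>)"
  proof (rule LIMSEQ_I)
    fix r :: real assume r: "0 < r"
    have "0 < r / 3" using r by simp
    from continuous_map_chabauty_uniform[OF f this]
    obtain B where B: "finite B" "B \<subseteq> carrier G"
      "\<forall>H K. subgroup H G \<longrightarrow> subgroup K G \<longrightarrow> H \<inter> B = K \<inter> B \<longrightarrow> \<bar>f H - f K\<bar> < r / 3"
      by blast
    \<comment> \<open>For an empty cylinder the chosen value is arbitrary; its coefficient then
      multiplies a vanishing indicator and a vanishing measure.\<close>
    define rep where "rep S = f (SOME H. H \<in> cyl G B S)" for S
    define s where "s H = (\<Sum>S\<in>Pow B. rep S * indicator (cyl G B S) H)" for H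
    have fs: "\<bar>f H - s H\<bar> < r / 3" if H: "subgroup H G" for H
    proof -
      have "s H = (\<Sum>S\<in>{H \<inter> B}. rep S * indicator (cyl G B S) H)"
        unfolding s_def using B(1) by (intro sum.mono_neutral_right) (auto simp: cyl_def indicator_def split: if_splits)
      also have "\<dots> = rep (H \<inter> B)" using H by (simp add: cyl_def)
      finally have sH: "s H = rep (H \<inter> B)" .
      have "(SOME K. K \<in> cyl G B (H \<inter> B)) \<in> cyl G B (H \<inter> B)"
        by (rule someI[of _ H]) (use H in \<open>simp add: cyl_def\<close>)
      then show ?thesis unfolding sH rep_def by (intro B(3)[rule_format] H) (auto simp: cyl_def)
    qed
    have close: "\<bar>(\<integral>H. f H \<partial>\<rho>) - (\<Sum>S\<in>Pow B. rep S * measure \<rho> (cyl G B S))\<bar> \<le> r / 3"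
      if \<rho>: "\<rho> \<in> sub_prob G" for \<rho>
    proof -
      interpret prob_space \<rho> using \<rho> by (simp add: sub_prob_def)
      have sp: "space \<rho> = {H. subgroup H G}" and st: "sets \<rho> = sets (sub_borel G)"
        using \<rho> by (auto simp: sub_prob_def)
      have cs: "cyl G B S \<in> sets \<rho>" for S unfolding st by (rule cyl_sets[OF B(1,2)])
      have fm: "f \<in> borel_measurable \<rho>"
        using continuous_map_sub_borel[OF f] measurable_cong_sets[OF st refl, of borel] by blast
      have ints: "integrable \<rho> s" unfolding s_def using cs
        by (intro Bochner_Integration.integrable_sum integrable_mult_right integrable_real_indicator)
          (auto simp: emeasure_eq_measure)
      have sm: "s \<in> borel_measurable \<rho>" using ints by auto
      have ifs: "integrable \<rho> (\<lambda>H. f H - s H)"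
        using fs fm sm by (intro integrable_const_bound[of _ "r / 3"]) (auto intro!: AE_I2 less_imp_le simp: sp)
      have "integrable \<rho> (\<lambda>H. (f H - s H) + s H)" using ifs ints by (rule Bochner_Integration.integrable_add)
      then have "integrable \<rho> f" by simp
      have "(\<integral>H. s H \<partial>\<rho>) = (\<Sum>S\<in>Pow B. \<integral>H. rep S * indicator (cyl G B S) H \<partial>\<rho>)"
        unfolding s_def using cs
        by (intro Bochner_Integration.integral_sum integrable_mult_right integrable_real_indicator)
          (auto simp: emeasure_eq_measure)
      also have "\<dots> = (\<Sum>S\<in>Pow B. rep S * measure \<rho> (cyl G B S))" using cs by simp
      finally have eq: "(\<integral>H. f H \<partial>\<rho>) - (\<Sum>S\<in>Pow B. rep S * measure \<rho> (cyl G B S)) = (\<integral>H. f H - s H \<partial>\<rho>)"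
        using \<open>integrable \<rho> f\<close> ints by simp
      have "\<bar>\<integral>H. f H - s H \<partial>\<rho>\<bar> \<le> (\<integral>H. \<bar>f H - s H\<bar> \<partial>\<rho>)" by (rule integral_abs_bound)
      also have "\<dots> \<le> (\<integral>H. r / 3 \<partial>\<rho>)"
        using fs ifs by (intro integral_mono) (auto simp: sp intro: less_imp_le)
      also have "\<dots> = r / 3" by (simp add: prob_space)
      finally show ?thesis unfolding eq .
    qed
    have "(\<lambda>i. \<Sum>S\<in>Pow B. rep S * measure (\<nu> i) (cyl G B S))
        \<longlonglongrightarrow> (\<Sum>S\<in>Pow B. rep S * measure \<mu> (cyl G B S))"
      by (intro tendsto_sum tendsto_mult_left cyl B) auto
    from LIMSEQ_D[OF this, of "r / 3"] obtain n0 where n0: "\<And>i. i \<ge> n0 \<Longrightarrow>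
        \<bar>(\<Sum>S\<in>Pow B. rep S * measure (\<nu> i) (cyl G B S)) - (\<Sum>S\<in>Pow B. rep S * measure \<mu> (cyl G B S))\<bar> < r / 3"
      using r by auto
    have "norm ((\<integral>H. f H \<partial>\<nu> i) - (\<integral>H. f H \<partial>\<mu>)) < r" if "i \<ge> n0" for i
      using n0[OF that] close[OF \<mu>] close[OF \<nu>[of i]] unfolding real_norm_def by linarith
    then show "\<exists>n0. \<forall>i\<ge>n0. norm ((\<integral>H. f H \<partial>\<nu> i) - (\<integral>H. f H \<partial>\<mu>)) < r" by blast
  qed
  moreover have "(\<integral>H. f H \<partial>\<mu>) \<in> U" using W Weq by simp
  ultimately have "\<forall>\<^sub>F i in sequentially. (\<integral>H. f H \<partial>\<nu> i) \<in> U" by (intro topological_tendstoD[OF _ U])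
  then show "\<forall>\<^sub>F i in sequentially. \<nu> i \<in> W" by (rule eventually_mono) (simp add: Weq \<nu>)
qed

end

section \<open>The conjugation action on invariant random subgroups\<close>

context group begin

lemma mem_conj_subgroup_iff:
  assumes "H \<subseteq> carrier G" "g \<in> carrier G"
  shows "x \<in> conj_subgroup G g H \<longleftrightarrow> x \<in> carrier G \<and> inv g \<otimes> x \<otimes> g \<in> H"
proof
  assume "x \<in> conj_subgroup G g H"
  then obtain h where h: "h \<in> H" "x = g \<otimes> h \<otimes> inv g"
    by (auto simp: conj_subgroup_def l_coset_def r_coset_def)
  have "h \<in> carrier G" using h assms by auto
  then have "inv g \<otimes> x \<otimes> g = h" using h(2) assms by (simp add: m_assoc) (simp add: m_assoc[symmetric])
  then show "x \<in> carrier G \<and> inv g \<otimes> x \<otimes> g \<in> H" using h assms \<open>h \<in> carrier G\<close> by simp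
next
  assume x: "x \<in> carrier G \<and> inv g \<otimes> x \<otimes> g \<in> H"
  have "x = g \<otimes> (inv g \<otimes> x \<otimes> g) \<otimes> inv g"
    using x assms by (simp add: m_assoc) (simp add: m_assoc[symmetric])
  then show "x \<in> conj_subgroup G g H" using x unfolding conj_subgroup_def l_coset_def r_coset_def by blast
qed

lemma subgroup_conj_subgroup:
  assumes H: "subgroup H G" and g: "g \<in> carrier G"
  shows "subgroup (conj_subgroup G g H) G"
proof -
  have sH: "H \<subseteq> carrier G" using H by (rule subgroup.subset)
  note iff = mem_conj_subgroup_iff[OF sH g]
  show ?thesis
  proof (rule subgroup.intro)
    show "conj_subgroup G g H \<subseteq> carrier G" using iff by blast
    show "\<one> \<in> conj_subgroup G g H" using H g by (simp add: iff subgroup.one_closed)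
    fix x assume x: "x \<in> conj_subgroup G g H"
    have "inv (inv g \<otimes> x \<otimes> g) = inv g \<otimes> inv x \<otimes> g" using x g by (simp add: iff inv_mult_group m_assoc)
    then show "inv x \<in> conj_subgroup G g H"
      using x subgroup.m_inv_closed[OF H, of "inv g \<otimes> x \<otimes> g"] by (simp add: iff)
    fix y assume y: "y \<in> conj_subgroup G g H"
    have "(inv g \<otimes> x \<otimes> g) \<otimes> (inv g \<otimes> y \<otimes> g) = inv g \<otimes> (x \<otimes> y) \<otimes> g"
    proof -
      have xy: "x \<in> carrier G" "y \<in> carrier G" using x y by (auto simp: iff)
      have "(inv g \<otimes> x \<otimes> g) \<otimes> (inv g \<otimes> y \<otimes> g) = inv g \<otimes> x \<otimes> (g \<otimes> inv g) \<otimes> y \<otimes> g"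
        using xy g by (simp only: m_assoc m_closed inv_closed)
      then show ?thesis using xy g by (simp add: m_assoc)
    qed
    then show "x \<otimes> y \<in> conj_subgroup G g H"
      using x y subgroup.m_closed[OF H, of "inv g \<otimes> x \<otimes> g" "inv g \<otimes> y \<otimes> g"] by (simp add: iff)
  qed
qed

lemma conj_subgroup_one: "subgroup H G \<Longrightarrow> conj_subgroup G \<one> H = H"
  using subgroup.subset[of H G] by (auto simp: mem_conj_subgroup_iff subset_iff)

lemma conj_subgroup_mult:
  assumes H: "subgroup H G" and g: "g \<in> carrier G" "h \<in> carrier G"
  shows "conj_subgroup G (g \<otimes> h) H = conj_subgroup G g (conj_subgroup G h H)"
proof -
  have sH: "H \<subseteq> carrier G" "conj_subgroup G h H \<subseteq> carrier G"
    using H subgroup_conj_subgroup[OF H g(2)] by (auto dest: subgroup.subset)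
  have "inv (g \<otimes> h) \<otimes> x \<otimes> (g \<otimes> h) = inv h \<otimes> (inv g \<otimes> x \<otimes> g) \<otimes> h" if "x \<in> carrier G" for x
    using that g by (simp add: inv_mult_group m_assoc)
  then show ?thesis using g sH by (auto simp: mem_conj_subgroup_iff)
qed

lemma finite_index_conj_subgroup:
  assumes K: "finite_index_subgroup G K" and g: "g \<in> carrier G"
  shows "finite_index_subgroup G (conj_subgroup G g K)"
proof -
  obtain T where sub: "subgroup K G" and T: "finite T" "T \<subseteq> carrier G"
    "\<And>x. x \<in> carrier G \<Longrightarrow> \<exists>t\<in>T. x \<in> t <# K"
    using K unfolding finite_index_iff by blast
  have sK: "K \<subseteq> carrier G" using sub by (rule subgroup.subset)
  note sC = subgroup_conj_subgroup[OF sub g]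
  have "\<exists>t\<in>(\<lambda>t. t \<otimes> inv g) ` T. x \<in> t <# conj_subgroup G g K" if x: "x \<in> carrier G" for x
  proof -
    obtain t where t: "t \<in> T" "x \<otimes> g \<in> t <# K" using T(3)[of "x \<otimes> g"] x g by auto
    have tc: "t \<in> carrier G" using t T by auto
    have "inv t \<otimes> (x \<otimes> g) \<in> K" using t tc sK by (simp add: mem_l_coset_iff)
    moreover have "inv g \<otimes> (inv (t \<otimes> inv g) \<otimes> x) \<otimes> g = inv t \<otimes> (x \<otimes> g)"
      using tc g x by (simp add: inv_mult_group m_assoc) (simp add: m_assoc[symmetric])
    ultimately have "x \<in> (t \<otimes> inv g) <# conj_subgroup G g K"
      using tc g x sK by (simp add: mem_l_coset_iff[OF subgroup.subset[OF sC]] mem_conj_subgroup_iff)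
    then show ?thesis using t by blast
  qed
  moreover have "finite ((\<lambda>t. t \<otimes> inv g) ` T)" "(\<lambda>t. t \<otimes> inv g) ` T \<subseteq> carrier G" using T g by auto
  ultimately show ?thesis unfolding finite_index_iff using sC by blast
qed

lemma normalizer_iff:
  "K \<subseteq> carrier G \<Longrightarrow> g \<in> normalizer G K \<longleftrightarrow> g \<in> carrier G \<and> conj_subgroup G g K = K"
  by (simp add: normalizer_def stabilizer_def conj_subgroup_def)

lemma subgroup_normalizer:
  assumes K: "subgroup K G" shows "subgroup (normalizer G K) G"
proof -
  have sK: "K \<subseteq> carrier G" using K by (rule subgroup.subset)
  note iff = normalizer_iff[OF sK]
  show ?thesis
  proof (rule subgroup.intro)
    show "normalizer G K \<subseteq> carrier G" using iff by blast
    show "\<one> \<in> normalizer G K" using K by (simp add: iff conj_subgroup_one)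
    fix x assume x: "x \<in> normalizer G K"
    then have xc: "x \<in> carrier G" "conj_subgroup G x K = K" by (simp_all add: iff)
    have "conj_subgroup G (inv x \<otimes> x) K = conj_subgroup G (inv x) (conj_subgroup G x K)"
      by (rule conj_subgroup_mult[OF K inv_closed[OF xc(1)] xc(1)])
    then have "conj_subgroup G (inv x) K = K" using xc K by (simp add: conj_subgroup_one)
    then show "inv x \<in> normalizer G K" using x by (simp add: iff)
    fix y assume "y \<in> normalizer G K"
    then show "x \<otimes> y \<in> normalizer G K" using x K by (simp add: iff conj_subgroup_mult)
  qed
qed

lemma subset_normalizer:
  assumes K: "subgroup K G" shows "K \<subseteq> normalizer G K"
proof
  fix k assume k: "k \<in> K"
  have sK: "K \<subseteq> carrier G" using K by (rule subgroup.subset)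
  have kc: "k \<in> carrier G" using k sK by auto
  have "x \<in> conj_subgroup G k K \<longleftrightarrow> x \<in> K" for x
  proof
    assume "x \<in> conj_subgroup G k K"
    then have x: "x \<in> carrier G" "inv k \<otimes> x \<otimes> k \<in> K" using sK kc by (auto simp: mem_conj_subgroup_iff)
    have "k \<otimes> (inv k \<otimes> x \<otimes> k) \<otimes> inv k \<in> K"
      by (intro subgroup.m_closed[OF K] subgroup.m_inv_closed[OF K] k x(2))
    then show "x \<in> K" using x kc by (simp add: m_assoc) (simp add: m_assoc[symmetric])
  next
    assume x: "x \<in> K"
    then have "inv k \<otimes> x \<otimes> k \<in> K"
      by (intro subgroup.m_closed[OF K] subgroup.m_inv_closed[OF K] k)
    then show "x \<in> conj_subgroup G k K" using x kc sK by (auto simp: mem_conj_subgroup_iff)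
  qed
  then show "k \<in> normalizer G K" using kc by (auto simp: normalizer_iff[OF sK])
qed

lemma conj_subgroup_mult_normalizer:
  assumes K: "subgroup K G" and g: "g \<in> carrier G" and l: "l \<in> normalizer G K"
  shows "conj_subgroup G (g \<otimes> l) K = conj_subgroup G g K"
  using assms by (simp add: conj_subgroup_mult normalizer_iff[OF subgroup.subset[OF K]])

text \<open>Conjugation moves the window and the trace along, so preimages of cylinders are
  cylinders. Hence conjugation is Borel, and finite averages of cylinder indicators still depend on
  a finite window only.\<close>

lemma conj_subgroup_in_cyl_iff:
  assumes H: "subgroup H G" and g: "g \<in> carrier G" and B: "S \<subseteq> B" "B \<subseteq> carrier G"
  defines "c \<equiv> \<lambda>x. inv g \<otimes> x \<otimes> g"
  shows "conj_subgroup G g H \<in> cyl G B S \<longleftrightarrow> H \<in> cyl G (c ` B) (c ` S)"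
proof -
  have sH: "H \<subseteq> carrier G" using H by (rule subgroup.subset)
  have inj: "x = y" if "x \<in> B" "y \<in> B" "c x = c y" for x y
    using that B g unfolding c_def by (simp add: subset_iff)
  have "conj_subgroup G g H \<inter> B = S \<longleftrightarrow> (\<forall>x\<in>B. c x \<in> H \<longleftrightarrow> x \<in> S)"
    using B by (auto simp: mem_conj_subgroup_iff[OF sH g] c_def subset_iff)
  also have "\<dots> \<longleftrightarrow> H \<inter> c ` B = c ` S"
  proof
    assume a: "\<forall>x\<in>B. c x \<in> H \<longleftrightarrow> x \<in> S"
    then show "H \<inter> c ` B = c ` S" using B(1) by blast
  next
    assume a: "H \<inter> c ` B = c ` S"
    show "\<forall>x\<in>B. c x \<in> H \<longleftrightarrow> x \<in> S"
    proof
      fix x assume x: "x \<in> B"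
      show "c x \<in> H \<longleftrightarrow> x \<in> S"
      proof
        assume "c x \<in> H"
        then have "c x \<in> c ` S" using a x by blast
        then obtain y where "y \<in> S" "c x = c y" by blast
        then show "x \<in> S" using inj[OF x, of y] B(1) by auto
      qed (use a in blast)
    qed
  qed
  finally show ?thesis using H subgroup_conj_subgroup[OF H g] by (simp add: cyl_def)
qed

lemma conj_image_carrier: "g \<in> carrier G \<Longrightarrow> B \<subseteq> carrier G \<Longrightarrow> (\<lambda>x. inv g \<otimes> x \<otimes> g) ` B \<subseteq> carrier G"
  by auto

lemma conj_subgroup_measurable:
  assumes g: "g \<in> carrier G"
  shows "conj_subgroup G g \<in> measurable (sub_borel G) (sub_borel G)"
proof -
  have "conj_subgroup G g \<in> measurable (sub_borel G) (measure_of {H. subgroup H G} {U. openin (chabauty G) U} (\<lambda>_. 0))"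
  proof (rule measurable_measure_of)
    show "{U. openin (chabauty G) U} \<subseteq> Pow {H. subgroup H G}"
      by (auto simp: openin_chabauty_iff)
    show "conj_subgroup G g \<in> space (sub_borel G) \<rightarrow> {H. subgroup H G}"
      using subgroup_conj_subgroup g by (auto simp: space_sub_borel)
    fix U assume "U \<in> {U. openin (chabauty G) U}"
    then have U: "openin (chabauty G) U" by simp
    have "openin (chabauty G) (conj_subgroup G g -` U \<inter> space (sub_borel G))"
    proof (rule openin_chabautyI)
      fix H assume H: "H \<in> conj_subgroup G g -` U \<inter> space (sub_borel G)"
      then have sub: "subgroup H G" and HU: "conj_subgroup G g H \<in> U" by (auto simp: space_sub_borel)
      show "subgroup H G" by fact
      obtain B where B: "finite B" "B \<subseteq> carrier G" "cyl G B (conj_subgroup G g H \<inter> B) \<subseteq> U"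
        using U HU unfolding openin_chabauty_iff by blast
      let ?c = "\<lambda>x. inv g \<otimes> x \<otimes> g"
      let ?S = "conj_subgroup G g H \<inter> B"
      have "conj_subgroup G g H \<in> cyl G B ?S" using subgroup_conj_subgroup[OF sub g] by (simp add: cyl_def)
      then have HS: "H \<inter> ?c ` B = ?c ` ?S"
        unfolding conj_subgroup_in_cyl_iff[OF sub g Int_lower2 B(2)] by (simp add: cyl_def)
      have "cyl G (?c ` B) (H \<inter> ?c ` B) \<subseteq> conj_subgroup G g -` U \<inter> space (sub_borel G)"
      proof
        fix K assume K: "K \<in> cyl G (?c ` B) (H \<inter> ?c ` B)"
        then have sK: "subgroup K G" by (simp add: cyl_def)
        have "conj_subgroup G g K \<in> cyl G B ?S"
          unfolding conj_subgroup_in_cyl_iff[OF sK g Int_lower2 B(2)] using K HS by simp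
        then show "K \<in> conj_subgroup G g -` U \<inter> space (sub_borel G)"
          using B(3) sK by (auto simp: space_sub_borel)
      qed
      then show "\<exists>B. finite B \<and> B \<subseteq> carrier G \<and> cyl G B (H \<inter> B) \<subseteq> conj_subgroup G g -` U \<inter> space (sub_borel G)"
        using B(1) conj_image_carrier[OF g B(2)] by (intro exI[of _ "?c ` B"]) auto
    qed
    then show "conj_subgroup G g -` U \<inter> space (sub_borel G) \<in> sets (sub_borel G)"
      by (rule open_in_sets_sub_borel)
  qed
  then show ?thesis by (simp add: sub_borel_def)
qed

section \<open>Averages over conjugates as invariant random subgroups\<close>

lemma conj_average_sub_prob:
  assumes F: "finite F" "F \<noteq> {}" "F \<subseteq> carrier G" and H: "subgroup H G"
  shows "conj_average G F H \<in> sub_prob G"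
proof -
  have sub: "sets (sub_borel G) \<subseteq> Pow {H. subgroup H G}"
    using sets.sets_into_space[of _ "sub_borel G"] by (auto simp: space_sub_borel)
  have sp: "space (conj_average G F H) = {H. subgroup H G}"
    unfolding conj_average_def using sub by (rule space_measure_of)
  have st: "sets (conj_average G F H) = sets (sub_borel G)"
    unfolding conj_average_def using sub by (simp add: sets_sub_borel_space)
  have top: "{H. subgroup H G} \<in> sets (sub_borel G)" using sets.top[of "sub_borel G"] by (simp add: space_sub_borel)
  have "(\<Sum>f\<in>F. indicator {H. subgroup H G} (conj_subgroup G f H)) = (\<Sum>f\<in>F. 1 :: ennreal)"
    using F H subgroup_conj_subgroup by (intro sum.cong) auto
  then have "emeasure (conj_average G F H) (space (conj_average G F H)) = 1"
    using F by (simp add: sp emeasure_conj_average[OF top])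
      (intro ennreal_divide_self, auto simp: of_nat_less_top less_imp_neq)
  then have "prob_space (conj_average G F H)" by (rule prob_spaceI)
  then show ?thesis using sp st by (simp add: sub_prob_def)
qed

lemma measure_conj_average:
  assumes F: "finite F" "F \<noteq> {}" and A: "A \<in> sets (sub_borel G)"
  shows "measure (conj_average G F H) A = (\<Sum>f\<in>F. indicator A (conj_subgroup G f H)) / card F"
proof -
  have c: "0 < card F" using F by (simp add: card_gt_0_iff)
  have "emeasure (conj_average G F H) A = (\<Sum>f\<in>F. ennreal (indicator A (conj_subgroup G f H))) / ennreal (card F)"
    by (simp add: emeasure_conj_average[OF A] ennreal_of_nat_eq_real_of_nat ennreal_indicator)
  also have "\<dots> = ennreal (\<Sum>f\<in>F. indicator A (conj_subgroup G f H)) / ennreal (card F)"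
    by (subst sum_ennreal) auto
  also have "\<dots> = ennreal ((\<Sum>f\<in>F. indicator A (conj_subgroup G f H)) / card F)"
    using c by (intro divide_ennreal) (auto intro: sum_nonneg)
  finally show ?thesis by (simp add: measure_def sum_nonneg)
qed

lemma sub_prob_eqI:
  assumes "\<mu> \<in> sub_prob G" "\<nu> \<in> sub_prob G"
    "\<And>A. A \<in> sets (sub_borel G) \<Longrightarrow> measure \<mu> A = measure \<nu> A"
  shows "\<mu> = \<nu>"
proof (rule measure_eqI)
  interpret M: prob_space \<mu> using assms(1) by (simp add: sub_prob_def)
  interpret N: prob_space \<nu> using assms(2) by (simp add: sub_prob_def)
  show "sets \<mu> = sets \<nu>" using assms by (simp add: sub_prob_def)
  fix A assume "A \<in> sets \<mu>"
  then show "emeasure \<mu> A = emeasure \<nu> A"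
    using assms by (simp add: M.emeasure_eq_measure N.emeasure_eq_measure sub_prob_def)
qed

lemma distr_conj_sub_prob:
  assumes "\<mu> \<in> sub_prob G" "g \<in> carrier G"
  shows "distr \<mu> (sub_borel G) (conj_subgroup G g) \<in> sub_prob G"
proof -
  interpret prob_space \<mu> using assms(1) by (simp add: sub_prob_def)
  have "conj_subgroup G g \<in> measurable \<mu> (sub_borel G)"
    using conj_subgroup_measurable[OF assms(2)] assms(1) measurable_cong_sets[of \<mu> "sub_borel G"]
    by (auto simp: sub_prob_def)
  then show ?thesis by (auto simp: sub_prob_def prob_space_distr space_sub_borel)
qed

lemma IRS_iff:
  assumes "\<mu> \<in> sub_prob G"
  shows "\<mu> \<in> IRS G \<longleftrightarrow> (\<forall>g\<in>carrier G. \<forall>A\<in>sets (sub_borel G).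
    measure \<mu> (conj_subgroup G g -` A \<inter> {H. subgroup H G}) = measure \<mu> A)"
proof -
  have m: "conj_subgroup G g \<in> measurable \<mu> (sub_borel G)" if "g \<in> carrier G" for g
    using conj_subgroup_measurable[OF that] assms measurable_cong_sets[of \<mu> "sub_borel G"]
    by (auto simp: sub_prob_def)
  have md: "measure (distr \<mu> (sub_borel G) (conj_subgroup G g)) A =
      measure \<mu> (conj_subgroup G g -` A \<inter> {H. subgroup H G})"
    if "g \<in> carrier G" "A \<in> sets (sub_borel G)" for g A
    using measure_distr[OF m[OF that(1)] that(2)] assms by (simp add: sub_prob_def)
  show ?thesis
  proof
    assume "\<mu> \<in> IRS G"
    then show "\<forall>g\<in>carrier G. \<forall>A\<in>sets (sub_borel G).
        measure \<mu> (conj_subgroup G g -` A \<inter> {H. subgroup H G}) = measure \<mu> A"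
      using md by (auto simp: IRS_def)
  next
    assume r: "\<forall>g\<in>carrier G. \<forall>A\<in>sets (sub_borel G).
        measure \<mu> (conj_subgroup G g -` A \<inter> {H. subgroup H G}) = measure \<mu> A"
    have "distr \<mu> (sub_borel G) (conj_subgroup G g) = \<mu>" if "g \<in> carrier G" for g
      using that r md by (intro sub_prob_eqI distr_conj_sub_prob assms) auto
    then show "\<mu> \<in> IRS G" using assms by (simp add: IRS_def)
  qed
qed

text \<open>Conjugates of \<open>K\<close> depend only on the left coset of its normalizer, so the
  average is the uniform measure on the conjugacy class of \<open>K\<close>, and its invariance is
  translation invariance of sums over transversals.\<close>

lemma conj_average_IRS_fi:
  assumes fg: "finitely_generated_group G"
    and F: "finite F" "F \<noteq> {}" "F \<subseteq> carrier G" and K: "finite_index_subgroup G K"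
    and tr: "finite_union_of_transversals G (normalizer G K) F"
  shows "conj_average G F K \<in> IRS_fi G"
proof -
  have sub: "subgroup K G" using K by (simp add: finite_index_subgroup_def)
  note sp = conj_average_sub_prob[OF F sub]
  have "measure (conj_average G F K) (conj_subgroup G g -` A \<inter> {H. subgroup H G}) = measure (conj_average G F K) A"
    if g: "g \<in> carrier G" and A: "A \<in> sets (sub_borel G)" for g A
  proof -
    have A': "conj_subgroup G g -` A \<inter> {H. subgroup H G} \<in> sets (sub_borel G)"
      using measurable_sets[OF conj_subgroup_measurable[OF g] A] by (simp add: space_sub_borel)
    have "(\<Sum>f\<in>F. indicator (conj_subgroup G g -` A \<inter> {H. subgroup H G}) (conj_subgroup G f K)) =
        (\<Sum>f\<in>F. indicator A (conj_subgroup G (g \<otimes> f) K) :: real)"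
      using F(3) g sub
      by (intro sum.cong) (auto simp: indicator_def conj_subgroup_mult subgroup_conj_subgroup subset_iff)
    also have "\<dots> = (\<Sum>f\<in>F. indicator A (conj_subgroup G f K))"
      using sub g
      by (intro sum_union_transversals_translate[OF subgroup_normalizer[OF sub] tr F(1)])
        (auto simp: conj_subgroup_mult_normalizer)
    finally show ?thesis by (simp add: measure_conj_average[OF F(1,2)] A A')
  qed
  then have "conj_average G F K \<in> IRS G" by (simp add: IRS_iff[OF sp])
  moreover have "measure (conj_average G F K) {H. finite_index_subgroup G H} = 1"
  proof -
    have "{H. finite_index_subgroup G H} = (\<Union>H\<in>{H. finite_index_subgroup G H}. {H})" by blast
    also have "\<dots> \<in> sets (sub_borel G)"
      by (intro sets.countable_UN' countable_finite_index fg)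
        (auto intro: singleton_sets_sub_borel simp: finite_index_subgroup_def)
    finally have m: "{H. finite_index_subgroup G H} \<in> sets (sub_borel G)" .
    have "(\<Sum>f\<in>F. indicator {H. finite_index_subgroup G H} (conj_subgroup G f K)) = (\<Sum>f\<in>F. 1 :: real)"
      using F(3) finite_index_conj_subgroup[OF K] by (intro sum.cong) auto
    then show ?thesis using F by (simp add: measure_conj_average[OF F(1,2) m])
  qed
  ultimately show ?thesis by (simp add: IRS_fi_def)
qed

section \<open>From extreme points to constancy of invariant functions\<close>

lemma IRS_pmp_action:
  assumes \<mu>: "\<mu> \<in> IRS G" shows "pmp_action G \<mu> (conj_subgroup G)"
proof -
  have sp: "space \<mu> = {H. subgroup H G}" and st: "sets \<mu> = sets (sub_borel G)" and pr: "prob_space \<mu>"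
    using \<mu> by (auto simp: IRS_def sub_prob_def)
  have "conj_subgroup G g \<in> measurable \<mu> \<mu>" if "g \<in> carrier G" for g
    using conj_subgroup_measurable[OF that] st measurable_cong_sets[of \<mu> "sub_borel G" \<mu> "sub_borel G"] by simp
  moreover have "distr \<mu> \<mu> (conj_subgroup G g) = \<mu>" if "g \<in> carrier G" for g
  proof -
    have "distr \<mu> \<mu> (conj_subgroup G g) = distr \<mu> (sub_borel G) (conj_subgroup G g)"
      by (rule distr_cong) (use st in auto)
    then show ?thesis using \<mu> that by (simp add: IRS_def)
  qed
  ultimately show ?thesis
    unfolding pmp_action_def pmp_action_axioms_def
    using pr group_axioms by (auto simp: sp conj_subgroup_one conj_subgroup_mult)
qed

text \<open>An invariant function \<open>\<phi>\<close> with mean \<open>c\<close> gives invariant probability densities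
  \<open>1 \<plusminus> (\<phi> - c) / D\<close> averaging to \<open>1\<close>, so extremality forces \<open>\<phi> = c\<close>.\<close>

lemma ergodic_IRS_invariant_function:
  assumes erg: "ergodic_IRS G \<mu>" and \<phi>: "pmp_action.bounded_meas \<mu> \<phi>"
    and inv: "\<And>g. g \<in> carrier G \<Longrightarrow> AE H in \<mu>. \<phi> (conj_subgroup G g H) = \<phi> H"
  shows "AE H in \<mu>. \<phi> H = (\<integral>H. \<phi> H \<partial>\<mu>)"
proof -
  have I: "\<mu> \<in> IRS G" using erg by (simp add: ergodic_IRS_def)
  interpret pmp_action G \<mu> "conj_subgroup G" by (rule IRS_pmp_action[OF I])
  have sp: "space \<mu> = {H. subgroup H G}" and st: "sets \<mu> = sets (sub_borel G)"
    using I by (auto simp: IRS_def sub_prob_def)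
  obtain B where B: "\<And>H. H \<in> space \<mu> \<Longrightarrow> \<bar>\<phi> H\<bar> \<le> B" using \<phi> unfolding bounded_meas_def by blast
  define c where "c = (\<integral>H. \<phi> H \<partial>\<mu>)"
  \<comment> \<open>Large enough for the densities to be nonnegative; the added 1 keeps the
    denominator positive.\<close>
  define D where "D = \<bar>B\<bar> + \<bar>c\<bar> + 1"
  have D: "D > 0" by (simp add: D_def)
  define w where "w s H = 1 + s * (\<phi> H - c) / D" for s H
  have w0: "0 \<le> w s H" if "H \<in> space \<mu>" "\<bar>s\<bar> = 1" for s H
  proof -
    have "\<bar>\<phi> H - c\<bar> \<le> D" using B[OF that(1)] by (simp add: D_def)
    then have "\<bar>s * (\<phi> H - c) / D\<bar> \<le> 1" using that(2) D by (simp add: abs_mult)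
    then show ?thesis unfolding w_def by linarith
  qed
  have bmw: "bounded_meas (w s)" for s
  proof -
    have "bounded_meas (\<lambda>H. 1 + s * (\<phi> H - c) / D)"
      by (rule bm_add[OF bm_const bm_divide[OF bm_mult[OF bm_const bm_diff[OF \<phi> bm_const]]]])
    then show ?thesis unfolding w_def .
  qed
  have [measurable]: "w s \<in> borel_measurable \<mu>" for s by (rule bm_measurable[OF bmw])
  have intw: "(\<integral>H. w s H \<partial>\<mu>) = 1" for s
  proof -
    have i: "integrable \<mu> \<phi>" by (rule bm_integrable[OF \<phi>])
    have "(\<integral>H. w s H \<partial>\<mu>) = (\<integral>H. 1 \<partial>\<mu>) + (\<integral>H. s * (\<phi> H - c) / D \<partial>\<mu>)"
      unfolding w_def using i by (intro Bochner_Integration.integral_add) auto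
    also have "(\<integral>H. s * (\<phi> H - c) / D \<partial>\<mu>) = s * ((\<integral>H. \<phi> H \<partial>\<mu>) - c) / D"
      using i by (simp add: prob_space)
    finally show ?thesis by (simp add: c_def prob_space)
  qed
  define \<nu> where "\<nu> s = density \<mu> (\<lambda>H. ennreal (w s H))" for s
  have mnu: "measure (\<nu> s) A = (\<integral>H. w s H * indicator A H \<partial>\<mu>)" if "A \<in> sets \<mu>" "\<bar>s\<bar> = 1" for s A
  proof -
    have "emeasure (\<nu> s) A = (\<integral>\<^sup>+H. ennreal (w s H) * indicator A H \<partial>\<mu>)"
      unfolding \<nu>_def using that by (simp add: emeasure_density)
    also have "\<dots> = (\<integral>\<^sup>+H. ennreal (w s H * indicator A H) \<partial>\<mu>)"
      using w0 that(2) by (intro nn_integral_cong) (auto simp: indicator_def)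
    also have "\<dots> = ennreal (\<integral>H. w s H * indicator A H \<partial>\<mu>)"
      using w0 that by (intro nn_integral_eq_integral bm_integrable[OF bm_mult[OF bmw bm_indicator]] AE_I2) auto
    finally show ?thesis
      using w0 that by (simp add: measure_def integral_nonneg_AE)
  qed
  have nuI: "\<nu> s \<in> IRS G" if s: "\<bar>s\<bar> = 1" for s
  proof -
    have snu: "sets (\<nu> s) = sets \<mu>" "space (\<nu> s) = space \<mu>" by (simp_all add: \<nu>_def)
    have "emeasure (\<nu> s) (space (\<nu> s)) = (\<integral>\<^sup>+H. ennreal (w s H) \<partial>\<mu>)"
      unfolding snu \<nu>_def by (simp add: emeasure_density cong: nn_integral_cong)
    also have "\<dots> = 1"
      using w0 s by (subst nn_integral_eq_integral[OF bm_integrable[OF bmw]]) (auto simp: intw)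
    finally have "prob_space (\<nu> s)" by (rule prob_spaceI)
    then have P: "\<nu> s \<in> sub_prob G" using snu sp st by (simp add: sub_prob_def)
    show ?thesis unfolding IRS_iff[OF P]
    proof (intro ballI)
      fix g A assume g: "g \<in> carrier G" and A: "A \<in> sets (sub_borel G)"
      let ?A = "conj_subgroup G g -` A \<inter> {H. subgroup H G}"
      have A': "?A \<in> sets \<mu>"
        using measurable_sets[OF act_measurable[OF g], of A] A st sp by simp
      have "measure (\<nu> s) ?A = (\<integral>H. w s H * indicator ?A H \<partial>\<mu>)" by (rule mnu[OF A' s])
      \<comment> \<open>The density is invariant almost everywhere and may be evaluated at the
        conjugate; after that, invariance of \<mu> applies to the whole integrand.\<close>
      also have "\<dots> = (\<integral>H. w s (conj_subgroup G g H) * indicator A (conj_subgroup G g H) \<partial>\<mu>)"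
      proof (rule integral_cong_AE)
        show "(\<lambda>H. w s H * indicator ?A H) \<in> borel_measurable \<mu>" using A' by measurable
        show "(\<lambda>H. w s (conj_subgroup G g H) * indicator A (conj_subgroup G g H)) \<in> borel_measurable \<mu>"
          using A st by (intro bm_measurable bm_act[OF bm_mult[OF bmw bm_indicator] g]) auto
        show "AE H in \<mu>. w s H * indicator ?A H = w s (conj_subgroup G g H) * indicator A (conj_subgroup G g H)"
          using inv[OF g] AE_space
          by eventually_elim (auto simp: w_def sp indicator_def)
      qed
      also have "\<dots> = (\<integral>H. w s H * indicator A H \<partial>\<mu>)"
        using A st by (intro integral_act[OF bm_mult[OF bmw bm_indicator] g]) auto
      also have "\<dots> = measure (\<nu> s) A" using A st s by (simp add: mnu)
      finally show "measure (\<nu> s) ?A = measure (\<nu> s) A" .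
    qed
  qed
  have "measure \<mu> A = (1 / 2) * measure (\<nu> 1) A + (1 - 1 / 2) * measure (\<nu> (- 1)) A"
    if A: "A \<in> sets (sub_borel G)" for A
  proof -
    have A': "A \<in> sets \<mu>" using A st by simp
    have "measure (\<nu> 1) A + measure (\<nu> (- 1)) A = (\<integral>H. w 1 H * indicator A H + w (- 1) H * indicator A H \<partial>\<mu>)"
      using A' by (simp add: mnu)
        (intro Bochner_Integration.integral_add[symmetric] bm_integrable[OF bm_mult[OF bmw bm_indicator]])
    also have "\<dots> = (\<integral>H. 2 * indicator A H \<partial>\<mu>)"
      by (intro Bochner_Integration.integral_cong) (auto simp: w_def indicator_def simp flip: add_divide_distrib)
    finally show ?thesis using A' by simp
  qed
  then have mix: "0 < (1 / 2 :: real) \<and> (1 / 2 :: real) < 1 \<and> (\<forall>A\<in>sets (sub_borel G).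
      measure \<mu> A = (1 / 2) * measure (\<nu> 1) A + (1 - 1 / 2) * measure (\<nu> (- 1)) A)" by simp
  have "\<nu> 1 \<in> IRS G" "\<nu> (- 1) \<in> IRS G" using nuI by simp_all
  from conjunct2[OF erg[unfolded ergodic_IRS_def], rule_format, OF this mix]
  have "\<nu> 1 = \<mu>" ..
  then have "density \<mu> (\<lambda>H. ennreal (w 1 H)) = density \<mu> (\<lambda>H. 1)"
    by (simp add: \<nu>_def density_1)
  then have "AE H in \<mu>. ennreal (w 1 H) = 1"
    by (subst (asm) density_unique_iff) auto
  then show ?thesis
  proof eventually_elim
    case (elim H)
    then have "w 1 H = 1" by (simp add: ennreal_eq_1)
    then show ?case using D by (simp add: w_def c_def)
  qed
qed

end

section \<open>Weiss approximations\<close>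

text \<open>At stage \<open>i\<close> take the largest solvable level \<open>j \<le> i\<close>; the
  cap makes the maximum exist. Any fixed level is solvable from some stage on, hence eventually
  reached, and \<open>mono\<close> passes from the chosen level down to it.\<close>

lemma diagonal_choice:
  fixes P :: "nat \<Rightarrow> nat \<Rightarrow> 'k \<Rightarrow> bool"
  assumes ex: "\<And>j. \<exists>m. \<forall>i\<ge>m. \<exists>k. P i j k"
    and mono: "\<And>i j j' k. P i j k \<Longrightarrow> j' \<le> j \<Longrightarrow> P i j' k"
  shows "\<exists>K. \<forall>j. \<exists>m. \<forall>i\<ge>m. P i j (K i)"
proof -
  define J where "J i = Max {j. j \<le> i \<and> (\<exists>k. P i j k)}" for i
  define K where "K i = (SOME k. P i (J i) k)" for i
  have "\<exists>m. \<forall>i\<ge>m. P i j (K i)" for j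
  proof -
    obtain m where m: "\<And>i. i \<ge> m \<Longrightarrow> \<exists>k. P i j k" using ex[of j] by blast
    have "P i j (K i)" if i: "i \<ge> max m j" for i
    proof -
      let ?A = "{j. j \<le> i \<and> (\<exists>k. P i j k)}"
      have fin: "finite ?A" by (rule finite_subset[of _ "{..i}"]) auto
      have j: "j \<in> ?A" using m[of i] i by simp
      have "J i \<in> ?A" unfolding J_def using fin j by (intro Max_in) auto
      then have "P i (J i) (K i)" unfolding K_def by (auto intro: someI_ex)
      moreover have "j \<le> J i" unfolding J_def using fin j by (rule Max_ge)
      ultimately show ?thesis by (rule mono)
    qed
    then show ?thesis by blast
  qed
  then show ?thesis by blast
qed

text \<open>Everything the sequence provides, stated without a measure or a metric, so that one
  \<open>F\<close> serves all of them.\<close>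

locale tempered_equidistributed = group G for G :: "('a, 'b) monoid_scheme" (structure) +
  fixes F N :: "nat \<Rightarrow> 'a set"
  assumes finitely_generated: "finitely_generated_group G"
    and N_index: "finite_index_subgroup G (N i)"
    and N_decreasing: "N (Suc i) \<subseteq> N i"
    and N_cofinal: "finite_index_subgroup G K \<Longrightarrow> \<exists>i. N i \<subseteq> K"
    and F_equidistributed: "equidistributed (F i) (N i)"
    and F_tempered': "real (card ((\<Union>j<i. \<Union>f\<in>F j. inv f <# F i) - F i)) \<le> (1 / 2) ^ Suc i * card (F i)"
    and F_Folner': "g \<in> carrier G \<Longrightarrow> (\<lambda>i. real (card ((g <# F i) - F i)) / card (F i)) \<longlonglongrightarrow> 0"
begin

lemma F_props: "finite (F i)" "F i \<noteq> {}" "F i \<subseteq> carrier G"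
  using F_equidistributed[of i] equidistributed_nonempty by (auto simp: equidistributed_def)

lemma countable_windows: "countable {(B, S). finite B \<and> B \<subseteq> carrier G \<and> S \<subseteq> B}" (is "countable ?P")
proof (rule countable_subset)
  let ?Q = "{B. finite B \<and> B \<subseteq> carrier G}"
  show "?P \<subseteq> ?Q \<times> ?Q" by (auto intro: finite_subset)
  show "countable (?Q \<times> ?Q)"
    by (intro countable_SIGMA countable_Collect_finite_subset countable_carrier finitely_generated)
qed

lemma IRS_tempered_Folner_action:
  assumes "\<mu> \<in> IRS G" shows "tempered_Folner_action G \<mu> (conj_subgroup G) F"
proof -
  have "card ((\<Union>j<i. \<Union>f\<in>F j. inv f <# F i) - F i) \<le> card (F i)" for i
  proof -
    have "real (card ((\<Union>j<i. \<Union>f\<in>F j. inv f <# F i) - F i)) \<le> (1 / 2) ^ Suc i * card (F i)"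
      by (rule F_tempered')
    also have "\<dots> \<le> 1 * real (card (F i))" by (intro mult_right_mono power_le_one) auto
    finally show ?thesis by simp
  qed
  then show ?thesis
    unfolding tempered_Folner_action_def tempered_Folner_action_axioms_def
    using IRS_pmp_action[OF assms] F_props F_Folner' by blast
qed

lemma ergodic_IRS_Folner_action:
  assumes "ergodic_IRS G \<mu>" shows "ergodic_Folner_action G \<mu> (conj_subgroup G) F"
proof -
  have "\<mu> \<in> IRS G" using assms by (simp add: ergodic_IRS_def)
  then show ?thesis
    unfolding ergodic_Folner_action_def ergodic_Folner_action_axioms_def
    using IRS_tempered_Folner_action ergodic_IRS_invariant_function[OF assms] by blast
qed

text \<open>\<open>N i \<subseteq> K \<subseteq> normalizer G K\<close>, and equidistribution passes
  from \<open>N i\<close> to every larger subgroup.\<close>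

lemma transversals_normalizer:
  assumes K: "subgroup K G" "N i \<subseteq> K"
  shows "finite_union_of_transversals G (normalizer G K) (F i)"
proof (rule equidistributed_imp_transversals[OF _ subgroup_normalizer[OF K(1)]])
  have "subgroup (N i) G" using N_index by (simp add: finite_index_subgroup_def)
  then show "equidistributed (F i) (normalizer G K)"
    using K subset_normalizer[OF K(1)] by (intro equidistributed_mono[OF F_equidistributed _ subgroup_normalizer]) auto
qed

text \<open>The measure of a cylinder under \<open>conj_average\<close> is the ergodic average of
  its indicator. There are only countably many pairs of window and trace, so a single null set
  serves all of them.\<close>

lemma conj_averages_tendsto:
  assumes erg: "ergodic_IRS G \<mu>"
  shows "AE H in \<mu>. subgroup H G \<and> limitin (weak_star G) (\<lambda>i. conj_average G (F i) H) \<mu> sequentially"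
proof -
  interpret ergodic_Folner_action G \<mu> "conj_subgroup G" F
    by (rule ergodic_IRS_Folner_action[OF erg])
  have \<mu>: "\<mu> \<in> sub_prob G" using erg by (simp add: ergodic_IRS_def IRS_def)
  then have sp: "space \<mu> = {H. subgroup H G}" and st: "sets \<mu> = sets (sub_borel G)"
    by (auto simp: sub_prob_def)
  define P where "P = {(B, S). finite B \<and> B \<subseteq> carrier G \<and> S \<subseteq> B}"
  have cP: "countable P" unfolding P_def by (rule countable_windows)
  have "AE H in \<mu>. \<forall>p\<in>P. (\<lambda>i. avg i (indicator (cyl G (fst p) (snd p))) H) \<longlonglongrightarrow> measure \<mu> (cyl G (fst p) (snd p))"
    unfolding AE_ball_countable[OF cP]
  proof
    fix p assume "p \<in> P"
    then have c: "cyl G (fst p) (snd p) \<in> sets \<mu>" unfolding st by (intro cyl_sets) (auto simp: P_def)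
    have "AE H in \<mu>. (\<lambda>i. avg i (indicator (cyl G (fst p) (snd p))) H) \<longlonglongrightarrow>
        (\<integral>H. indicator (cyl G (fst p) (snd p)) H \<partial>\<mu>)"
      by (rule pointwise_ergodic[OF bm_indicator[OF c]])
    then show "AE H in \<mu>. (\<lambda>i. avg i (indicator (cyl G (fst p) (snd p))) H) \<longlonglongrightarrow> measure \<mu> (cyl G (fst p) (snd p))"
      using c by simp
  qed
  then show ?thesis using AE_space
  proof eventually_elim
    case (elim H)
    then have H: "subgroup H G" by (simp add: sp)
    have "limitin (weak_star G) (\<lambda>i. conj_average G (F i) H) \<mu> sequentially"
    proof (rule limitin_weak_starI[OF conj_average_sub_prob[OF F_props H] \<mu>])
      fix B S assume BS: "finite B" "B \<subseteq> carrier G" "S \<subseteq> B"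
      then have "(\<lambda>i. avg i (indicator (cyl G B S)) H) \<longlonglongrightarrow> measure \<mu> (cyl G B S)"
        using elim(1) by (force simp: P_def)
      then show "(\<lambda>i. measure (conj_average G (F i) H) (cyl G B S)) \<longlonglongrightarrow> measure \<mu> (cyl G B S)"
        by (simp add: measure_conj_average[OF F_props(1,2) cyl_sets[OF BS(1,2)]] avg_def)
    qed
    then show ?case using H by blast
  qed
qed

text \<open>A Milman-type step: by the mean ergodic theorem the averages of the cylinder indicators are
  \<open>\<mu>\<close>-nearly constant, hence nearly constant for a nearby finite index random subgroup, and
  therefore for the uniform measure on the conjugates of one of its values.\<close>

lemma cosofic_imp_single_class:
  assumes erg: "ergodic_IRS G \<mu>" and cos: "cosofic G \<mu>"
    and P: "finite P" "\<And>B S. (B, S) \<in> P \<Longrightarrow> finite B \<and> B \<subseteq> carrier G \<and> S \<subseteq> B" and e: "0 < (e::real)"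
  shows "\<exists>m. \<forall>i\<ge>m. \<exists>K. subgroup K G \<and> N i \<subseteq> K \<and>
    (\<forall>(B, S)\<in>P. \<bar>measure (conj_average G (F i) K) (cyl G B S) - measure \<mu> (cyl G B S)\<bar> < e)"
proof -
  interpret M: ergodic_Folner_action G \<mu> "conj_subgroup G" F
    by (rule ergodic_IRS_Folner_action[OF erg])
  have \<mu>: "\<mu> \<in> sub_prob G" using erg by (simp add: ergodic_IRS_def IRS_def)
  then have sp: "space \<mu> = {H. subgroup H G}" and st: "sets \<mu> = sets (sub_borel G)"
    by (auto simp: sub_prob_def)
  define I where "I p = (indicator (cyl G (fst p) (snd p)) :: 'a set \<Rightarrow> real)" for p
  define c where "c p = measure \<mu> (cyl G (fst p) (snd p))" for p
  have cs: "cyl G (fst p) (snd p) \<in> sets (sub_borel G)" if "p \<in> P" for p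
    using P(2)[of "fst p" "snd p"] that by (intro cyl_sets) auto
  have I01: "0 \<le> I p H" "I p H \<le> 1" for p H by (auto simp: I_def indicator_def)
  have c01: "0 \<le> c p" "c p \<le> 1" for p by (auto simp: c_def)
  \<comment> \<open>Squares are used so that convexity can pull an average inside at the end; the
    sum over \<open>P\<close> lets one number control all cylinders at once.\<close>
  define \<psi> where "\<psi> n p H = (M.avg n (I p) H - c p)\<^sup>2" for n p H
  define \<Psi> where "\<Psi> n H = (\<Sum>p\<in>P. \<psi> n p H)" for n H
  have avg01: "0 \<le> M.avg n (I p) H" "M.avg n (I p) H \<le> 1" for n p H
  proof -
    show "0 \<le> M.avg n (I p) H" unfolding M.avg_def by (intro divide_nonneg_nonneg sum_nonneg I01) auto
    have "(\<Sum>g\<in>F n. I p (conj_subgroup G g H)) \<le> (\<Sum>g\<in>F n. 1)" by (intro sum_mono I01)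
    then show "M.avg n (I p) H \<le> 1" unfolding M.avg_def using M.card_F_pos[of n] by simp
  qed
  have psi01: "0 \<le> \<psi> n p H" "\<psi> n p H \<le> 1" for n p H
  proof -
    show "0 \<le> \<psi> n p H" by (simp add: \<psi>_def)
    have "\<bar>M.avg n (I p) H - c p\<bar> \<le> 1" using avg01[of n p H] c01[of p] by linarith
    then show "\<psi> n p H \<le> 1" unfolding \<psi>_def by (simp add: abs_square_le_1)
  qed
  have bmI: "M.bounded_meas (I p)" if "p \<in> P" for p unfolding I_def using cs[OF that] st by (intro M.bm_indicator) simp
  have bmPsi: "M.bounded_meas (\<Psi> n)" for n
  proof -
    have "M.bounded_meas (\<lambda>H. \<Sum>p\<in>P. (M.avg n (I p) H - c p)\<^sup>2)"
      by (rule M.bm_sum, rule M.bm_power2, rule M.bm_diff[OF M.bm_avg[OF bmI] M.bm_const])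
    then show ?thesis unfolding \<Psi>_def \<psi>_def .
  qed
  have "(\<lambda>n. \<integral>H. \<Psi> n H \<partial>\<mu>) \<longlonglongrightarrow> (\<integral>H. 0 \<partial>\<mu>)"
  proof (rule integral_dominated_convergence[where w = "\<lambda>_. real (card P)"])
    show "\<Psi> n \<in> borel_measurable \<mu>" for n by (rule M.bm_measurable[OF bmPsi])
    have "AE H in \<mu>. \<forall>p\<in>P. (\<lambda>n. M.avg n (I p) H) \<longlonglongrightarrow> c p"
    proof (rule AE_finite_allI[OF P(1)])
      fix p assume p: "p \<in> P"
      have "(\<integral>H. I p H \<partial>\<mu>) = c p" unfolding I_def c_def using cs[OF p] st by simp
      then show "AE H in \<mu>. (\<lambda>n. M.avg n (I p) H) \<longlonglongrightarrow> c p"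
        using M.pointwise_ergodic[OF bmI[OF p]] by simp
    qed
    then show "AE H in \<mu>. (\<lambda>n. \<Psi> n H) \<longlonglongrightarrow> 0"
    proof eventually_elim
      case (elim H)
      have "(\<lambda>n. \<Psi> n H) \<longlonglongrightarrow> (\<Sum>p\<in>P. (c p - c p)\<^sup>2)"
        unfolding \<Psi>_def \<psi>_def using elim by (intro tendsto_sum tendsto_power tendsto_diff tendsto_const) auto
      then show ?case by simp
    qed
    show "AE H in \<mu>. norm (\<Psi> n H) \<le> real (card P)" for n
    proof (rule AE_I2)
      fix H
      have "\<Psi> n H \<le> (\<Sum>p\<in>P. 1)" unfolding \<Psi>_def by (intro sum_mono psi01)
      moreover have "0 \<le> \<Psi> n H" unfolding \<Psi>_def by (intro sum_nonneg psi01)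
      ultimately show "norm (\<Psi> n H) \<le> real (card P)" by simp
    qed
  qed auto
  then have lim0: "(\<lambda>n. \<integral>H. \<Psi> n H \<partial>\<mu>) \<longlonglongrightarrow> 0" by simp
  \<comment> \<open>The bound to be reached is \<open>e\<^sup>2\<close>; the factor one half pays
    for the set \<open>D i\<close>, of which only mass above one half is known.\<close>
  have "0 < e\<^sup>2 / 2" using e by simp
  from eventually_happens'[OF sequentially_bot order_tendstoD(2)[OF lim0 this]]
  obtain n where n: "(\<integral>H. \<Psi> n H \<partial>\<mu>) < e\<^sup>2 / 2" by blast
  let ?c = "\<lambda>g x. inv g \<otimes> x \<otimes> g"
  define W where "W = (\<Union>p\<in>P. \<Union>g\<in>F n. ?c g ` fst p)"
  have fp: "finite (fst p)" "snd p \<subseteq> fst p" "fst p \<subseteq> carrier G" if "p \<in> P" for p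
    using P(2)[of "fst p" "snd p"] that by auto
  have W: "finite W" unfolding W_def using P(1) F_props(1) fp(1) by auto
  have Wc: "W \<subseteq> carrier G"
    unfolding W_def by (intro UN_least conj_image_carrier fp(3) M.F_in)
  \<comment> \<open>Being determined by the finite window \<open>W\<close>, \<open>\<Psi> n\<close>
    is continuous, so the smallness of its integral is a weak-* open condition and holds for some
    finite index random subgroup \<nu>.\<close>
  have win: "\<Psi> n H = \<Psi> n K" if HK: "subgroup H G" "subgroup K G" "H \<inter> W = K \<inter> W" for H K
  proof -
    have "I p (conj_subgroup G g H) = I p (conj_subgroup G g K)" if pg: "p \<in> P" "g \<in> F n" for p g
    proof -
      have gc: "g \<in> carrier G" using pg F_props by auto
      note BS = fp(2,3)[OF pg(1)]
      have "?c g ` fst p \<subseteq> W" unfolding W_def using pg by blast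
      then have "H \<inter> ?c g ` fst p = K \<inter> ?c g ` fst p" using HK(3) by blast
      then show ?thesis
        unfolding I_def indicator_def conj_subgroup_in_cyl_iff[OF HK(1) gc BS] conj_subgroup_in_cyl_iff[OF HK(2) gc BS]
        using HK by (simp add: cyl_def)
    qed
    then show ?thesis unfolding \<Psi>_def \<psi>_def M.avg_def by simp
  qed
  have contPsi: "continuous_map (chabauty G) euclideanreal (\<Psi> n)"
    using W Wc win by (rule continuous_map_chabautyI)
  let ?T = "{\<mu> \<in> sub_prob G. (\<integral>H. \<Psi> n H \<partial>\<mu>) \<in> {..<e\<^sup>2 / 2}}"
  have "openin (weak_star G) ?T"
    unfolding weak_star_def
    by (rule topology_generated_by_Basis, rule CollectI)
      (intro exI[of _ "\<Psi> n"] exI[of _ "{..<e\<^sup>2 / 2}"] conjI refl contPsi open_lessThan)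
  moreover have "\<mu> \<in> ?T" using n \<mu> by simp
  moreover have "\<forall>U. \<mu> \<in> U \<and> openin (weak_star G) U \<longrightarrow> (\<exists>\<nu>. \<nu> \<in> IRS_fi G \<and> \<nu> \<in> U)"
    using cos unfolding cosofic_def in_closure_of by (elim conjE)
  ultimately have "\<exists>\<nu>. \<nu> \<in> IRS_fi G \<and> \<nu> \<in> ?T" by (elim allE[of _ ?T]) (rule mp, assumption, rule conjI)
  then obtain \<nu> where nu: "\<nu> \<in> IRS_fi G" "\<nu> \<in> ?T" by (elim exE conjE)
  have nuI: "\<nu> \<in> IRS G" and nufi: "measure \<nu> {H. finite_index_subgroup G H} = 1"
    using nu(1) by (auto simp: IRS_fi_def)
  interpret N: tempered_Folner_action G \<nu> "conj_subgroup G" F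
    by (rule IRS_tempered_Folner_action[OF nuI])
  have spn: "space \<nu> = {H. subgroup H G}" and stn: "sets \<nu> = sets (sub_borel G)"
    using nu(2) by (auto simp: sub_prob_def)
  have bmPsiN: "N.bounded_meas (\<Psi> n)"
  proof -
    have "N.bounded_meas (\<lambda>H. \<Sum>p\<in>P. (N.avg n (I p) H - c p)\<^sup>2)"
    proof (rule N.bm_sum, rule N.bm_power2, rule N.bm_diff[OF N.bm_avg N.bm_const])
      show "N.bounded_meas (I p)" if "p \<in> P" for p unfolding I_def using cs[OF that] stn by (intro N.bm_indicator) simp
    qed
    then show ?thesis unfolding \<Psi>_def \<psi>_def .
  qed
  \<comment> \<open>These sets increase and exhaust the finite index subgroups, so they fill up
    \<nu>. The resulting \<open>m\<close> depends on \<nu>, hence on \<open>P\<close> and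
    \<open>e\<close>.\<close>
  define D where "D i = {K. subgroup K G \<and> N i \<subseteq> K}" for i
  have Ds: "D i \<in> sets \<nu>" for i
    unfolding D_def stn using N_index[of i]
    by (intro supergroups_sets_sub_borel) (auto simp: finite_index_subgroup_def dest: subgroup.subset)
  have "incseq D" by (rule incseq_SucI) (use N_decreasing in \<open>auto simp: D_def\<close>)
  then have "(\<lambda>i. measure \<nu> (D i)) \<longlonglongrightarrow> measure \<nu> (\<Union>i. D i)"
    using Ds by (intro N.finite_Lim_measure_incseq) auto
  moreover have "measure \<nu> (\<Union>i. D i) = 1"
  proof -
    have "{H. finite_index_subgroup G H} \<subseteq> (\<Union>i. D i)"
      using N_cofinal by (auto simp: D_def finite_index_subgroup_def)
    then have "1 \<le> measure \<nu> (\<Union>i. D i)"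
      unfolding nufi[symmetric] using Ds by (intro N.finite_measure_mono) auto
    then show ?thesis using N.prob_le_1 by (simp add: antisym)
  qed
  ultimately have "\<forall>\<^sub>F i in sequentially. 1 / 2 < measure \<nu> (D i)"
    using order_tendstoD(1)[of "\<lambda>i. measure \<nu> (D i)" 1 sequentially "1 / 2"] by simp
  then obtain m where m: "\<And>i. i \<ge> m \<Longrightarrow> 1 / 2 < measure \<nu> (D i)"
    by (auto simp: eventually_sequentially)
  have "\<exists>K. subgroup K G \<and> N i \<subseteq> K \<and>
      (\<forall>(B, S)\<in>P. \<bar>measure (conj_average G (F i) K) (cyl G B S) - measure \<mu> (cyl G B S)\<bar> < e)" if i: "i \<ge> m" for i
  proof -
    \<comment> \<open>Averaging over \<open>F i\<close> preserves the integral with respect to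
      \<nu>, so the average cannot be at least \<open>e\<^sup>2\<close> on a set of mass above one
      half.\<close>
    have "\<exists>K\<in>D i. N.avg i (\<Psi> n) K < e\<^sup>2"
    proof (rule ccontr)
      assume "\<not> ?thesis"
      then have ge: "e\<^sup>2 \<le> N.avg i (\<Psi> n) K" if "K \<in> D i" for K using that by (meson not_le)
      have nn: "0 \<le> N.avg i (\<Psi> n) K" for K
        unfolding N.avg_def \<Psi>_def by (intro divide_nonneg_nonneg sum_nonneg psi01) auto
      have "e\<^sup>2 * (1 / 2) < e\<^sup>2 * measure \<nu> (D i)" using m[OF i] e by simp
      also have "\<dots> = (\<integral>K. e\<^sup>2 * indicator (D i) K \<partial>\<nu>)" using Ds by simp
      also have "\<dots> \<le> (\<integral>K. N.avg i (\<Psi> n) K \<partial>\<nu>)"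
        by (rule N.integral_mono_bm[OF N.bm_mult[OF N.bm_const N.bm_indicator[OF Ds]] N.bm_avg[OF bmPsiN]])
          (use ge nn in \<open>auto simp: indicator_def\<close>)
      also have "\<dots> = (\<integral>K. \<Psi> n K \<partial>\<nu>)" by (rule N.integral_avg[OF bmPsiN])
      also have "\<dots> < e\<^sup>2 / 2" using nu(2) by simp
      finally show False by simp
    qed
    then obtain K where K: "subgroup K G" "N i \<subseteq> K" and lt: "N.avg i (\<Psi> n) K < e\<^sup>2"
      by (auto simp: D_def)
    note tr = transversals_normalizer[OF K]
    have "\<bar>measure (conj_average G (F i) K) (cyl G B S) - measure \<mu> (cyl G B S)\<bar> < e" if p: "(B, S) \<in> P" for B S
    proof -
      let ?p = "(B, S)"
      let ?J = "\<lambda>f. I ?p (conj_subgroup G f K)"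
      define a where "a = (\<Sum>f\<in>F i. ?J f) / card (F i)"
      \<comment> \<open>Averaging first over \<open>F n\<close> does not change the average over the
        conjugacy class of \<open>K\<close>, because \<open>F i\<close> is exactly a union of
        transversals of its normalizer.\<close>
      have "a = N.avg i (N.avg n (I ?p)) K"
      proof -
        have "N.avg i (N.avg n (I ?p)) K = (\<Sum>f\<in>F i. \<Sum>g\<in>F n. I ?p (conj_subgroup G g (conj_subgroup G f K)))
            / card (F n) / card (F i)"
          unfolding N.avg_def by (simp add: sum_divide_distrib)
        also have "(\<Sum>f\<in>F i. \<Sum>g\<in>F n. I ?p (conj_subgroup G g (conj_subgroup G f K))) =
            (\<Sum>g\<in>F n. \<Sum>f\<in>F i. ?J (g \<otimes> f))"
        proof (subst sum.swap, intro sum.cong refl)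
          fix g f assume "g \<in> F n" "f \<in> F i"
          then have "g \<in> carrier G" "f \<in> carrier G" using F_props by auto
          then show "I ?p (conj_subgroup G g (conj_subgroup G f K)) = ?J (g \<otimes> f)"
            by (simp add: conj_subgroup_mult[OF K(1)])
        qed
        also have "\<dots> = (\<Sum>g\<in>F n. \<Sum>f\<in>F i. ?J f)"
        proof (rule sum.cong[OF refl])
          fix g assume "g \<in> F n"
          then have g: "g \<in> carrier G" using F_props by auto
          show "(\<Sum>f\<in>F i. ?J (g \<otimes> f)) = (\<Sum>f\<in>F i. ?J f)"
            by (rule sum_union_transversals_translate[OF subgroup_normalizer[OF K(1)] tr F_props(1) _ g])
              (simp add: conj_subgroup_mult_normalizer[OF K(1)])
        qed
        also have "\<dots> / card (F n) / card (F i) = a" using M.card_F_pos[of n] by (simp add: a_def)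
        finally show ?thesis by simp
      qed
      then have "a - c ?p = (\<Sum>f\<in>F i. N.avg n (I ?p) (conj_subgroup G f K) - c ?p) / card (F i)"
        using M.card_F_pos[of i] by (simp add: N.avg_def[of i] sum_subtractf diff_divide_distrib)
      then have "(a - c ?p)\<^sup>2 = (\<Sum>f\<in>F i. N.avg n (I ?p) (conj_subgroup G f K) - c ?p)\<^sup>2 / (card (F i))\<^sup>2"
        by (simp add: power_divide)
      \<comment> \<open>Jensen's inequality for the square: near constancy of the inner averages on
        the class forces its mean near \<open>c ?p\<close>.\<close>
      also have "\<dots> \<le> (card (F i) * (\<Sum>f\<in>F i. \<psi> n ?p (conj_subgroup G f K))) / (card (F i))\<^sup>2"
        unfolding \<psi>_def
        using sum_squared_le_sum_of_squares[of "\<lambda>f. N.avg n (I ?p) (conj_subgroup G f K) - c ?p" "F i"]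
        by (intro divide_right_mono) (auto simp: mult.commute)
      also have "\<dots> = N.avg i (\<psi> n ?p) K"
        using M.card_F_pos[of i] by (simp add: N.avg_def power2_eq_square)
      also have "\<dots> \<le> N.avg i (\<Psi> n) K"
        unfolding N.avg_def \<Psi>_def using P(1) p psi01
        by (intro divide_right_mono sum_mono member_le_sum) auto
      also have "\<dots> < e\<^sup>2" by (rule lt)
      finally have "\<bar>a - c ?p\<bar>\<^sup>2 < e\<^sup>2" by simp
      then have "\<bar>a - c ?p\<bar> < e" by (rule power2_less_imp_less) (use e in simp)
      moreover have "measure (conj_average G (F i) K) (cyl G B S) = a"
        using cs[OF p] by (simp add: measure_conj_average[OF F_props(1,2)] a_def I_def)
      ultimately show ?thesis by (simp add: c_def)
    qed
    then show ?thesis using K by blast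
  qed
  then show ?thesis by blast
qed

text \<open>Level \<open>j\<close> asks for the first \<open>j + 1\<close> pairs of an enumeration
  with tolerance \<open>1 / (j + 1)\<close>; the diagonal choice meets every level
  eventually.\<close>

lemma cosofic_imp_approximation:
  assumes erg: "ergodic_IRS G \<mu>" and cos: "cosofic G \<mu>"
  obtains K where "\<And>i. finite_index_subgroup G (K i)"
    "\<And>i. finite_union_of_transversals G (normalizer G (K i)) (F i)"
    "limitin (weak_star G) (\<lambda>i. conj_average G (F i) (K i)) \<mu> sequentially"
proof -
  have \<mu>: "\<mu> \<in> sub_prob G" using erg by (simp add: ergodic_IRS_def IRS_def)
  define P where "P = {(B, S). finite B \<and> B \<subseteq> carrier G \<and> S \<subseteq> B}"
  have cP: "countable P" unfolding P_def by (rule countable_windows)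
  have Pne: "P \<noteq> {}" by (auto simp: P_def)
  define p where "p = from_nat_into P"
  have p: "p n \<in> P" for n unfolding p_def by (rule from_nat_into[OF Pne])
  define R where "R i j K \<longleftrightarrow> subgroup K G \<and> N i \<subseteq> K \<and> (\<forall>(B, S)\<in>p ` {..j}.
    \<bar>measure (conj_average G (F i) K) (cyl G B S) - measure \<mu> (cyl G B S)\<bar> < inverse (real (Suc j)))" for i j K
  have "\<exists>K. \<forall>j. \<exists>m. \<forall>i\<ge>m. R i j (K i)"
  proof (rule diagonal_choice)
    show "\<exists>m. \<forall>i\<ge>m. \<exists>K. R i j K" for j
      unfolding R_def
    proof (rule cosofic_imp_single_class[OF erg cos])
      show "finite B \<and> B \<subseteq> carrier G \<and> S \<subseteq> B" if "(B, S) \<in> p ` {..j}" for B S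
      proof -
        have "(B, S) \<in> P" using that p by auto
        then show ?thesis by (simp add: P_def)
      qed
    qed auto
    fix i j j' K assume R: "R i j K" and j: "j' \<le> j"
    have "inverse (real (Suc j)) \<le> inverse (real (Suc j'))" using j by (intro le_imp_inverse_le) auto
    then have less: "x < inverse (real (Suc j'))" if "x < inverse (real (Suc j))" for x using that by linarith
    have "p ` {..j'} \<subseteq> p ` {..j}" using j by auto
    then show "R i j' K" using R unfolding R_def by (blast intro: less)
  qed
  then obtain K where K: "\<And>j. \<exists>m. \<forall>i\<ge>m. R i j (K i)" by blast
  \<comment> \<open>At the finitely many early indices where the diagonal sequence guarantees
    nothing, the whole group is taken, so that finite index and transversality hold at every
    index.\<close>
  define L where "L i = (if subgroup (K i) G \<and> N i \<subseteq> K i then K i else carrier G)" for i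
  have Ncar: "N i \<subseteq> carrier G" for i
    using N_index[of i] by (auto simp: finite_index_subgroup_def dest: subgroup.subset)
  have L: "subgroup (L i) G" "N i \<subseteq> L i" for i using subgroup_self Ncar by (auto simp: L_def)
  show thesis
  proof (rule that)
    show "finite_index_subgroup G (L i)" for i by (rule finite_index_mono[OF N_index L(2) L(1)])
    show "finite_union_of_transversals G (normalizer G (L i)) (F i)" for i
      by (rule transversals_normalizer[OF L])
    show "limitin (weak_star G) (\<lambda>i. conj_average G (F i) (L i)) \<mu> sequentially"
    proof (rule limitin_weak_starI[OF conj_average_sub_prob[OF F_props L(1)] \<mu>])
      fix B S assume "finite B" "B \<subseteq> carrier G" "S \<subseteq> B"
      then have "(B, S) \<in> P" by (simp add: P_def)
      then obtain n where n: "p n = (B, S)" unfolding p_def using from_nat_into_surj[OF cP] by blast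
      show "(\<lambda>i. measure (conj_average G (F i) (L i)) (cyl G B S)) \<longlonglongrightarrow> measure \<mu> (cyl G B S)"
      proof (rule LIMSEQ_I)
        fix r :: real assume r: "0 < r"
        obtain j0 where j0: "inverse (real (Suc j0)) < r" using reals_Archimedean[OF r] by blast
        define j where "j = max j0 n"
        have "inverse (real (Suc j)) \<le> inverse (real (Suc j0))"
          unfolding j_def by (intro le_imp_inverse_le) auto
        then have jr: "inverse (real (Suc j)) < r" using j0 by linarith
        have "p n \<in> p ` {..j}" by (rule imageI) (simp add: j_def)
        then have inj: "(B, S) \<in> p ` {..j}" using n by simp
        obtain m where m: "\<And>i. i \<ge> m \<Longrightarrow> R i j (K i)" using K[of j] by blast
        have "norm (measure (conj_average G (F i) (L i)) (cyl G B S) - measure \<mu> (cyl G B S)) < r" if "i \<ge> m" for i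
        proof -
          have Ri: "R i j (K i)" by (rule m[OF that])
          then have "L i = K i" by (simp add: L_def R_def)
          moreover have "\<bar>measure (conj_average G (F i) (K i)) (cyl G B S) - measure \<mu> (cyl G B S)\<bar> < inverse (real (Suc j))"
            using Ri inj unfolding R_def by blast
          ultimately show ?thesis using jr by simp
        qed
        then show "\<exists>m. \<forall>i\<ge>m. norm (measure (conj_average G (F i) (L i)) (cyl G B S) - measure \<mu> (cyl G B S)) < r"
          by blast
      qed
    qed
  qed
qed

text \<open>For almost every \<open>H\<close> the averages over its conjugates tend to \<mu>, so
  being close to them and being close to \<mu> amount to the same. Forwards, one sequence
  \<open>K\<close> serves almost every \<open>H\<close>; backwards, a single good \<open>H\<close>
  is enough.\<close>

lemma cosofic_iff_Weiss_approximated: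
  assumes d: "compatible_metric G d" and erg: "ergodic_IRS G \<mu>"
  shows "cosofic G \<mu> \<longleftrightarrow> (AE H in \<mu>. \<exists>K. Weiss_approximation G d H K F)"
proof -
  interpret D: Metric_space "sub_prob G" d using d by (simp add: compatible_metric_def)
  have "\<mu> \<in> IRS G" using erg by (simp add: ergodic_IRS_def)
  then have \<mu>: "\<mu> \<in> sub_prob G" by (simp add: IRS_def)
  interpret prob_space \<mu> using \<mu> by (simp add: sub_prob_def)
  have top: "weak_star G = D.mtopology" using d by (simp add: compatible_metric_def)
  note sub = conj_average_sub_prob[OF F_props]
  have lim_iff: "limitin (weak_star G) (\<lambda>i. conj_average G (F i) (L i)) \<mu> sequentially \<longleftrightarrow>
      (\<lambda>i. d (conj_average G (F i) (L i)) \<mu>) \<longlonglongrightarrow> 0" if "\<And>i. subgroup (L i) G" for L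
    unfolding top D.limitin_metric_dist_null using \<mu> sub[OF that] by simp
  note lim = conj_averages_tendsto[OF erg]
  show ?thesis
  proof
    assume cos: "cosofic G \<mu>"
    obtain K where K: "\<And>i. finite_index_subgroup G (K i)"
      "\<And>i. finite_union_of_transversals G (normalizer G (K i)) (F i)"
      "limitin (weak_star G) (\<lambda>i. conj_average G (F i) (K i)) \<mu> sequentially"
      using cosofic_imp_approximation[OF erg cos] by blast
    have sK: "subgroup (K i) G" for i using K(1) by (simp add: finite_index_subgroup_def)
    show "AE H in \<mu>. \<exists>K. Weiss_approximation G d H K F"
      using lim
    proof eventually_elim
      case (elim H)
      then have H: "subgroup H G" by blast
      have limH: "(\<lambda>i. d (conj_average G (F i) H) \<mu>) \<longlonglongrightarrow> 0"
        using elim lim_iff[of "\<lambda>_. H"] by simp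
      have "(\<lambda>i. d (conj_average G (F i) (K i)) \<mu>) \<longlonglongrightarrow> 0"
        using K(3) lim_iff[of K, OF sK] by simp
      from tendsto_add[OF this limH]
      have "(\<lambda>i. d (conj_average G (F i) (K i)) \<mu> + d (conj_average G (F i) H) \<mu>) \<longlonglongrightarrow> 0" by simp
      then have "(\<lambda>i. d (conj_average G (F i) (K i)) (conj_average G (F i) H)) \<longlonglongrightarrow> 0"
        by (rule Lim_null_comparison[rotated]) (simp add: D.triangle'[OF sub[OF sK] \<mu> sub[OF H]])
      then show ?case unfolding Weiss_approximation_def using K(1,2) by blast
    qed
  next
    assume "AE H in \<mu>. \<exists>K. Weiss_approximation G d H K F"
    with lim have "AE H in \<mu>. subgroup H G \<and> limitin (weak_star G) (\<lambda>i. conj_average G (F i) H) \<mu> sequentially \<and>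
        (\<exists>K. Weiss_approximation G d H K F)" by eventually_elim blast
    from eventually_happens'[OF ae_filter_bot this] obtain H K where H: "subgroup H G"
      "limitin (weak_star G) (\<lambda>i. conj_average G (F i) H) \<mu> sequentially" "Weiss_approximation G d H K F"
      by blast
    have K: "finite_index_subgroup G (K i)" "finite_union_of_transversals G (normalizer G (K i)) (F i)" for i
      using H(3) by (auto simp: Weiss_approximation_def)
    have sK: "subgroup (K i) G" for i using K(1) by (simp add: finite_index_subgroup_def)
    have "(\<lambda>i. d (conj_average G (F i) (K i)) (conj_average G (F i) H)) \<longlonglongrightarrow> 0"
      using H(3) by (simp add: Weiss_approximation_def)
    moreover have "(\<lambda>i. d (conj_average G (F i) H) \<mu>) \<longlonglongrightarrow> 0"
      using H(1,2) lim_iff[of "\<lambda>_. H"] by simp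
    ultimately have "(\<lambda>i. d (conj_average G (F i) (K i)) (conj_average G (F i) H)
        + d (conj_average G (F i) H) \<mu>) \<longlonglongrightarrow> 0" using tendsto_add by fastforce
    then have "(\<lambda>i. d (conj_average G (F i) (K i)) \<mu>) \<longlonglongrightarrow> 0"
      by (rule Lim_null_comparison[rotated]) (simp add: D.triangle[OF sub[OF sK] sub[OF H(1)] \<mu>])
    then have "limitin (weak_star G) (\<lambda>i. conj_average G (F i) (K i)) \<mu> sequentially"
      using lim_iff[of K, OF sK] by simp
    then have ev: "\<forall>\<^sub>F i in sequentially. conj_average G (F i) (K i) \<in> U"
      if "openin (weak_star G) U" "\<mu> \<in> U" for U
      using that unfolding limitin_def by blast
    have "\<mu> \<in> weak_star G closure_of IRS_fi G"
      unfolding in_closure_of topspace_weak_star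
    proof (intro conjI allI impI \<mu>)
      fix U assume "\<mu> \<in> U \<and> openin (weak_star G) U"
      then have "\<forall>\<^sub>F i in sequentially. conj_average G (F i) (K i) \<in> U" by (intro ev) auto
      from eventually_happens'[OF sequentially_bot this]
      obtain i where "conj_average G (F i) (K i) \<in> U" by blast
      then show "\<exists>\<nu>. \<nu> \<in> IRS_fi G \<and> \<nu> \<in> U"
        using conj_average_IRS_fi[OF finitely_generated F_props K] by blast
    qed
    then show "cosofic G \<mu>" using \<open>\<mu> \<in> IRS G\<close> by (simp add: cosofic_def)
  qed
qed

end

theorem theorem1p8:
  fixes G :: "('a, 'b) monoid_scheme"
  assumes "group G"
    and "finitely_generated_group G"
    and "residually_finite_group G"
    and "amenable_group G"
  shows "\<exists>F :: nat \<Rightarrow> 'a set.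
           (\<forall>i. finite (F i) \<and> F i \<subseteq> carrier G) \<and>
           (\<forall>d. compatible_metric G d \<longrightarrow>
             (\<forall>\<mu>. ergodic_IRS G \<mu> \<longrightarrow>
               (cosofic G \<mu> \<longleftrightarrow>
                 (AE H in \<mu>. \<exists>K :: nat \<Rightarrow> 'a set. Weiss_approximation G d H K F))))"
proof -
  interpret group G by fact
  obtain F N where FN: "\<And>i. finite_index_subgroup G (N i)" "\<And>i. N (Suc i) \<subseteq> N i"
    "\<And>K. finite_index_subgroup G K \<Longrightarrow> \<exists>i. N i \<subseteq> K"
    "\<And>i. equidistributed (F i) (N i)"
    "\<And>i. real (card ((\<Union>j<i. \<Union>f\<in>F j. inv\<^bsub>G\<^esub> f <#\<^bsub>G\<^esub> F i) - F i)) \<le> (1 / 2) ^ Suc i * card (F i)"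
    "\<And>g. g \<in> carrier G \<Longrightarrow> (\<lambda>i. real (card ((g <#\<^bsub>G\<^esub> F i) - F i)) / card (F i)) \<longlonglongrightarrow> 0"
    by (rule ex_tempered_Folner_sequence[OF assms(2,4)]) (rule that)
  interpret tempered_equidistributed G F N
    by unfold_locales (fact assms(2) FN)+
  show ?thesis using F_props(1,3) cosofic_iff_Weiss_approximated by blast
qed

end
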